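(* Let $d,n\in\mathbb{N}$ with $d,n\ge 1$, and let $n' = \lfloor n^2/4\rfloor+1$. There is a constant $C_{d,n}$ with $$C_{d,n} \le \bigl(2\min\bigl(C(d)\sqrt{d},\, C(n')\sqrt{n'}\bigr)\bigr)^{n-1}$$ such that for every commuting row contraction $T=(T_1,\ldots,T_d)$ consisting of $n\times n$ complex matrices and every $p\in\mathbb{C}[z_1,\ldots,z_d]$, $$\|p(T)\|\le C_{d,n}\|p\|_\infty .$$
   Context: $\mathbb{B}_d$ is the open Euclidean unit ball of $\mathbb{C}^d$ and $\|p\|_\infty=\sup_{z\in\mathbb{B}_d}|p(z)|$. A tuple $T=(T_1,\ldots,T_d)$ of commuting $n\times n$ matrices is a commuting row contraction if $\|\sum_{i=1}^d T_iT_i^*\|^{1/2}\le 1$. $H^\infty(\mathbb{B}_k)$ is the algebra of bounded holomorphic functions on $\mathbb{B}_k$ with the supremum norm. For each integer $k\ge1$, $C(k)>0$ denotes a constant (such constants exist) with the following property (Gleason's problem): for every $f\in H^\infty(\mathbb{B}_k)$ with $f(0)=0$ there exist $f_1,\ldots,f_k\in H^\infty(\mathbb{B}_k)$ with $f=\sum_{i=1}^k z_if_i$ and $\|f_i\|_\infty\le C(k)\|f\|_\infty$ for all $i$. *)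

theory Defs
  imports
    Complex_Main
    "HOL-Analysis.L2_Norm"
    "HOL-Library.Poly_Mapping"
    "Jordan_Normal_Form.Schur_Decomposition"
begin

text \<open>
  Points of $\mathbb{C}^k$ are elements of \<^term>\<open>carrier_vec k\<close> and $n \times n$ matrices are
  elements of \<^term>\<open>carrier_mat n n\<close>, so that all dimensions are ordinary natural numbers.
  Coordinates, variables and the members of a tuple are indexed by $0, \ldots, k - 1$.
\<close>

definition vnorm :: "complex vec \<Rightarrow> real" where
  "vnorm v = L2_set (\<lambda>i. cmod (v $ i)) {..<dim_vec v}"

definition unit_ball :: "nat \<Rightarrow> complex vec set" where
  "unit_ball k = {z \<in> carrier_vec k. vnorm z < 1}"

definition sup_norm :: "nat \<Rightarrow> (complex vec \<Rightarrow> complex) \<Rightarrow> real" where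
  "sup_norm k f = (SUP z\<in>unit_ball k. cmod (f z))"

text \<open>
  Holomorphy on a relatively open set $U \subseteq \mathbb{C}^k$: at every point of $U$ there is a
  $\mathbb{C}$-linear Frechet derivative, given here by its coefficient vector \<open>c\<close>.
\<close>

definition holomorphic_vec_on :: "nat \<Rightarrow> (complex vec \<Rightarrow> complex) \<Rightarrow> complex vec set \<Rightarrow> bool" where
  "holomorphic_vec_on k f U \<longleftrightarrow>
    (\<forall>a\<in>U. \<exists>c\<in>carrier_vec k. \<forall>\<epsilon>>0. \<exists>\<delta>>0. \<forall>z\<in>U. vnorm (z - a) < \<delta> \<longrightarrow>
      cmod (f z - f a - (\<Sum>i<k. c $ i * (z $ i - a $ i))) \<le> \<epsilon> * vnorm (z - a))"

text \<open>
  Members of the following set are total functions of which only the values on the ball matter.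
\<close>

definition H_inf :: "nat \<Rightarrow> (complex vec \<Rightarrow> complex) set" where
  "H_inf k = {f. holomorphic_vec_on k f (unit_ball k) \<and>
                 (\<exists>B. \<forall>z\<in>unit_ball k. cmod (f z) \<le> B)}"

definition gleason_constant :: "nat \<Rightarrow> real \<Rightarrow> bool" where
  "gleason_constant k c \<longleftrightarrow>
    (\<forall>f\<in>H_inf k. f (0\<^sub>v k) = 0 \<longrightarrow>
      (\<exists>g :: nat \<Rightarrow> complex vec \<Rightarrow> complex.
        (\<forall>i<k. g i \<in> H_inf k \<and> sup_norm k (g i) \<le> c * sup_norm k f) \<and>
        (\<forall>z\<in>unit_ball k. f z = (\<Sum>i<k. z $ i * g i z))))"

definition op_norm :: "complex mat \<Rightarrow> real" where
  "op_norm A = (SUP v\<in>{v \<in> carrier_vec (dim_col A). vnorm v \<le> 1}. vnorm (A *\<^sub>v v))"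

text \<open>The sum over $i$ is taken entrywise, since matrices form no monoid as a type.\<close>

definition commuting_row_contraction :: "nat \<Rightarrow> nat \<Rightarrow> (nat \<Rightarrow> complex mat) \<Rightarrow> bool" where
  "commuting_row_contraction d n T \<longleftrightarrow>
    (\<forall>i<d. T i \<in> carrier_mat n n) \<and>
    (\<forall>i<d. \<forall>j<d. T i * T j = T j * T i) \<and>
    sqrt (op_norm (mat n n (\<lambda>(r, c). \<Sum>i<d. (T i * mat_adjoint (T i)) $$ (r, c)))) \<le> 1"

text \<open>
  A polynomial is a finitely supported coefficient function on exponent vectors;
  \<open>polys d\<close> is $\mathbb{C}[z_1, \ldots, z_d]$.
\<close>

type_synonym mpoly = "(nat \<Rightarrow>\<^sub>0 nat) \<Rightarrow>\<^sub>0 complex"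

definition polys :: "nat \<Rightarrow> mpoly set" where
  "polys d = {p. \<forall>m\<in>Poly_Mapping.keys p. Poly_Mapping.keys m \<subseteq> {..<d}}"

definition poly_eval :: "nat \<Rightarrow> mpoly \<Rightarrow> complex vec \<Rightarrow> complex" where
  "poly_eval d p z =
    (\<Sum>m\<in>Poly_Mapping.keys p.
      Poly_Mapping.lookup p m * (\<Prod>i<d. (z $ i) ^ Poly_Mapping.lookup m i))"

text \<open>
  The monomial $T_1^{m_1} \cdots T_d^{m_d}$, with the factors in increasing order of the index.
\<close>

definition monom_mat :: "nat \<Rightarrow> nat \<Rightarrow> (nat \<Rightarrow>\<^sub>0 nat) \<Rightarrow> (nat \<Rightarrow> complex mat) \<Rightarrow> complex mat" where
  "monom_mat d n m T = foldr (\<lambda>i M. (T i ^\<^sub>m Poly_Mapping.lookup m i) * M) [0..<d] (1\<^sub>m n)"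

definition poly_mat :: "nat \<Rightarrow> nat \<Rightarrow> mpoly \<Rightarrow> (nat \<Rightarrow> complex mat) \<Rightarrow> complex mat" where
  "poly_mat d n p T =
    mat n n (\<lambda>(r, c). \<Sum>m\<in>Poly_Mapping.keys p.
      Poly_Mapping.lookup p m * monom_mat d n m T $$ (r, c))"

end

theory Submission
  imports Defs "HOL-Complex_Analysis.Conformal_Mappings"
begin

text \<open>
  The idea is an induction on the size $n$ of the matrices. Passing to transposes, a commuting row
  contraction becomes a commuting tuple $A$ with $\sum_i \|A_i x\|^2 \le \|x\|^2$, a property that is
  inherited by invariant subspaces; so the induction runs over invariant subspaces $Y$ of a fixed space
  (\<open>von_neumann_subspace\<close>). Commuting operators have a joint eigenvalue $\lambda$ on the quotient by some
  proper invariant subspace $W$ (\<open>ex_joint_coeigenvalue\<close>), and $\lambda$ lies in the ball. An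
  automorphism of the ball acts on commuting column contractions as it does on points and moves $\lambda$
  to the origin (\<open>moebius_transfer\<close>). Then all $A_i$ map $Y$ into $W$, and the Gleason property
  $p - p(0) = \sum_i z_i q_i$ gives $p(A)x = p(0)x + \sum_i q_i(A) A_i x$ with $A_i x \in W$. As
  $\|q_i\| \le 2 C(d) \|p\|$ up to an arbitrarily small error, the inductive bound on $W$ yields the recursion
  $K_m = 1 + 2 C(d) \sqrt{d}\, K_{m-1}$ (\<open>gleason_step\<close>).
  
  Started from $K_1 = 1$, this recursion would exceed $(2 C(d)\sqrt d)^{n-1}$ for $n \ge 2$. The additive terms are
  compensated by starting with constant 1 in dimension 2: there the range of the tuple is at most a line, the tuple
  is essentially a single contraction, and Schwarz's lemma gives the inequality with constant 1
  (\<open>rank_one_bound\<close>).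
  
  Functions in $H^\infty$ are never evaluated at matrices. The Gleason property is first turned into a
  statement about polynomials (\<open>gleason_polynomial\<close>): iterating it produces Taylor polynomials, and
  since $p$ is a polynomial, the homogeneous components of the quotients beyond the degree of $p$ can be
  discarded without affecting the identity.
  
  For the bound with $n'$, a commuting family of operators on an $n$-dimensional space depends on at most
  $\lfloor n^2/4 \rfloor + 1$ parameters, by Schur's theorem (\<open>commuting_determined\<close>). Hence the
  tuple arises from a column contraction with $n'$ members by a linear map that sends the ball of
  $\mathbb{C}^{n'}$ into that of $\mathbb{C}^d$ (\<open>reduce_variables\<close>), and $C(d)\sqrt d$ may be replaced by
  $C(n')\sqrt{n'}$.
\<close>

section \<open>Vectors and linear operators\<close>

text \<open>
  Vectors are finitely supported functions, so that vectors of every length share one type and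
  dimension arguments can be carried out by induction on subspaces of a single space.
\<close>

type_synonym cvec = "nat \<Rightarrow>\<^sub>0 complex"

abbreviation coord :: "cvec \<Rightarrow> nat \<Rightarrow> complex" where
  "coord \<equiv> Poly_Mapping.lookup"

lemma cvec_eqI: "(\<And>i. coord x i = coord y i) \<Longrightarrow> x = y"
  by (rule poly_mapping_eqI)

definition smul :: "complex \<Rightarrow> cvec \<Rightarrow> cvec" where
  "smul c = Poly_Mapping.map ((*) c)"

lemma coord_smul [simp]: "coord (smul c x) i = c * coord x i"
  by (simp add: smul_def Poly_Mapping.map.rep_eq when_def)

interpretation V: vector_space smul
  by unfold_locales (auto intro!: cvec_eqI simp: lookup_add algebra_simps)

definition vec_of :: "nat \<Rightarrow> (nat \<Rightarrow> complex) \<Rightarrow> cvec" where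
  "vec_of n f = (\<Sum>i<n. Poly_Mapping.single i (f i))"

lemma coord_vec_of [simp]: "coord (vec_of n f) i = (if i < n then f i else 0)"
  by (simp add: vec_of_def lookup_sum lookup_single when_def)

definition supported :: "nat \<Rightarrow> cvec set" where
  "supported n = {x. \<forall>i\<ge>n. coord x i = 0}"

lemmas coord_simps = lookup_add lookup_minus lookup_sum

text \<open>
  The ambient space is infinite-dimensional, so finite dimension has to be recorded explicitly
  before dimensions of subspaces can be compared.
\<close>

definition fin_subspace :: "cvec set \<Rightarrow> bool" where
  "fin_subspace Y \<longleftrightarrow> V.subspace Y \<and> (\<exists>F. finite F \<and> Y \<subseteq> V.span F)"

lemma fin_subspaceD: "fin_subspace Y \<Longrightarrow> V.subspace Y"
  by (simp add: fin_subspace_def)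

lemma fin_subspace_mono: "fin_subspace Y \<Longrightarrow> V.subspace W \<Longrightarrow> W \<subseteq> Y \<Longrightarrow> fin_subspace W"
  unfolding fin_subspace_def by blast

lemma fin_subspace_basis_extend:
  assumes Y: "fin_subspace Y" and S: "S \<subseteq> Y" "V.independent S"
  obtains B where "S \<subseteq> B" "finite B" "B \<subseteq> Y" "V.independent B" "Y = V.span B" "card B = V.dim Y"
proof -
  obtain B where B: "S \<subseteq> B" "B \<subseteq> Y" "V.independent B" "Y \<subseteq> V.span B"
    using V.maximal_independent_subset_extend[OF S] by metis
  obtain F where F: "finite F" "Y \<subseteq> V.span F"
    using Y by (auto simp: fin_subspace_def)
  have "finite B"
    using V.independent_span_bound[OF F(1) B(3)] B(2) F(2) by blast
  moreover have "V.span B \<subseteq> Y"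
    using B(2) fin_subspaceD[OF Y] by (rule V.span_minimal)
  moreover have "card B = V.dim Y"
    using B by (intro V.basis_card_eq_dim)
  ultimately show ?thesis using B that by blast
qed

lemma fin_subspace_basis:
  assumes "fin_subspace Y"
  obtains B where "finite B" "B \<subseteq> Y" "V.independent B" "Y = V.span B" "card B = V.dim Y"
  using fin_subspace_basis_extend[OF assms, of "{}"] V.independent_empty by auto

lemma independent_card_le_dim:
  assumes "fin_subspace Y" "S \<subseteq> Y" "V.independent S"
  shows "finite S \<and> card S \<le> V.dim Y"
  using fin_subspace_basis_extend[OF assms] by (metis card_mono finite_subset)

lemma dim_less:
  assumes Y: "fin_subspace Y" and W: "V.subspace W" "W \<subseteq> Y" "W \<noteq> Y"
  shows "V.dim W < V.dim Y"
proof -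
  obtain B where B: "finite B" "B \<subseteq> W" "V.independent B" "W = V.span B" "card B = V.dim W"
    using fin_subspace_basis[OF fin_subspace_mono[OF Y W(1,2)]] by metis
  obtain y where y: "y \<in> Y" "y \<notin> W" using W by blast
  have "V.independent (insert y B)" using B y by (simp add: V.independent_insertI)
  moreover have "insert y B \<subseteq> Y" using B y W by blast
  ultimately have "card (insert y B) \<le> V.dim Y"
    using independent_card_le_dim[OF Y] by blast
  moreover have "y \<notin> B" using B y by blast
  ultimately show ?thesis using B by simp
qed

lemma subspace_smul: "V.subspace Y \<Longrightarrow> x \<in> Y \<Longrightarrow> smul c x \<in> Y"
  by (rule V.subspace_scale)

lemma subspace_supported: "V.subspace (supported n)"
  by (rule V.subspaceI) (auto simp: supported_def lookup_add)

lemma supported_span: "supported n \<subseteq> V.span ((\<lambda>i. Poly_Mapping.single i 1) ` {..<n})"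
proof
  fix x assume x: "x \<in> supported n"
  have "x = (\<Sum>i<n. smul (coord x i) (Poly_Mapping.single i 1))"
    using x by (intro cvec_eqI) (auto simp: lookup_sum lookup_single when_def supported_def if_distrib[of "(*) _"] cong: if_cong)
  also have "\<dots> \<in> V.span ((\<lambda>i. Poly_Mapping.single i 1) ` {..<n})"
    by (intro V.span_sum V.span_scale V.span_base imageI)
  finally show "x \<in> V.span ((\<lambda>i. Poly_Mapping.single i 1) ` {..<n})" .
qed

lemma fin_subspace_supported: "fin_subspace (supported n)"
  unfolding fin_subspace_def using subspace_supported supported_span by blast

lemma dim_supported: "V.dim (supported n) \<le> n"
  using V.dim_le_card[OF supported_span[of n]] card_image_le[of "{..<n}"] 
  by (metis card_lessThan finite_imageI finite_lessThan le_trans)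

definition lin :: "(cvec \<Rightarrow> cvec) \<Rightarrow> bool" where
  "lin A \<longleftrightarrow> (\<forall>x y. A (x + y) = A x + A y) \<and> (\<forall>c x. A (smul c x) = smul c (A x))"

lemma lin_add: "lin A \<Longrightarrow> A (x + y) = A x + A y"
  and lin_smul: "lin A \<Longrightarrow> A (smul c x) = smul c (A x)"
  by (auto simp: lin_def)

lemma lin_zero: "lin A \<Longrightarrow> A 0 = 0"
  by (metis lin_smul V.scale_zero_left)

lemma lin_minus: "lin A \<Longrightarrow> A (x - y) = A x - A y"
  by (metis add_diff_cancel diff_add_cancel lin_add)

lemma lin_sum: "lin A \<Longrightarrow> A (sum f S) = (\<Sum>i\<in>S. A (f i))"
  by (induction S rule: infinite_finite_induct) (auto simp: lin_zero lin_add)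

lemma lin_id: "lin (\<lambda>x. x)"
  by (simp add: lin_def)

lemma lin_comp: "lin A \<Longrightarrow> lin B \<Longrightarrow> lin (\<lambda>x. A (B x))"
  by (simp add: lin_def)

lemma lin_plus: "lin A \<Longrightarrow> lin B \<Longrightarrow> lin (\<lambda>x. A x + B x)"
  by (auto simp: lin_def V.scale_right_distrib)

lemma lin_diff: "lin A \<Longrightarrow> lin B \<Longrightarrow> lin (\<lambda>x. A x - B x)"
  by (auto simp: lin_def V.scale_right_diff_distrib)

lemma lin_scale: "lin A \<Longrightarrow> lin (\<lambda>x. smul c (A x))"
  by (auto simp: lin_def V.scale_right_distrib mult.commute)

lemma lin_Sum: "(\<And>i. i \<in> S \<Longrightarrow> lin (A i)) \<Longrightarrow> lin (\<lambda>x. \<Sum>i\<in>S. A i x)"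
  by (auto simp: lin_def V.scale_sum_right sum.distrib)

lemma lin_funpow: "lin A \<Longrightarrow> lin (A ^^ k)"
  by (induction k) (auto simp: lin_def)

lemma funpow_commute:
  assumes "\<And>x. A (B x) = B (A x)"
  shows "(A ^^ k) (B x) = B ((A ^^ k) x)"
  by (induction k) (auto simp: assms)

lemma funpow_invariant: "(\<And>y. y \<in> Y \<Longrightarrow> A y \<in> Y) \<Longrightarrow> y \<in> Y \<Longrightarrow> (A ^^ k) y \<in> Y"
  by (induction k) auto

section \<open>Polynomials in a single operator\<close>

definition poly_op :: "complex poly \<Rightarrow> (cvec \<Rightarrow> cvec) \<Rightarrow> cvec \<Rightarrow> cvec" where
  "poly_op p A = fold_coeffs (\<lambda>a f x. smul a x + A (f x)) p (\<lambda>x. 0)"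

lemma poly_op_0 [simp]: "poly_op 0 A x = 0"
  by (simp add: poly_op_def)

lemma poly_op_pCons: "lin A \<Longrightarrow> poly_op (pCons a p) A x = smul a x + A (poly_op p A x)"
  by (cases "p = 0 \<and> a = 0") (auto simp: poly_op_def lin_zero)

lemma lin_poly_op: "lin A \<Longrightarrow> lin (poly_op p A)"
proof (induction p)
  case 0
  then show ?case by (auto simp: lin_def)
next
  case (pCons a p)
  have "poly_op (pCons a p) A = (\<lambda>x. smul a x + A (poly_op p A x))"
    using pCons by (simp add: poly_op_pCons fun_eq_iff)
  then show ?case using pCons by (simp add: lin_plus lin_scale lin_comp lin_id)
qed

lemma poly_op_commute:
  assumes "lin A" "lin B" "\<And>x. A (B x) = B (A x)"
  shows "poly_op p A (B x) = B (poly_op p A x)"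
  by (induction p) (auto simp: poly_op_pCons assms lin_zero lin_add lin_smul)

lemma poly_op_add: "lin A \<Longrightarrow> poly_op (p + q) A x = poly_op p A x + poly_op q A x"
proof (induction p arbitrary: q)
  case 0
  then show ?case by simp
next
  case (pCons a p)
  obtain b r where q: "q = pCons b r" by (metis pCons_cases)
  have "poly_op (p + r) A x = poly_op p A x + poly_op r A x"
    using pCons by blast
  then show ?case using pCons.prems
    by (simp add: q poly_op_pCons lin_add[of A] V.scale_left_distrib add_ac)
qed

lemma poly_op_smult: "lin A \<Longrightarrow> poly_op (smult c p) A x = smul c (poly_op p A x)"
  by (induction p) (auto simp: poly_op_pCons lin_smul V.scale_right_distrib)

lemma poly_op_mult: "lin A \<Longrightarrow> poly_op (p * q) A x = poly_op p A (poly_op q A x)"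
  by (induction p) (auto simp: poly_op_pCons poly_op_add poly_op_smult)

lemma poly_op_const: "lin A \<Longrightarrow> poly_op [:c:] A x = smul c x"
  by (simp add: poly_op_pCons lin_zero)

lemma poly_op_linear: "lin A \<Longrightarrow> poly_op [:c, 1:] A x = smul c x + A x"
  using lin_zero[of A] by (simp add: poly_op_pCons)

lemma poly_op_monom: "lin A \<Longrightarrow> poly_op (monom c k) A x = smul c ((A ^^ k) x)"
proof (induction k)
  case 0
  then show ?case by (simp add: monom_0 poly_op_const)
next
  case (Suc k)
  then show ?case by (simp add: monom_Suc poly_op_pCons lin_smul)
qed

lemma poly_op_sum: "lin A \<Longrightarrow> poly_op (sum p S) A x = (\<Sum>i\<in>S. poly_op (p i) A x)"
  by (induction S rule: infinite_finite_induct) (auto simp: poly_op_add)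

lemma poly_op_invariant:
  assumes "lin A" "V.subspace Y" "\<And>y. y \<in> Y \<Longrightarrow> A y \<in> Y" "x \<in> Y"
  shows "poly_op p A x \<in> Y"
  by (induction p) (auto simp: poly_op_pCons assms V.subspace_0 V.subspace_add subspace_smul)

text \<open>
  Among the first $\dim Y + 1$ iterates of a vector there is a linear relation; when two iterates
  coincide the relation is immediate, which is the second case.
\<close>

lemma annihilating_poly_vector:
  assumes Y: "fin_subspace Y" and A: "lin A" "\<And>y. y \<in> Y \<Longrightarrow> A y \<in> Y" and y: "y \<in> Y"
  shows "\<exists>q. q \<noteq> (0 :: complex poly) \<and> poly_op q A y = 0"
proof (cases "inj_on (\<lambda>k. (A ^^ k) y) {..V.dim Y}")
  case True
  define S where "S = (\<lambda>k. (A ^^ k) y) ` {..V.dim Y}"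
  have "card S = Suc (V.dim Y)" using True by (simp add: S_def card_image)
  moreover have "S \<subseteq> Y" unfolding S_def using funpow_invariant[of Y A y] A(2) y by blast
  ultimately have "V.dependent S"
    using independent_card_le_dim[OF Y, of S] by auto
  then obtain u where u: "\<exists>v\<in>S. u v \<noteq> 0" "(\<Sum>v\<in>S. smul (u v) v) = 0"
    using V.dependent_finite[of S] by (auto simp: S_def)
  define q where "q = (\<Sum>k\<le>V.dim Y. monom (u ((A ^^ k) y)) k)"
  have "poly_op q A y = (\<Sum>k\<le>V.dim Y. smul (u ((A ^^ k) y)) ((A ^^ k) y))"
    by (simp add: q_def poly_op_sum poly_op_monom A)
  also have "\<dots> = (\<Sum>v\<in>S. smul (u v) v)"
    unfolding S_def by (simp add: sum.reindex[OF True])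
  finally have "poly_op q A y = 0" using u by simp
  moreover obtain k where k: "k \<le> V.dim Y" "u ((A ^^ k) y) \<noteq> 0"
    using u by (auto simp: S_def)
  have "coeff q k \<noteq> 0" using k
    by (simp add: q_def coeff_sum)
  hence "q \<noteq> 0" by auto
  ultimately show ?thesis by blast
next
  case False
  then obtain i j where ij: "i \<noteq> j" "(A ^^ i) y = (A ^^ j) y"
    by (auto simp: inj_on_def)
  define q where "q = monom (1::complex) i + monom (-1) j"
  have "poly_op q A y = 0" using ij by (simp add: q_def poly_op_add poly_op_monom A)
  moreover have "coeff q i = (1::complex)" using ij by (simp add: q_def)
  hence "q \<noteq> 0" by auto
  ultimately show ?thesis by blast
qed

lemma annihilating_poly:
  assumes Y: "fin_subspace Y" and A: "lin A" "\<And>y. y \<in> Y \<Longrightarrow> A y \<in> Y"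
  shows "\<exists>q. q \<noteq> 0 \<and> (\<forall>y\<in>Y. poly_op q A y = 0)"
proof -
  obtain B where B: "finite B" "B \<subseteq> Y" "Y = V.span B"
    using fin_subspace_basis[OF Y] by metis
  have "\<exists>q. q \<noteq> (0 :: complex poly) \<and> (\<forall>y\<in>B. poly_op q A y = 0)"
    using B(1,2)
  proof (induction B)
    case empty
    show ?case by (intro exI[of _ 1]) auto
  next
    case (insert b B)
    have "B \<subseteq> Y" using insert.prems by simp
    with insert.IH obtain q where q: "q \<noteq> 0" "\<forall>y\<in>B. poly_op q A y = 0" by blast
    obtain r where r: "r \<noteq> 0" "poly_op r A b = 0"
      using annihilating_poly_vector[OF Y A(1) A(2), of b] insert.prems by auto
    have 0: "poly_op p A 0 = 0" for p
      by (rule lin_zero[OF lin_poly_op[OF A(1)]])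
    have "poly_op (q * r) A y = 0" if "y \<in> insert b B" for y
    proof (cases "y = b")
      case True
      then show ?thesis using r 0 by (simp add: poly_op_mult[OF A(1)])
    next
      case False
      then have "poly_op (r * q) A y = 0" using q that 0 by (simp add: poly_op_mult[OF A(1)])
      then show ?thesis by (simp only: mult.commute)
    qed
    moreover have "q * r \<noteq> 0" using q r by simp
    ultimately show ?case by blast
  qed
  then obtain q where q: "q \<noteq> 0" "\<forall>y\<in>B. poly_op q A y = 0" by blast
  have "V.subspace {y. poly_op q A y = 0}"
    using lin_poly_op[OF A(1), of q]
    by (intro V.subspaceI) (simp_all add: lin_zero[OF lin_poly_op[OF A(1)]] lin_add[OF lin_poly_op[OF A(1)]] lin_smul[OF lin_poly_op[OF A(1)]])
  then have "V.span B \<subseteq> {y. poly_op q A y = 0}"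
    using q(2) by (intro V.span_minimal) auto
  then have "\<forall>y\<in>Y. poly_op q A y = 0" unfolding B(3) by blast
  then show ?thesis using q(1) by blast
qed

text \<open>
  Inverses are found as polynomials because such an inverse automatically commutes with everything
  that commutes with the operator and preserves every subspace that the operator preserves. If $q$ is
  an annihilating polynomial of least degree and the operator minus $\mu$ is injective, then
  $q(\mu) \neq 0$, since otherwise the factor $X - \mu$ could be cancelled; dividing
  $q - q(\mu)$ by $X - \mu$ gives the inverse.
\<close>

lemma inverse_is_poly:
  assumes Y: "fin_subspace Y" and A: "lin A" "\<And>y. y \<in> Y \<Longrightarrow> A y \<in> Y"
    and inj: "\<And>y. y \<in> Y \<Longrightarrow> A y = smul \<mu> y \<Longrightarrow> y = 0"
  obtains h where "\<And>y. y \<in> Y \<Longrightarrow> A (poly_op h A y) - smul \<mu> (poly_op h A y) = y"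
proof -
  define P where "P q \<longleftrightarrow> q \<noteq> 0 \<and> (\<forall>y\<in>Y. poly_op q A y = 0)" for q
  obtain q where q: "P q" and min: "\<And>r. P r \<Longrightarrow> degree q \<le> degree r"
  proof -
    obtain q0 where "P q0" using annihilating_poly[OF Y A(1) A(2)] unfolding P_def by auto
    from ex_has_least_nat[of P q0 degree, OF this] show ?thesis using that by auto
  qed
  have fact: "poly_op ([:-\<mu>, 1:] * r) A y = A (poly_op r A y) - smul \<mu> (poly_op r A y)" for r y
    by (simp only: poly_op_mult[OF A(1)] poly_op_linear[OF A(1)]) (auto intro!: cvec_eqI simp: coord_simps)
  have "poly q \<mu> \<noteq> 0"
  proof
    assume "poly q \<mu> = 0"
    then obtain r where r: "q = [:-\<mu>, 1:] * r" by (auto simp: poly_eq_0_iff_dvd elim: dvdE)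
    have "r \<noteq> 0" using q r by (auto simp: P_def)
    have "poly_op r A y = 0" if "y \<in> Y" for y
    proof (rule inj)
      show "poly_op r A y \<in> Y" by (rule poly_op_invariant[OF A(1) fin_subspaceD[OF Y] A(2) that])
      show "A (poly_op r A y) = smul \<mu> (poly_op r A y)"
        using fact[of r y] q that unfolding P_def r by auto
    qed
    then have "P r" using \<open>r \<noteq> 0\<close> by (simp add: P_def)
    then have "degree q \<le> degree r" by (rule min)
    moreover have "degree q = Suc (degree r)"
      unfolding r using \<open>r \<noteq> 0\<close> by (subst degree_mult_eq) auto
    ultimately show False by simp
  qed
  define c where "c = poly q \<mu>"
  have "poly (q - [:c:]) \<mu> = 0" by (simp add: c_def)
  then obtain r where r: "q - [:c:] = [:-\<mu>, 1:] * r" by (metis poly_eq_0_iff_dvd dvdE)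
  have "A (poly_op (smult (-1/c) r) A y) - smul \<mu> (poly_op (smult (-1/c) r) A y) = y" if "y \<in> Y" for y
  proof -
    have "poly_op q A y = poly_op ([:-\<mu>, 1:] * r + [:c:]) A y"
      using r by (metis diff_add_cancel)
    then have 1: "0 = A (poly_op r A y) - smul \<mu> (poly_op r A y) + smul c y"
      using q that by (simp only: poly_op_add[OF A(1)] fact poly_op_const[OF A(1)] P_def)
    have "A (poly_op (smult (-1/c) r) A y) - smul \<mu> (poly_op (smult (-1/c) r) A y)
       = smul (-1/c) (A (poly_op r A y) - smul \<mu> (poly_op r A y))"
      by (simp only: poly_op_smult[OF A(1)] lin_smul[OF A(1)] V.scale_right_diff_distrib V.scale_left_commute)
    also have "A (poly_op r A y) - smul \<mu> (poly_op r A y) = smul (-c) y"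
      using 1 by (simp add: eq_neg_iff_add_eq_0 add.commute)
    also have "smul (-1/c) (smul (-c) y) = y"
      using \<open>poly q \<mu> \<noteq> 0\<close> by (auto intro!: cvec_eqI simp: coord_simps c_def)
    finally show ?thesis .
  qed
  then show ?thesis using that by blast
qed

text \<open>
  The quotient $Y/W$ is nonzero, so the operator that $A$ induces on it has an eigenvalue, and at an
  eigenvalue the induced operator misses some class. Without forming quotients: if every $A - \mu$ were
  onto modulo $W$, the same would hold for every product of such factors, hence for every nonzero
  polynomial in $A$, contradicting the existence of an annihilating polynomial.
\<close>

lemma ex_not_surjective_mod:
  assumes Y: "fin_subspace Y" and A: "lin A" "\<And>y. y \<in> Y \<Longrightarrow> A y \<in> Y"
    and W: "V.subspace W" "W \<subseteq> Y" "W \<noteq> Y" "\<And>y. y \<in> W \<Longrightarrow> A y \<in> W"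
  obtains \<mu> z where "z \<in> Y" "\<And>y w. y \<in> Y \<Longrightarrow> w \<in> W \<Longrightarrow> z \<noteq> A y - smul \<mu> y + w"
proof (rule ccontr)
  note * = that
  assume neg: "\<not> thesis"
  have surj: "\<exists>y\<in>Y. \<exists>w\<in>W. z = A y - smul \<mu> y + w" if "z \<in> Y" for z \<mu>
  proof (rule ccontr)
    assume "\<not> ?thesis"
    then have "\<And>y w. y \<in> Y \<Longrightarrow> w \<in> W \<Longrightarrow> z \<noteq> A y - smul \<mu> y + w" by auto
    then have thesis by (rule *[OF that])
    with neg show False ..
  qed
  have sY: "V.subspace Y" using Y by (rule fin_subspaceD)
  have "\<forall>z\<in>Y. \<exists>y\<in>Y. \<exists>w\<in>W. z = poly_op q A y + w" if "q \<noteq> 0" for q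
    using that
  proof (induction "degree q" arbitrary: q rule: less_induct)
    case less
    show ?case
    proof (cases "degree q = 0")
      case True
      then obtain c where c: "q = [:c:]" by (metis degree_0_id)
      have c0: "c \<noteq> 0" using less.prems c by simp
      show ?thesis
      proof
        fix z assume z: "z \<in> Y"
        have "z = poly_op q A (smul (1/c) z) + 0"
          unfolding c poly_op_const[OF A(1)] using c0 by simp
        then show "\<exists>y\<in>Y. \<exists>w\<in>W. z = poly_op q A y + w"
          using subspace_smul[OF sY z, of "1/c"] V.subspace_0[OF W(1)] by (metis)
      qed
    next
      case False
      then obtain \<mu> where "poly q \<mu> = 0"
        using Fundamental_Theorem_Algebra.fundamental_theorem_of_algebra[of q] by (auto simp: constant_degree)
      then obtain r where r: "q = [:-\<mu>, 1:] * r" by (auto simp: poly_eq_0_iff_dvd elim: dvdE)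
      have "r \<noteq> 0" using less r by auto
      moreover have "degree r < degree q"
        unfolding r using \<open>r \<noteq> 0\<close> by (subst degree_mult_eq) auto
      ultimately have IH: "\<forall>z\<in>Y. \<exists>y\<in>Y. \<exists>w\<in>W. z = poly_op r A y + w"
        by (intro less.hyps)
      show ?thesis
      proof
        fix z assume "z \<in> Y"
        then obtain y w where y: "y \<in> Y" "w \<in> W" "z = A y - smul \<mu> y + w" using surj[of z \<mu>] by auto
        obtain y' w' where y': "y' \<in> Y" "w' \<in> W" "y = poly_op r A y' + w'" using IH y by blast
        have "z = poly_op q A y' + (A w' - smul \<mu> w' + w)"
          unfolding r y(3) poly_op_mult[OF A(1)] poly_op_linear[OF A(1)] y'(3)
          by (simp add: lin_add[OF A(1)] V.scale_right_distrib V.scale_minus_left algebra_simps)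
        moreover have "A w' - smul \<mu> w' + w \<in> W"
          using y(2) y'(2) W(1) W(4)[OF y'(2)] by (intro V.subspace_add V.subspace_diff subspace_smul)
        ultimately show "\<exists>y\<in>Y. \<exists>w\<in>W. z = poly_op q A y + w" using y'(1) by blast
      qed
    qed
  qed
  moreover obtain q where "q \<noteq> 0" and q: "\<forall>y\<in>Y. poly_op q A y = 0"
    using annihilating_poly[OF Y A(1) A(2)] by auto
  ultimately have *: "\<forall>z\<in>Y. \<exists>y\<in>Y. \<exists>w\<in>W. z = poly_op q A y + w" by blast
  have "Y \<subseteq> W"
  proof
    fix z assume "z \<in> Y"
    then obtain y w where "y \<in> Y" "w \<in> W" "z = poly_op q A y + w" using * by blast
    then show "z \<in> W" using q by simp
  qed
  then show False using W by blast
qed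

section \<open>Joint eigenvalues of commuting operators\<close>

definition commuting :: "(nat \<Rightarrow> cvec \<Rightarrow> cvec) \<Rightarrow> bool" where
  "commuting A \<longleftrightarrow> (\<forall>i. lin (A i)) \<and> (\<forall>i j x. A i (A j x) = A j (A i x))"

definition invariant :: "(nat \<Rightarrow> cvec \<Rightarrow> cvec) \<Rightarrow> cvec set \<Rightarrow> bool" where
  "invariant A Y \<longleftrightarrow> (\<forall>i. \<forall>y\<in>Y. A i y \<in> Y)"

lemma commuting_lin: "commuting A \<Longrightarrow> lin (A i)"
  by (simp add: commuting_def)

lemma commuting_commute: "commuting A \<Longrightarrow> A i (A j x) = A j (A i x)"
  by (simp add: commuting_def)

lemma invariantD: "invariant A Y \<Longrightarrow> y \<in> Y \<Longrightarrow> A i y \<in> Y"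
  by (simp add: invariant_def)

text \<open>
  This is the inductive engine of the development. Modulo $W$ every $A_i$ acts on $Y$ as the scalar
  $\lambda_i$, and $W$ is still a proper invariant subspace. One operator at a time is treated, each
  time enlarging the subspace by the range of $A_d - \mu$ for a $\mu$ that keeps it proper; commutation
  makes the enlarged subspace invariant. The last clause says that $W$ is no larger than it has to be;
  the dimension bound for commuting families relies on it.
\<close>

lemma ex_joint_coeigenvalue:
  assumes Y: "fin_subspace Y" and A: "commuting A" "invariant A Y"
    and U: "V.subspace U" "U \<subseteq> Y" "U \<noteq> Y" "invariant A U"
  obtains lam W where "V.subspace W" "U \<subseteq> W" "W \<subseteq> Y" "W \<noteq> Y" "invariant A W"
    "\<And>i y. i < d \<Longrightarrow> y \<in> Y \<Longrightarrow> A i y - smul (lam i) y \<in> W"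
    "\<And>W'. V.subspace W' \<Longrightarrow> U \<subseteq> W' \<Longrightarrow> (\<And>i y. i < d \<Longrightarrow> y \<in> Y \<Longrightarrow> A i y - smul (lam i) y \<in> W') \<Longrightarrow> W \<subseteq> W'"
proof -
  have "\<exists>lam W. V.subspace W \<and> U \<subseteq> W \<and> W \<subseteq> Y \<and> W \<noteq> Y \<and> invariant A W \<and>
     (\<forall>i<d. \<forall>y\<in>Y. A i y - smul (lam i) y \<in> W) \<and>
     (\<forall>W'. V.subspace W' \<longrightarrow> U \<subseteq> W' \<longrightarrow> (\<forall>i<d. \<forall>y\<in>Y. A i y - smul (lam i) y \<in> W') \<longrightarrow> W \<subseteq> W')"
  proof (induction d)
    case 0
    then show ?case using U by (intro exI[of _ "\<lambda>_. 0"] exI[of _ U]) auto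
  next
    case (Suc d)
    from Suc.IH obtain lam W where W: "V.subspace W" "U \<subseteq> W" "W \<subseteq> Y" "W \<noteq> Y" "invariant A W"
      and l: "\<forall>i<d. \<forall>y\<in>Y. A i y - smul (lam i) y \<in> W"
      and min: "\<forall>W'. V.subspace W' \<longrightarrow> U \<subseteq> W' \<longrightarrow> 
          (\<forall>i<d. \<forall>y\<in>Y. A i y - smul (lam i) y \<in> W') \<longrightarrow> W \<subseteq> W'"
      by (elim exE conjE)
    have sY: "V.subspace Y" using Y by (rule fin_subspaceD)
    have lA: "lin (A i)" for i using A by (simp add: commuting_def)
    obtain \<mu> z where z: "z \<in> Y" "\<And>y w. y \<in> Y \<Longrightarrow> w \<in> W \<Longrightarrow> z \<noteq> A d y - smul \<mu> y + w"
    proof (rule ex_not_surjective_mod[OF Y lA[of d] invariantD[OF A(2), of _ d] W(1,3,4) invariantD[OF W(5), of _ d]])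
      fix \<mu> z assume "z \<in> Y" "\<And>y w. y \<in> Y \<Longrightarrow> w \<in> W \<Longrightarrow> z \<noteq> A d y - smul \<mu> y + w"
      then show thesis by (rule that)
    qed
    define Z where "Z = {A d y - smul \<mu> y + w |y w. y \<in> Y \<and> w \<in> W}"
    have ZI: "A d y - smul \<mu> y + w \<in> Z" if "y \<in> Y" "w \<in> W" for y w
      using that by (auto simp: Z_def)
    have WZ: "W \<subseteq> Z"
    proof
      fix w assume "w \<in> W"
      then have "A d 0 - smul \<mu> 0 + w \<in> Z" by (intro ZI V.subspace_0[OF sY])
      then show "w \<in> Z" by (simp add: lin_zero[OF lA])
    qed
    have "V.subspace Z"
    proof (rule V.subspaceI)
      show "0 \<in> Z" using WZ V.subspace_0[OF W(1)] by blast
    next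
      fix a b assume "a \<in> Z" "b \<in> Z"
      then obtain y w y' w' where ab: "a = A d y - smul \<mu> y + w" "b = A d y' - smul \<mu> y' + w'"
        "y \<in> Y" "w \<in> W" "y' \<in> Y" "w' \<in> W" by (auto simp: Z_def)
      have eq: "a + b = A d (y + y') - smul \<mu> (y + y') + (w + w')"
        by (auto intro!: cvec_eqI simp: ab lin_add[OF lA] coord_simps algebra_simps)
      show "a + b \<in> Z" 
        unfolding eq by (intro ZI V.subspace_add sY W(1) ab)
    next
      fix c a assume "a \<in> Z"
      then obtain y w where a: "a = A d y - smul \<mu> y + w" "y \<in> Y" "w \<in> W" by (auto simp: Z_def)
      have eq: "smul c a = A d (smul c y) - smul \<mu> (smul c y) + smul c w"
        by (auto intro!: cvec_eqI simp: a lin_smul[OF lA] coord_simps algebra_simps)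
      show "smul c a \<in> Z" 
        unfolding eq by (intro ZI subspace_smul sY W(1) a)
    qed
    moreover have "Z \<subseteq> Y"
      using W(3) invariantD[OF A(2)] unfolding Z_def by (blast intro: V.subspace_add[OF sY] V.subspace_diff[OF sY] subspace_smul[OF sY])
    moreover have "Z \<noteq> Y"
    proof
      assume "Z = Y"
      with z(1) have "z \<in> Z" by simp
      then obtain y w where "y \<in> Y" "w \<in> W" "z = A d y - smul \<mu> y + w"
        unfolding Z_def by blast
      then show False using z(2) by simp
    qed
    moreover have "invariant A Z" unfolding invariant_def
    proof (intro allI ballI)
      fix i a assume "a \<in> Z"
      then obtain y w where a: "a = A d y - smul \<mu> y + w" "y \<in> Y" "w \<in> W" by (auto simp: Z_def)
      have eq: "A i a = A d (A i y) - smul \<mu> (A i y) + A i w"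
        by (simp add: a lin_add[OF lA] lin_minus[OF lA] lin_smul[OF lA] commuting_commute[OF A(1), of i d])
      show "A i a \<in> Z" 
        unfolding eq by (intro ZI invariantD[OF A(2)] invariantD[OF W(5)] a)
    qed
    moreover have r1: "A i y - smul ((lam(d := \<mu>)) i) y \<in> Z" if "i < Suc d" "y \<in> Y" for i y
    proof (cases "i = d")
      case True
      then show ?thesis using ZI[OF that(2) V.subspace_0[OF W(1)]] by simp
    next
      case False
      then show ?thesis using l that WZ by auto
    qed
    moreover have r2: "Z \<subseteq> W'" if W': "V.subspace W'" "U \<subseteq> W'"
      and a: "\<forall>i<Suc d. \<forall>y\<in>Y. A i y - smul ((lam(d := \<mu>)) i) y \<in> W'" for W'
    proof -
      have "\<forall>i<d. \<forall>y\<in>Y. A i y - smul (lam i) y \<in> W'"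
      proof (intro allI impI ballI)
        fix i y assume "i < d" "y \<in> Y"
        then show "A i y - smul (lam i) y \<in> W'" using a[rule_format, of i y] by auto
      qed
      then have "W \<subseteq> W'" using min W' by simp
      moreover have "A d y - smul \<mu> y \<in> W'" if "y \<in> Y" for y
        using a[rule_format, of d y] that by simp
      ultimately show ?thesis
        unfolding Z_def using V.subspace_add[OF W'(1)] by blast
    qed
    moreover have "U \<subseteq> Z" using W(2) WZ by (rule subset_trans)
    ultimately have "V.subspace Z \<and> U \<subseteq> Z \<and> Z \<subseteq> Y \<and> Z \<noteq> Y \<and> invariant A Z" by (intro conjI)
    moreover have "\<forall>i<Suc d. \<forall>y\<in>Y. A i y - smul ((lam(d := \<mu>)) i) y \<in> Z"
      by (intro allI impI ballI r1)
    moreover have "\<forall>W'. V.subspace W' \<longrightarrow> U \<subseteq> W' \<longrightarrow> 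
        (\<forall>i<Suc d. \<forall>y\<in>Y. A i y - smul ((lam(d := \<mu>)) i) y \<in> W') \<longrightarrow> Z \<subseteq> W'"
      by (intro allI impI) (rule r2)
    ultimately show ?case
      by (intro exI[of _ "lam(d := \<mu>)"] exI[of _ Z]) (elim conjE, intro conjI)
  qed
  then obtain lam W where *: "V.subspace W" "U \<subseteq> W" "W \<subseteq> Y" "W \<noteq> Y" "invariant A W"
    and l: "\<forall>i<d. \<forall>y\<in>Y. A i y - smul (lam i) y \<in> W"
    and m: "\<forall>W'. V.subspace W' \<longrightarrow> U \<subseteq> W' \<longrightarrow> (\<forall>i<d. \<forall>y\<in>Y. A i y - smul (lam i) y \<in> W') \<longrightarrow> W \<subseteq> W'"
    by (elim exE conjE)
  show ?thesis
  proof (rule that[of W lam])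
    show "\<And>i y. i < d \<Longrightarrow> y \<in> Y \<Longrightarrow> A i y - smul (lam i) y \<in> W" using l by simp
    show "\<And>W'. V.subspace W' \<Longrightarrow> U \<subseteq> W' \<Longrightarrow> 
      (\<And>i y. i < d \<Longrightarrow> y \<in> Y \<Longrightarrow> A i y - smul (lam i) y \<in> W') \<Longrightarrow> W \<subseteq> W'"
      using m by simp
  qed (fact *)+
qed

section \<open>Polynomials in commuting operators\<close>

definition monom_op :: "nat \<Rightarrow> (nat \<Rightarrow> cvec \<Rightarrow> cvec) \<Rightarrow> (nat \<Rightarrow>\<^sub>0 nat) \<Rightarrow> cvec \<Rightarrow> cvec" where
  "monom_op d A m x = foldr (\<lambda>i y. (A i ^^ Poly_Mapping.lookup m i) y) [0..<d] x"

text \<open>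
  Evaluation of a polynomial at a tuple of operators; \<open>pe\<close> below is evaluation at a point. The two
  are linked by letting scalars act as operators, so that the homomorphism properties have to be proved
  only once.
\<close>

definition ev :: "nat \<Rightarrow> (nat \<Rightarrow> cvec \<Rightarrow> cvec) \<Rightarrow> mpoly \<Rightarrow> cvec \<Rightarrow> cvec" where
  "ev d A p x = (\<Sum>m\<in>Poly_Mapping.keys p. smul (Poly_Mapping.lookup p m) (monom_op d A m x))"

definition pe :: "nat \<Rightarrow> mpoly \<Rightarrow> (nat \<Rightarrow> complex) \<Rightarrow> complex" where
  "pe d p z = (\<Sum>m\<in>Poly_Mapping.keys p.
     Poly_Mapping.lookup p m * (\<Prod>i<d. z i ^ Poly_Mapping.lookup m i))"

lemma monom_op_0 [simp]: "monom_op 0 A m x = x"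
  by (simp add: monom_op_def)

lemma monom_op_Suc: "monom_op (Suc d) A m x = monom_op d A m ((A d ^^ Poly_Mapping.lookup m d) x)"
  by (simp add: monom_op_def)

lemma lin_monom_op: "commuting A \<Longrightarrow> lin (monom_op d A m)"
proof (induction d)
  case 0
  have "monom_op 0 A m = (\<lambda>x. x)" by auto
  then show ?case by (simp add: lin_id)
next
  case (Suc d)
  have "monom_op (Suc d) A m = (\<lambda>x. monom_op d A m ((A d ^^ Poly_Mapping.lookup m d) x))"
    by (rule ext) (rule monom_op_Suc)
  then show ?case
    using lin_comp[OF Suc.IH[OF Suc.prems] lin_funpow[OF commuting_lin[OF Suc.prems]]] by simp
qed

lemma monom_op_commute:
  assumes "\<And>i x. A i (B x) = B (A i x)"
  shows "monom_op d A m (B x) = B (monom_op d A m x)"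
proof (induction d arbitrary: x)
  case 0
  then show ?case by simp
next
  case (Suc d)
  have "(A d ^^ k) (B y) = B ((A d ^^ k) y)" for k y
    using assms[of d] by (rule funpow_commute)
  then show ?case using Suc by (simp add: monom_op_Suc)
qed

lemma monom_op_add:
  assumes A: "commuting A"
  shows "monom_op d A (m + m') x = monom_op d A m (monom_op d A m' x)"
proof (induction d arbitrary: x)
  case 0
  then show ?case by simp
next
  case (Suc d)
  let ?k = "Poly_Mapping.lookup m d" and ?k' = "Poly_Mapping.lookup m' d"
  have *: "monom_op d A m' ((A d ^^ k) y) = (A d ^^ k) (monom_op d A m' y)" for k y
  proof (rule monom_op_commute)
    fix i x
    show "A i ((A d ^^ k) x) = (A d ^^ k) (A i x)"
      using funpow_commute[of "A d" "A i" k x] commuting_commute[OF A, of d i] by simp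
  qed
  have "monom_op (Suc d) A (m + m') x = monom_op d A m (monom_op d A m' ((A d ^^ (?k + ?k')) x))"
    by (simp add: monom_op_Suc Suc.IH lookup_add)
  also have "(A d ^^ (?k + ?k')) x = (A d ^^ ?k) ((A d ^^ ?k') x)"
    by (simp add: funpow_add)
  also have "monom_op d A m' \<dots> = (A d ^^ ?k) (monom_op d A m' ((A d ^^ ?k') x))"
    by (rule *)
  finally show ?case by (simp add: monom_op_Suc)
qed

lemma monom_op_zero: "monom_op d A 0 x = x"
  by (induction d) (auto simp: monom_op_Suc)

lemma monom_op_single: "monom_op d A (Poly_Mapping.single i 1) x = (if i < d then A i x else x)"
  by (induction d arbitrary: x) (auto simp: monom_op_Suc lookup_single when_def less_Suc_eq)

lemma ev_superset:
  assumes "finite F" "Poly_Mapping.keys p \<subseteq> F"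
  shows "ev d A p x = (\<Sum>m\<in>F. smul (Poly_Mapping.lookup p m) (monom_op d A m x))"
  unfolding ev_def
  by (rule sum.mono_neutral_left) (use assms in \<open>auto simp: in_keys_iff\<close>)

lemma lin_ev: "commuting A \<Longrightarrow> lin (ev d A p)"
  unfolding ev_def[abs_def] by (intro lin_Sum lin_scale lin_monom_op)

lemma ev_zero: "ev d A 0 x = 0"
  by (simp add: ev_def)

lemma ev_single: "ev d A (Poly_Mapping.single m c) x = smul c (monom_op d A m x)"
  by (auto simp: ev_def)

lemma ev_add: "ev d A (p + q) x = ev d A p x + ev d A q x"
proof -
  let ?F = "Poly_Mapping.keys p \<union> Poly_Mapping.keys q"
  have "ev d A r x = (\<Sum>m\<in>?F. smul (Poly_Mapping.lookup r m) (monom_op d A m x))"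
    if "r \<in> {p, q, p + q}" for r
    using that keys_add[of p q] by (intro ev_superset) auto
  then show ?thesis
    by (simp add: lookup_add V.scale_left_distrib sum.distrib)
qed

lemma ev_sum: "ev d A (sum p S) x = (\<Sum>i\<in>S. ev d A (p i) x)"
  by (induction S rule: infinite_finite_induct) (simp_all add: ev_add ev_zero)

lemma mpoly_expand:
  fixes p :: mpoly
  shows "p = (\<Sum>m\<in>Poly_Mapping.keys p. Poly_Mapping.single m (Poly_Mapping.lookup p m))"
  by (rule poly_mapping_eqI) (auto simp: lookup_sum lookup_single when_def in_keys_iff)

lemma ev_mult:
  assumes A: "commuting A"
  shows "ev d A (p * q) x = ev d A p (ev d A q x)"
proof -
  let ?l = Poly_Mapping.lookup and ?s = Poly_Mapping.single and ?K = Poly_Mapping.keys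
  have l: "lin (monom_op d A m)" for m using A by (rule lin_monom_op)
  have "p * q = (\<Sum>m\<in>?K p. \<Sum>m'\<in>?K q. ?s (m + m') (?l p m * ?l q m'))"
    by (subst mpoly_expand[of p], subst mpoly_expand[of q])
      (simp only: sum_product mult_single)
  then have "ev d A (p * q) x
      = (\<Sum>m\<in>?K p. \<Sum>m'\<in>?K q. smul (?l p m * ?l q m') (monom_op d A m (monom_op d A m' x)))"
    by (simp only: ev_sum ev_single monom_op_add[OF A])
  also have "\<dots> = ev d A p (ev d A q x)"
    unfolding ev_def lin_sum[OF l] lin_smul[OF l] V.scale_sum_right V.scale_scale ..
  finally show ?thesis .
qed

definition cst :: "complex \<Rightarrow> mpoly" where
  "cst c = Poly_Mapping.single 0 c"

definition var :: "nat \<Rightarrow> mpoly" where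
  "var i = Poly_Mapping.single (Poly_Mapping.single i 1) 1"

lemma ev_cst: "ev d A (cst c) x = smul c x"
  by (simp add: cst_def ev_single monom_op_zero)

lemma ev_var: "i < d \<Longrightarrow> ev d A (var i) x = A i x"
  using monom_op_single[of d A i x] by (simp add: var_def ev_single)

lemma cst_1: "cst 1 = 1"
  by (simp add: cst_def)

lemma ev_one: "ev d A 1 x = x"
  using ev_cst[of d A 1 x] by (simp add: cst_1)

lemma ev_uminus: "ev d A (- p) x = - ev d A p x"
  using ev_add[of d A p "- p" x] by (simp add: ev_zero eq_neg_iff_add_eq_0 add.commute)

lemma ev_diff: "ev d A (p - q) x = ev d A p x - ev d A q x"
  using ev_add[of d A p "- q" x] by (simp add: ev_uminus)

lemma ev_power: "commuting A \<Longrightarrow> ev d A (p ^ k) x = ((ev d A p) ^^ k) x"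
  by (induction k) (simp_all add: ev_one ev_mult)

lemma lin_smul_op: "lin (smul c)"
  by (simp add: lin_def V.scale_right_distrib mult.commute)

lemma commuting_scalar: "commuting (\<lambda>i. smul (z i))"
  by (simp add: commuting_def lin_smul_op mult.commute)

lemma funpow_smul: "(smul c ^^ k) x = smul (c ^ k) x"
  by (induction k) auto

lemma monom_op_scalar: "monom_op d (\<lambda>i. smul (z i)) m x = smul (\<Prod>i<d. z i ^ Poly_Mapping.lookup m i) x"
  by (induction d arbitrary: x) (auto simp: monom_op_Suc funpow_smul mult.commute)

lemma ev_scalar: "ev d (\<lambda>i. smul (z i)) p x = smul (pe d p z) x"
  by (simp add: ev_def pe_def monom_op_scalar V.scale_sum_left)

text \<open>
  Scalars are recovered from the operators that they induce; this transports identities from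
  operator tuples to points.
\<close>

lemma pe_eqI:
  assumes "\<And>x. smul a x = smul b x" shows "a = b"
proof -
  have "coord (smul a (Poly_Mapping.single 0 1)) 0 = coord (smul b (Poly_Mapping.single 0 1)) 0"
    using assms by (rule arg_cong)
  then show ?thesis by simp
qed

lemma pe_add: "pe d (p + q) z = pe d p z + pe d q z"
  by (rule pe_eqI) (simp add: V.scale_left_distrib ev_add flip: ev_scalar)

lemma pe_diff: "pe d (p - q) z = pe d p z - pe d q z"
  by (rule pe_eqI) (simp add: V.scale_left_diff_distrib ev_diff flip: ev_scalar)

lemma pe_mult: "pe d (p * q) z = pe d p z * pe d q z"
  by (rule pe_eqI) (simp add: ev_mult[OF commuting_scalar] flip: ev_scalar V.scale_scale)

lemma pe_zero [simp]: "pe d 0 z = 0"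
  by (simp add: pe_def)

lemma pe_sum: "pe d (sum p S) z = (\<Sum>i\<in>S. pe d (p i) z)"
  by (induction S rule: infinite_finite_induct) (simp_all add: pe_add)

lemma pe_cst [simp]: "pe d (cst c) z = c"
  by (rule pe_eqI) (simp add: ev_cst flip: ev_scalar)

lemma pe_var [simp]: "i < d \<Longrightarrow> pe d (var i) z = z i"
  by (rule pe_eqI) (simp add: ev_var flip: ev_scalar)

lemma pe_one [simp]: "pe d 1 z = 1"
  using pe_cst[of d 1 z] by (simp add: cst_1)

lemma pe_power: "pe d (p ^ k) z = pe d p z ^ k"
  by (induction k) (simp_all add: pe_mult)

lemma pe_cong: "(\<And>i. i < d \<Longrightarrow> z i = w i) \<Longrightarrow> pe d p z = pe d p w"
  by (simp add: pe_def)

text \<open>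
  Substitution of the polynomials $\Phi_i$ for the variables: it turns a change of coordinates of the
  ball into an operation on polynomials that is available for operators as well.
\<close>

definition psubst :: "nat \<Rightarrow> (nat \<Rightarrow> mpoly) \<Rightarrow> mpoly \<Rightarrow> mpoly" where
  "psubst d \<Phi> p = (\<Sum>m\<in>Poly_Mapping.keys p.
     cst (Poly_Mapping.lookup p m) * (\<Prod>i<d. \<Phi> i ^ Poly_Mapping.lookup m i))"

lemma ev_psubst:
  assumes A: "commuting A"
  shows "ev e A (psubst d \<Phi> p) x = ev d (\<lambda>i. ev e A (\<Phi> i)) p x"
proof -
  have "ev e A (\<Prod>i<d. \<Phi> i ^ Poly_Mapping.lookup m i) x = monom_op d (\<lambda>i. ev e A (\<Phi> i)) m x" for m
    by (induction d arbitrary: x) (simp_all add: ev_one monom_op_Suc ev_mult[OF A] ev_power[OF A])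
  then show ?thesis
    by (simp add: psubst_def ev_sum ev_mult[OF A] ev_cst ev_def[of d])
qed

lemma pe_psubst: "pe e (psubst d \<Phi> p) z = pe d p (\<lambda>i. pe e (\<Phi> i) z)"
proof (rule pe_eqI)
  fix x
  have "ev e (\<lambda>i. smul (z i)) q = smul (pe e q z)" for q
    by (rule ext) (rule ev_scalar)
  then show "smul (pe e (psubst d \<Phi> p) z) x = smul (pe d p (\<lambda>i. pe e (\<Phi> i) z)) x"
    using ev_psubst[OF commuting_scalar, of e z d \<Phi> p x] by (simp add: ev_scalar)
qed

lemma ev_commute: "commuting A \<Longrightarrow> ev d A p (ev d A q x) = ev d A q (ev d A p x)"
  by (simp only: ev_mult[symmetric] mult.commute)

lemma commuting_ev: "commuting A \<Longrightarrow> commuting (\<lambda>i. ev e A (\<Phi> i))"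
  by (simp only: commuting_def[of "\<lambda>i. ev e A (\<Phi> i)"] lin_ev ev_commute) simp

lemma ev_cong_on:
  assumes Y: "\<And>i y. i < d \<Longrightarrow> y \<in> Y \<Longrightarrow> A i y \<in> Y"
    and eq: "\<And>i y. i < d \<Longrightarrow> y \<in> Y \<Longrightarrow> B i y = A i y" and x: "x \<in> Y"
  shows "ev d B p x = ev d A p x"
proof -
  have pow: "(B i ^^ k) y = (A i ^^ k) y \<and> (A i ^^ k) y \<in> Y" if "i < d" "y \<in> Y" for i k y
    using that by (induction k) (auto simp: Y eq)
  have "monom_op e B m x = monom_op e A m x" if "e \<le> d" for e m
    using that x
  proof (induction e arbitrary: x)
    case 0
    then show ?case by simp
  next
    case (Suc e)
    then show ?case using pow[of e x] by (simp add: monom_op_Suc)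
  qed
  then show ?thesis by (simp add: ev_def)
qed

lemma monom_op_invariant:
  assumes "\<And>i y. y \<in> Y \<Longrightarrow> A i y \<in> Y" "x \<in> Y"
  shows "monom_op d A m x \<in> Y"
  using assms(2)
proof (induction d arbitrary: x)
  case 0
  then show ?case by simp
next
  case (Suc d)
  have "(A d ^^ Poly_Mapping.lookup m d) x \<in> Y"
    using assms(1) Suc.prems by (rule funpow_invariant)
  then show ?case by (simp add: monom_op_Suc Suc.IH)
qed

lemma ev_invariant:
  assumes "V.subspace Y" "\<And>i y. y \<in> Y \<Longrightarrow> A i y \<in> Y" "x \<in> Y"
  shows "ev d A p x \<in> Y"
  unfolding ev_def
  by (intro V.subspace_sum[OF assms(1)] subspace_smul[OF assms(1)] monom_op_invariant assms)

lemma polys_cst: "cst c \<in> polys d"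
  by (auto simp: polys_def cst_def)

lemma polys_one: "1 \<in> polys d"
  using polys_cst[of 1] by (simp add: cst_1)

lemma polys_var: "i < d \<Longrightarrow> var i \<in> polys d"
  by (auto simp: polys_def var_def)

lemma polys_zero: "0 \<in> polys d"
  by (auto simp: polys_def)

lemma polys_add: "p \<in> polys d \<Longrightarrow> q \<in> polys d \<Longrightarrow> p + q \<in> polys d"
  using keys_add[of p q] unfolding polys_def by blast

lemma polys_uminus: "p \<in> polys d \<Longrightarrow> - p \<in> polys d"
  by (auto simp: polys_def in_keys_iff)

lemma polys_diff: "p \<in> polys d \<Longrightarrow> q \<in> polys d \<Longrightarrow> p - q \<in> polys d"
  using polys_add[of p d "- q"] polys_uminus[of q d] by simp

lemma polys_mult: "p \<in> polys d \<Longrightarrow> q \<in> polys d \<Longrightarrow> p * q \<in> polys d"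
proof -
  assume a: "p \<in> polys d" "q \<in> polys d"
  have "Poly_Mapping.keys m \<subseteq> {..<d}" if m: "m \<in> Poly_Mapping.keys (p * q)" for m
  proof -
    obtain m1 m2 where m: "m = m1 + m2" "m1 \<in> Poly_Mapping.keys p" "m2 \<in> Poly_Mapping.keys q"
      using m keys_mult[of p q] by blast
    then have "Poly_Mapping.keys m1 \<subseteq> {..<d}" "Poly_Mapping.keys m2 \<subseteq> {..<d}"
      using a by (auto simp: polys_def)
    then show ?thesis using keys_add[of m1 m2] m(1) by blast
  qed
  then show ?thesis by (simp add: polys_def)
qed

lemma polys_sum: "(\<And>i. i \<in> S \<Longrightarrow> p i \<in> polys d) \<Longrightarrow> sum p S \<in> polys d"
  by (induction S rule: infinite_finite_induct) (simp_all add: polys_zero polys_add)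

lemma polys_power: "p \<in> polys d \<Longrightarrow> p ^ k \<in> polys d"
  by (induction k) (simp_all add: polys_one polys_mult)

lemma polys_prod: "(\<And>i. i \<in> S \<Longrightarrow> p i \<in> polys d) \<Longrightarrow> prod p S \<in> polys d"
  by (induction S rule: infinite_finite_induct) (simp_all add: polys_one polys_mult)

lemma polys_psubst: "(\<And>i. i < d \<Longrightarrow> \<Phi> i \<in> polys e) \<Longrightarrow> psubst d \<Phi> p \<in> polys e"
  unfolding psubst_def by (intro polys_sum polys_mult polys_cst polys_prod polys_power) simp

section \<open>Polynomials as functions on the ball\<close>

definition fun_ball :: "nat \<Rightarrow> (nat \<Rightarrow> complex) set" where
  "fun_ball d = {z. (\<Sum>i<d. (cmod (z i))\<^sup>2) < 1}"

text \<open>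
  Uniqueness of base-$N$ digits, which separates the exponents in Kronecker's substitution.
\<close>

lemma base_representation_unique:
  fixes a b :: "nat \<Rightarrow> nat"
  assumes "\<And>i. i < d \<Longrightarrow> a i < N" "\<And>i. i < d \<Longrightarrow> b i < N"
    and "(\<Sum>i<d. a i * N ^ i) = (\<Sum>i<d. b i * N ^ i)" "i < d"
  shows "a i = b i"
  using assms
proof (induction d arbitrary: a b i)
  case 0
  then show ?case by simp
next
  case (Suc d)
  have split: "(\<Sum>i<Suc d. c i * N ^ i) = c 0 + N * (\<Sum>i<d. c (Suc i) * N ^ i)" for c
    by (simp add: sum.lessThan_Suc_shift sum_distrib_left mult_ac del: sum.lessThan_Suc)
  have eq: "a 0 + N * (\<Sum>i<d. a (Suc i) * N ^ i) = b 0 + N * (\<Sum>i<d. b (Suc i) * N ^ i)"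
    using Suc.prems(3) unfolding split .
  have "a 0 < N" "b 0 < N" using Suc.prems(1,2)[of 0] by auto
  then have 0: "a 0 = b 0"
    using arg_cong[OF eq, of "\<lambda>x. x mod N"] by simp
  have "(\<Sum>i<d. a (Suc i) * N ^ i) = (\<Sum>i<d. b (Suc i) * N ^ i)"
    using eq 0 \<open>a 0 < N\<close> by simp
  then have "a (Suc j) = b (Suc j)" if "j < d" for j
    using Suc.IH[of "\<lambda>i. a (Suc i)" "\<lambda>i. b (Suc i)" j] Suc.prems(1,2) that by simp
  then show ?case using 0 Suc.prems(4) by (cases i) auto
qed

text \<open>
  An identity between polynomial functions on the ball may be used for operators, because the
  coefficients are determined by the values on the ball. Kronecker's substitution $z_i = \eta t^{N^i}$
  reduces this to one variable: for $N$ larger than all exponents, distinct monomials become distinct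
  powers of $t$, and $\eta$ keeps the point inside the ball.
\<close>

lemma polys_eq_zeroI:
  assumes p: "p \<in> polys d" and zero: "\<And>z. z \<in> fun_ball d \<Longrightarrow> pe d p z = 0"
  shows "p = 0"
proof (rule ccontr)
  let ?l = Poly_Mapping.lookup and ?K = "Poly_Mapping.keys p"
  assume "p \<noteq> 0"
  then obtain m0 where m0: "m0 \<in> ?K" by (meson equals0I keys_eq_empty)
  define N where "N = Suc (\<Sum>m\<in>?K. \<Sum>i<d. ?l m i)"
  have N: "?l m i < N" if "m \<in> ?K" "i < d" for m i
  proof -
    have "?l m i \<le> (\<Sum>i<d. ?l m i)" using that by (intro member_le_sum) auto
    also have "\<dots> \<le> (\<Sum>m\<in>?K. \<Sum>i<d. ?l m i)"
      using that by (intro member_le_sum[where f = "\<lambda>m. \<Sum>i<d. ?l m i"]) auto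
    finally show ?thesis by (simp add: N_def)
  qed
  \<comment> \<open>Any $\eta > 0$ with $d\eta^2 < 1$ would do.\<close>
  define \<eta> :: real where "\<eta> = 1 / (real d + 1)"
  define code where "code m = (\<Sum>i<d. ?l m i * N ^ i)" for m :: "nat \<Rightarrow>\<^sub>0 nat"
  define w where "w m = (\<Prod>i<d. complex_of_real \<eta> ^ ?l m i)" for m :: "nat \<Rightarrow>\<^sub>0 nat"
  have inj: "inj_on code ?K"
  proof (rule inj_onI, rule poly_mapping_eqI)
    fix m m' i assume m: "m \<in> ?K" "m' \<in> ?K" "code m = code m'"
    show "?l m i = ?l m' i"
    proof (cases "i < d")
      case True
      then show ?thesis
        using base_representation_unique[of d "?l m" N "?l m'" i] N m by (simp add: code_def)
    next
      case False
      then have "i \<notin> Poly_Mapping.keys m" "i \<notin> Poly_Mapping.keys m'"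
        using p m by (auto simp: polys_def)
      then show ?thesis by (simp add: in_keys_iff)
    qed
  qed
  define P where "P = (\<Sum>m\<in>?K. monom (?l p m * w m) (code m))"
  have "poly P t = 0" if t: "t \<in> ball 0 1" for t
  proof -
    define z where "z i = complex_of_real \<eta> * t ^ (N ^ i)" for i
    have "(cmod (z i))\<^sup>2 \<le> \<eta>\<^sup>2" for i
    proof -
      have "cmod t ^ (N ^ i) \<le> 1" using t by (intro power_le_one) auto
      then have "cmod (z i) \<le> \<eta> * 1"
        unfolding z_def norm_mult norm_power norm_of_real
        by (intro mult_mono) (auto simp: \<eta>_def)
      then show ?thesis by (intro power_mono) auto
    qed
    then have "(\<Sum>i<d. (cmod (z i))\<^sup>2) \<le> (\<Sum>i<d. \<eta>\<^sup>2)" by (intro sum_mono) auto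
    also have "\<dots> = real d * \<eta>\<^sup>2" by simp
    also have "\<dots> < 1"
    proof -
      have "0 \<le> real d * real d" by simp
      then have "real d < (real d + 1)\<^sup>2"
        unfolding power2_eq_square by (simp only: distrib_left distrib_right mult_1_left mult_1_right)
      then show ?thesis by (simp add: \<eta>_def power_divide divide_less_eq)
    qed
    finally have "pe d p z = 0" by (intro zero) (simp add: fun_ball_def)
    moreover have "(\<Prod>i<d. z i ^ ?l m i) = w m * t ^ code m" for m
      unfolding z_def w_def code_def power_mult_distrib prod.distrib power_sum
      by (simp add: mult.commute flip: power_mult)
    ultimately show ?thesis
      by (simp add: P_def poly_sum poly_monom pe_def mult.assoc)
  qed
  then have "ball 0 1 \<subseteq> {t. poly P t = 0}" by auto
  moreover have "infinite (ball (0::complex) 1)"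
    using uncountable_ball[of 1 "0::complex"] countable_finite by auto
  ultimately have "P = 0" using poly_roots_finite infinite_super by blast
  moreover have "coeff P (code m0) = ?l p m0 * w m0"
  proof -
    have "coeff P (code m0) = (\<Sum>m\<in>?K. if m = m0 then ?l p m * w m else 0)"
      unfolding P_def coeff_sum coeff_monom
      using inj m0 by (intro sum.cong refl) (auto simp: inj_on_def)
    then show ?thesis using m0 by simp
  qed
  moreover have "w m0 \<noteq> 0" 
  proof -
    have "\<eta> \<noteq> 0" by (simp add: \<eta>_def)
    then show ?thesis by (simp add: w_def)
  qed
  ultimately show False using m0 by (simp add: in_keys_iff)
qed

section \<open>Norms and column contractions\<close>

text \<open>
  Coordinates with index at least \<open>n\<close> are ignored, so this is a norm on \<open>supported n\<close> only.
\<close>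

definition nrm :: "nat \<Rightarrow> cvec \<Rightarrow> real" where
  "nrm n x = L2_set (\<lambda>i. cmod (coord x i)) {..<n}"

lemma nrm_nonneg [simp]: "0 \<le> nrm n x"
  by (simp add: nrm_def L2_set_nonneg)

lemma nrm_zero [simp]: "nrm n 0 = 0"
  by (simp add: nrm_def L2_set_def)

lemma nrm_power2: "(nrm n x)\<^sup>2 = (\<Sum>k<n. (cmod (coord x k))\<^sup>2)"
  by (simp add: nrm_def L2_set_def sum_nonneg)

lemma nrm_smul: "nrm n (smul c x) = cmod c * nrm n x"
  by (simp add: nrm_def norm_mult L2_set_right_distrib)

lemma nrm_triangle: "nrm n (x + y) \<le> nrm n x + nrm n y"
proof -
  have "nrm n (x + y) \<le> L2_set (\<lambda>i. cmod (coord x i) + cmod (coord y i)) {..<n}"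
    unfolding nrm_def by (intro L2_set_mono) (auto simp: lookup_add norm_triangle_ineq)
  also have "\<dots> \<le> nrm n x + nrm n y"
    unfolding nrm_def by (rule L2_set_triangle_ineq)
  finally show ?thesis .
qed

lemma nrm_uminus: "nrm n (- x) = nrm n x"
  by (simp add: nrm_def)

lemma nrm_triangle_diff: "nrm n (x - y) \<le> nrm n x + nrm n y"
  using nrm_triangle[of n x "- y"] by (simp add: nrm_uminus)

lemma nrm_sum: "nrm n (sum f S) \<le> (\<Sum>i\<in>S. nrm n (f i))"
proof (induction S rule: infinite_finite_induct)
  case (insert a S)
  then show ?case using nrm_triangle[of n "f a" "sum f S"] by simp
qed simp_all

lemma nrm_eq_zero: "x \<in> supported n \<Longrightarrow> nrm n x = 0 \<Longrightarrow> x = 0"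
proof (rule cvec_eqI)
  fix i assume "x \<in> supported n" "nrm n x = 0"
  moreover then have "(\<Sum>k<n. (cmod (coord x k))\<^sup>2) = 0"
    using nrm_power2[of n x] by simp
  ultimately show "coord x i = coord 0 i"
    by (cases "i < n") (auto simp: sum_nonneg_eq_0_iff supported_def)
qed

lemma nrm_limit_le:
  assumes "(\<lambda>L. nrm n (u L - v)) \<longlonglongrightarrow> 0" "\<And>L. nrm n (u L) \<le> K"
  shows "nrm n v \<le> K"
proof (rule LIMSEQ_le_const)
  show "(\<lambda>L. K + nrm n (u L - v)) \<longlonglongrightarrow> K"
    using tendsto_add[OF tendsto_const[of K] assms(1)] by simp
  have "nrm n v \<le> K + nrm n (u L - v)" for L
    using nrm_triangle_diff[of n "u L" "u L - v"] assms(2)[of L] by simp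
  then show "\<exists>N. \<forall>L\<ge>N. nrm n v \<le> K + nrm n (u L - v)" by blast
qed

text \<open>
  Strong convergence of uniformly bounded operators is preserved by products, hence by polynomials.
  Every limiting argument below, for dilations and for truncated geometric series, is an instance.
\<close>

lemma ev_tendsto:
  assumes Y: "V.subspace Y" "\<And>i y. i < d \<Longrightarrow> y \<in> Y \<Longrightarrow> A i y \<in> Y"
    and F: "\<And>L i y. i < d \<Longrightarrow> y \<in> Y \<Longrightarrow> F L i y \<in> Y" "\<And>L i. lin (F L i)"
    and bd: "\<And>L i y. i < d \<Longrightarrow> y \<in> Y \<Longrightarrow> nrm n (F L i y) \<le> c * nrm n y"
    and conv: "\<And>i y. i < d \<Longrightarrow> y \<in> Y \<Longrightarrow> (\<lambda>L. nrm n (F L i y - A i y)) \<longlonglongrightarrow> 0"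
    and x: "x \<in> Y"
  shows "(\<lambda>L. nrm n (ev d (F L) p x - ev d A p x)) \<longlonglongrightarrow> 0"
proof -
  define G where "G u v \<longleftrightarrow> (\<forall>L. u L \<in> Y) \<and> v \<in> Y \<and> (\<lambda>L. nrm n (u L - v)) \<longlonglongrightarrow> 0" 
    for u :: "nat \<Rightarrow> cvec" and v
  have step: "G (\<lambda>L. F L i (u L)) (A i v)" if i: "i < d" and g: "G u v" for i u v
  proof -
    have uv: "u L \<in> Y" "v \<in> Y" "u L - v \<in> Y" for L
      using g Y(1) by (auto simp: G_def V.subspace_diff)
    have ineq: "norm (nrm n (F L i (u L) - A i v)) \<le> c * nrm n (u L - v) + nrm n (F L i v - A i v)" for L
    proof -
      have "F L i (u L) - A i v = F L i (u L - v) + (F L i v - A i v)"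
        by (simp add: lin_minus[OF F(2)])
      then have "nrm n (F L i (u L) - A i v) \<le> nrm n (F L i (u L - v)) + nrm n (F L i v - A i v)"
        using nrm_triangle by metis
      then show ?thesis using bd[OF i uv(3)[of L], of L] by simp
    qed
    have "(\<lambda>L. c * nrm n (u L - v) + nrm n (F L i v - A i v)) \<longlonglongrightarrow> c * 0 + 0"
      using g by (intro tendsto_add tendsto_mult_left conv[OF i uv(2)]) (simp add: G_def)
    then have "(\<lambda>L. c * nrm n (u L - v) + nrm n (F L i v - A i v)) \<longlonglongrightarrow> 0" by simp
    then have "(\<lambda>L. nrm n (F L i (u L) - A i v)) \<longlonglongrightarrow> 0"
      by (rule Lim_null_comparison[OF always_eventually, OF allI, OF ineq])
    then show ?thesis using uv i Y(2) F(1) by (simp add: G_def)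
  qed
  have pow: "G (\<lambda>L. (F L i ^^ k) (u L)) ((A i ^^ k) v)" if "i < d" "G u v" for i k u v
    using that by (induction k) (simp_all add: step)
  have mon: "G (\<lambda>L. monom_op e (F L) m (u L)) (monom_op e A m v)" if "e \<le> d" "G u v" for e m u v
    using that
  proof (induction e arbitrary: u v)
    case 0
    then show ?case by simp
  next
    case (Suc e)
    then show ?case using pow[of e u v] by (simp add: monom_op_Suc)
  qed
  have "G (\<lambda>L. x) x" using x by (simp add: G_def)
  from mon[OF order_refl this]
  have conv': "(\<lambda>L. nrm n (monom_op d (F L) m x - monom_op d A m x)) \<longlonglongrightarrow> 0" for m
    by (simp add: G_def)
  let ?K = "Poly_Mapping.keys p" and ?l = "Poly_Mapping.lookup p"
  have ineq: "norm (nrm n (ev d (F L) p x - ev d A p x))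
      \<le> (\<Sum>m\<in>?K. cmod (?l m) * nrm n (monom_op d (F L) m x - monom_op d A m x))" for L
  proof -
    have "ev d (F L) p x - ev d A p x = (\<Sum>m\<in>?K. smul (?l m) (monom_op d (F L) m x - monom_op d A m x))"
      by (simp add: ev_def sum_subtractf V.scale_right_diff_distrib)
    then show ?thesis
      using nrm_sum[of n "\<lambda>m. smul (?l m) (monom_op d (F L) m x - monom_op d A m x)" ?K]
      by (simp add: nrm_smul)
  qed
  have "(\<lambda>L. \<Sum>m\<in>?K. cmod (?l m) * nrm n (monom_op d (F L) m x - monom_op d A m x)) 
      \<longlonglongrightarrow> (\<Sum>m\<in>?K. cmod (?l m) * 0)"
    by (intro tendsto_sum tendsto_mult_left conv')
  then have "(\<lambda>L. \<Sum>m\<in>?K. cmod (?l m) * nrm n (monom_op d (F L) m x - monom_op d A m x)) \<longlonglongrightarrow> 0"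
    by simp
  then show ?thesis
    by (rule Lim_null_comparison[OF always_eventually, OF allI, OF ineq])
qed

text \<open>
  The condition is dual to being a row contraction. Columns are used because it passes to every
  invariant subspace, whereas row contractions would have to be compressed to quotients.
\<close>

definition col_contraction :: "nat \<Rightarrow> nat \<Rightarrow> (nat \<Rightarrow> cvec \<Rightarrow> cvec) \<Rightarrow> cvec set \<Rightarrow> bool" where
  "col_contraction d n A Y \<longleftrightarrow> (\<forall>y\<in>Y. (\<Sum>i<d. (nrm n (A i y))\<^sup>2) \<le> (nrm n y)\<^sup>2)"

lemma col_contractionD: "col_contraction d n A Y \<Longrightarrow> y \<in> Y \<Longrightarrow> (\<Sum>i<d. (nrm n (A i y))\<^sup>2) \<le> (nrm n y)\<^sup>2"
  by (simp add: col_contraction_def)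

lemma col_contraction_entry:
  assumes "col_contraction d n A Y" "y \<in> Y" "i < d"
  shows "nrm n (A i y) \<le> nrm n y"
proof (rule power2_le_imp_le)
  have "(nrm n (A i y))\<^sup>2 \<le> (\<Sum>i<d. (nrm n (A i y))\<^sup>2)"
    using assms(3) by (intro member_le_sum[of i "{..<d}" "\<lambda>i. (nrm n (A i y))\<^sup>2"]) auto
  also have "\<dots> \<le> (nrm n y)\<^sup>2" using assms by (intro col_contractionD)
  finally show "(nrm n (A i y))\<^sup>2 \<le> (nrm n y)\<^sup>2" .
qed simp

text \<open>
  Cauchy-Schwarz, in the form that makes $\sum_i \bar\lambda_i A_i$ a strict contraction when
  $|\lambda| < 1$.
\<close>

lemma col_contraction_comb:
  assumes "col_contraction d n A Y" "y \<in> Y"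
  shows "nrm n (\<Sum>i<d. smul (a i) (A i y)) \<le> sqrt (\<Sum>i<d. (cmod (a i))\<^sup>2) * nrm n y"
proof -
  have "nrm n (\<Sum>i<d. smul (a i) (A i y)) \<le> (\<Sum>i<d. cmod (a i) * nrm n (A i y))"
    using nrm_sum[of n "\<lambda>i. smul (a i) (A i y)" "{..<d}"] by (simp add: nrm_smul)
  also have "\<dots> = (\<Sum>i<d. \<bar>cmod (a i)\<bar> * \<bar>nrm n (A i y)\<bar>)" by simp
  also have "\<dots> \<le> L2_set (\<lambda>i. cmod (a i)) {..<d} * L2_set (\<lambda>i. nrm n (A i y)) {..<d}"
    by (rule L2_set_mult_ineq)
  also have "\<dots> \<le> sqrt (\<Sum>i<d. (cmod (a i))\<^sup>2) * nrm n y"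
  proof (rule mult_mono)
    show "L2_set (\<lambda>i. nrm n (A i y)) {..<d} \<le> nrm n y"
      using col_contractionD[OF assms] unfolding L2_set_def by (simp add: real_le_lsqrt)
  qed (simp_all add: L2_set_def sum_nonneg)
  finally show ?thesis .
qed

definition ball_bound :: "nat \<Rightarrow> mpoly \<Rightarrow> real \<Rightarrow> bool" where
  "ball_bound d p S \<longleftrightarrow> (\<forall>z\<in>fun_ball d. cmod (pe d p z) \<le> S)"

lemma ball_boundD: "ball_bound d p S \<Longrightarrow> z \<in> fun_ball d \<Longrightarrow> cmod (pe d p z) \<le> S"
  by (simp add: ball_bound_def)

lemma zero_in_fun_ball: "(\<lambda>_. 0) \<in> fun_ball d"
  by (simp add: fun_ball_def)

lemma ball_bound_nonneg: "ball_bound d p S \<Longrightarrow> 0 \<le> S"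
  using ball_boundD[OF _ zero_in_fun_ball, of d p S] norm_ge_zero order_trans by blast

text \<open>
  Estimates may be proved for $rA$ with $r < 1$ and then carried over to $A$.
\<close>

lemma dilation_limit:
  assumes Y: "V.subspace Y" "\<And>i. lin (A i)" "\<And>i y. i < d \<Longrightarrow> y \<in> Y \<Longrightarrow> A i y \<in> Y"
    and A: "\<And>i y. i < d \<Longrightarrow> y \<in> Y \<Longrightarrow> nrm n (A i y) \<le> nrm n y" and x: "x \<in> Y"
    and K: "\<And>r::real. 0 < r \<Longrightarrow> r < 1 \<Longrightarrow> nrm n (ev d (\<lambda>i y. smul (of_real r) (A i y)) p x) \<le> K"
  shows "nrm n (ev d A p x) \<le> K"
proof (rule nrm_limit_le)
  define \<delta> where "\<delta> L = 1 / real (L + 2)" for L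
  define r where "r L = 1 - \<delta> L" for L
  have \<delta>: "0 < \<delta> L" "\<delta> L < 1" for L by (simp_all add: \<delta>_def)
  have r: "0 < r L" "r L < 1" for L using \<delta>[of L] by (simp_all add: r_def)
  have r1: "\<delta> \<longlonglongrightarrow> 0"
    unfolding \<delta>_def[abs_def] by (rule LIMSEQ_ignore_initial_segment[OF lim_1_over_n, of 2])
  show "(\<lambda>L. nrm n (ev d (\<lambda>i y. smul (of_real (r L)) (A i y)) p x - ev d A p x)) \<longlonglongrightarrow> 0"
  proof (rule ev_tendsto[where Y = Y and c = 1])
    fix L i y assume i: "i < d" "y \<in> Y"
    show "smul (of_real (r L)) (A i y) \<in> Y" by (intro subspace_smul Y i)
    have "r L * nrm n (A i y) \<le> 1 * nrm n y"
      using r[of L] A[OF i] by (intro mult_mono) auto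
    then show "nrm n (smul (of_real (r L)) (A i y)) \<le> 1 * nrm n y"
      using r[of L] by (simp add: nrm_smul)
  next
    fix i y assume i: "i < d" "y \<in> Y"
    have "smul (of_real (r L)) (A i y) - A i y = smul (of_real (- \<delta> L)) (A i y)" for L
      by (simp only: r_def of_real_diff of_real_1 of_real_minus V.scale_left_diff_distrib V.scale_one V.scale_minus_left) simp
    then have "nrm n (smul (of_real (r L)) (A i y) - A i y) = \<delta> L * nrm n (A i y)" for L
      using \<delta>[of L] by (simp only: nrm_smul norm_of_real abs_minus_cancel abs_of_pos)
    moreover have "(\<lambda>L. \<delta> L * nrm n (A i y)) \<longlonglongrightarrow> 0 * nrm n (A i y)"
      by (intro tendsto_mult_right r1)
    ultimately show "(\<lambda>L. nrm n (smul (of_real (r L)) (A i y) - A i y)) \<longlonglongrightarrow> 0" by simp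
  next
    show "lin (\<lambda>y. smul (of_real (r L)) (A i y))" for L i by (intro lin_scale Y)
  qed (fact Y x)+
  show "nrm n (ev d (\<lambda>i y. smul (of_real (r L)) (A i y)) p x) \<le> K" for L
    using r by (intro K)
qed


section \<open>Automorphisms of the ball\<close>

text \<open>
  With $u = c/(1+s)$ the vector on the left is $\lambda(\eta - u) - s a$, so its norm can be expanded;
  the claim is then a polynomial identity in $\eta$, $u$ and $s$. Applied to $\eta = 1$ it shows that the
  automorphism $\varphi_\lambda$ maps the ball to itself, and applied to the coordinates of vectors it
  shows that $\varphi_\lambda$ preserves column contractions.
\<close>

lemma moebius_identity:
  fixes lam a :: "nat \<Rightarrow> complex" and \<eta> :: complex
  assumes L: "(\<Sum>i<d. (cmod (lam i))\<^sup>2) = 1 - s\<^sup>2" and s: "s \<ge> 0"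
    and c: "c = (\<Sum>i<d. cnj (lam i) * a i)"
  shows "(cmod (\<eta> - c))\<^sup>2 - (\<Sum>i<d. (cmod (lam i * \<eta> - of_real s * a i - lam i / of_real (1 + s) * c))\<^sup>2)
     = s\<^sup>2 * ((cmod \<eta>)\<^sup>2 - (\<Sum>i<d. (cmod (a i))\<^sup>2))"
proof -
  define u where "u = c / of_real (1 + s)"
  have "complex_of_real (1 + s) \<noteq> 0" unfolding of_real_eq_0_iff using s by linarith
  then have cu: "c = of_real (1 + s) * u" by (simp add: u_def)
  have sq: "(cmod (x - y))\<^sup>2 = (cmod x)\<^sup>2 + (cmod y)\<^sup>2 - 2 * Re (cnj x * y)" for x y
    unfolding cmod_power2 by (simp add: power2_eq_square algebra_simps)
  have trm: "(cmod (lam i * \<eta> - of_real s * a i - lam i / of_real (1 + s) * c))\<^sup>2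
    = (cmod (\<eta> - u))\<^sup>2 * (cmod (lam i))\<^sup>2 + s\<^sup>2 * (cmod (a i))\<^sup>2 
       - 2 * s * Re (cnj (\<eta> - u) * (cnj (lam i) * a i))" for i
  proof -
    have e1: "lam i * \<eta> - of_real s * a i - lam i / of_real (1 + s) * c
        = lam i * (\<eta> - u) - of_real s * a i" by (simp add: u_def algebra_simps)
    have e2: "cnj (lam i * (\<eta> - u)) * (of_real s * a i)
        = of_real s * (cnj (\<eta> - u) * (cnj (lam i) * a i))"
      by (simp only: complex_cnj_mult mult_ac)
    have e3: "Re (of_real s * w) = s * Re w" for w by simp
    show ?thesis
      unfolding e1 sq[of "lam i * (\<eta> - u)"] e2 e3 norm_mult power_mult_distrib norm_of_real power2_abs
      by (simp only: mult_ac)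
  qed
  have "(\<Sum>i<d. Re (cnj (\<eta> - u) * (cnj (lam i) * a i))) = Re (cnj (\<eta> - u) * c)"
    by (simp only: c sum_distrib_left Re_sum)
  then have "(\<Sum>i<d. (cmod (lam i * \<eta> - of_real s * a i - lam i / of_real (1 + s) * c))\<^sup>2)
    = (cmod (\<eta> - u))\<^sup>2 * (1 - s\<^sup>2) + s\<^sup>2 * (\<Sum>i<d. (cmod (a i))\<^sup>2) - 2 * s * Re (cnj (\<eta> - u) * c)"
    by (simp only: trm sum_subtractf sum.distrib sum_distrib_left[symmetric] L)
  moreover have "(cmod (\<eta> - c))\<^sup>2 = s\<^sup>2 * (cmod \<eta>)\<^sup>2 + (cmod (\<eta> - u))\<^sup>2 * (1 - s\<^sup>2) - 2 * s * Re (cnj (\<eta> - u) * c)"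
    unfolding cu cmod_power2 by (simp add: power2_eq_square algebra_simps)
  ultimately show ?thesis by (simp add: algebra_simps)
qed

text \<open>
  The partial sums of the Neumann series of $1 - E$.
\<close>

lemma geometric_telescope:
  assumes "lin E"
  shows "(\<Sum>j\<le>L. (E ^^ j) (u - E u)) = u - (E ^^ Suc L) u"
proof (induction L)
  case (Suc L)
  have "(E ^^ Suc L) (u - E u) = (E ^^ Suc L) u - (E ^^ Suc L) (E u)"
    by (rule lin_minus[OF lin_funpow[OF assms]])
  then show ?case using Suc by (simp add: funpow_swap1)
qed simp

text \<open>
  The automorphism
  $\varphi_\lambda(z)_i = (\lambda_i - s z_i - \lambda_i \langle z, \lambda\rangle / (1+s)) / (1 - \langle z, \lambda\rangle)$
  with $s = \sqrt{1 - |\lambda|^2}$ is an involution of the ball. The tuple $B = \varphi_\lambda(A)$ is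
  again a commuting column contraction, and $\lambda$ has been moved to the origin: $B_i$ maps $Y$ into
  $W$. Since $A = \varphi_\lambda(B)$, an estimate for $p(A)$ follows from one for $p \circ \varphi_\lambda$
  at $B$. To stay within polynomials, the denominator of $\varphi_\lambda$ is replaced by a partial sum of
  the geometric series and the result is shrunk by the factor $1/(1 + |\lambda|^{L+1})$; this polynomial
  map $\Phi_L$ sends the ball into itself exactly, so $p \circ \Phi_L$ has no larger supremum than $p$, and
  $\Phi_L(B) \to A$ strongly.
\<close>

lemma moebius_transfer:
  assumes Y: "fin_subspace Y" "Y \<subseteq> supported n" and A: "commuting A" "invariant A Y" "col_contraction d n A Y"
    and W: "V.subspace W" "invariant A W" "W \<subseteq> Y"
    and lam: "\<And>i y. i < d \<Longrightarrow> y \<in> Y \<Longrightarrow> A i y - smul (lam i) y \<in> W" "(\<Sum>i<d. (cmod (lam i))\<^sup>2) < 1"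
    and base: "\<And>B h S x. commuting B \<Longrightarrow> invariant B Y \<Longrightarrow> invariant B W \<Longrightarrow> col_contraction d n B Y \<Longrightarrow>
      (\<And>i y. i < d \<Longrightarrow> y \<in> Y \<Longrightarrow> B i y \<in> W) \<Longrightarrow> h \<in> polys d \<Longrightarrow> ball_bound d h S \<Longrightarrow> x \<in> Y \<Longrightarrow>
      nrm n (ev d B h x) \<le> K * S * nrm n x"
    and p: "p \<in> polys d" "ball_bound d p S" and x: "x \<in> Y"
  shows "nrm n (ev d A p x) \<le> K * S * nrm n x"
proof -
  have sY: "V.subspace Y" using Y(1) by (rule fin_subspaceD)
  have lA: "lin (A i)" for i using A(1) by (rule commuting_lin)
  define \<Lambda> where "\<Lambda> = (\<Sum>i<d. (cmod (lam i))\<^sup>2)"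
  define l where "l = sqrt \<Lambda>"
  define s where "s = sqrt (1 - \<Lambda>)"
  have \<Lambda>: "0 \<le> \<Lambda>" "\<Lambda> < 1" using lam(2) by (simp_all add: \<Lambda>_def sum_nonneg)
  have l: "0 \<le> l" "l < 1" using \<Lambda> by (simp_all add: l_def real_sqrt_lt_1_iff)
  have s: "0 < s" "s\<^sup>2 = 1 - \<Lambda>" "\<Lambda> = 1 - s\<^sup>2" using \<Lambda> by (simp_all add: s_def)
  have cl: "(\<Sum>i<d. cnj (lam i) * lam i) = of_real \<Lambda>"
    unfolding \<Lambda>_def of_real_sum by (intro sum.cong refl) (simp add: complex_norm_square mult.commute del: of_real_power)
  define \<kappa> where "\<kappa> i = lam i / of_real (1 + s)" for i
  have s1: "complex_of_real (1 + s) \<noteq> 0" unfolding of_real_eq_0_iff using s by linarith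
  have k1: "lam i = \<kappa> i + of_real s * \<kappa> i" for i
  proof -
    have "\<kappa> i * of_real (1 + s) = lam i" using s1 by (simp add: \<kappa>_def)
    then show ?thesis by (simp add: algebra_simps)
  qed
  define C where "C y = (\<Sum>i<d. smul (cnj (lam i)) (A i y))" for y
  have lC: "lin C" unfolding C_def[abs_def] by (intro lin_Sum lin_scale lA)
  have CY: "C y \<in> Z" if "V.subspace Z" "invariant A Z" "y \<in> Z" for y Z
    unfolding C_def by (intro V.subspace_sum[OF that(1)] subspace_smul[OF that(1)] invariantD[OF that(2)] that(3))
  have AC: "A i (C y) = C (A i y)" for i y
    unfolding C_def by (simp add: lin_sum[OF lA] lin_smul[OF lA] commuting_commute[OF A(1), of i])
  have C_le: "nrm n (C y) \<le> l * nrm n y" if "y \<in> Y" for y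
    using col_contraction_comb[OF A(3) that, of "\<lambda>i. cnj (lam i)"] by (simp add: C_def l_def \<Lambda>_def)
  have inj: "y = 0" if "y \<in> Y" "C y = smul 1 y" for y
  proof -
    have "nrm n y \<le> l * nrm n y" using C_le[OF that(1)] that(2) by simp
    then have "nrm n y = 0" using l nrm_nonneg[of n y]
      by (metis mult_left_le_one_le mult_cancel_right1 nrm_nonneg order.antisym less_imp_le order_less_irrefl)
    then show ?thesis using nrm_eq_zero Y(2) that(1) by blast
  qed
  obtain h where h: "\<And>y. y \<in> Y \<Longrightarrow> C (poly_op h C y) - smul 1 (poly_op h C y) = y"
  proof (rule inverse_is_poly[OF Y(1) lC CY[OF sY A(2)] inj])
    fix h assume "\<And>y. y \<in> Y \<Longrightarrow> C (poly_op h C y) - smul 1 (poly_op h C y) = y"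
    then show thesis by (rule that)
  qed
  define D where "D y = - poly_op h C y" for y
  have lD: "lin D"
  proof -
    have "D = (\<lambda>y. smul (-1) (poly_op h C y))" by (rule ext) (simp add: D_def)
    then show ?thesis by (simp only: lin_scale[OF lin_poly_op[OF lC]])
  qed
  have D: "y = D y - C (D y)" if "y \<in> Y" for y
    using h[OF that] lin_smul[OF lC, of "-1" "poly_op h C y"] by (simp add: D_def)
  have DC: "D (C y) = C (D y)" for y
    using poly_op_commute[OF lC lC, of h y] lin_smul[OF lC, of "-1" "poly_op h C y"] by (simp add: D_def)
  have DA: "D (A i y) = A i (D y)" for i y
    using poly_op_commute[OF lC lA, of i h y] AC[of i] lin_smul[OF lA, of i "-1" "poly_op h C y"] by (simp add: D_def)
  have DY: "D y \<in> Z" if "V.subspace Z" "invariant A Z" "y \<in> Z" for y Z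
    unfolding D_def by (intro V.subspace_neg[OF that(1)] poly_op_invariant[OF lC that(1) CY[OF that(1,2)] that(3)])
  define u where "u i y = smul (lam i) y - smul (of_real s) (A i y) - smul (\<kappa> i) (C y)" for i y
  define B where "B i y = D (u i y)" for i y
  have lu: "lin (u i)" for i
    unfolding u_def[abs_def] by (intro lin_diff lin_scale lin_id lA lC)
  have lB: "lin (B i)" for i
    unfolding B_def[abs_def] by (rule lin_comp[OF lD lu])
  have uA: "u i (A j y) = A j (u i y)" for i j y
    unfolding u_def lin_minus[OF lA] lin_smul[OF lA] AC commuting_commute[OF A(1), of j i y] ..
  have uC: "u i (C y) = C (u i y)" for i y
    unfolding u_def lin_minus[OF lC] lin_smul[OF lC] AC ..
  have uu: "u i (u j y) = u j (u i y)" for i j y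
  proof -
    have "u i (u j y) = smul (lam j) (u i y) - smul (of_real s) (A j (u i y)) - smul (\<kappa> j) (C (u i y))"
      unfolding u_def[of j y] lin_minus[OF lu] lin_smul[OF lu] uA uC ..
    then show ?thesis unfolding u_def[of j "u i y"] .
  qed
  have uD: "u i (D y) = D (u i y)" for i y
    unfolding u_def lin_minus[OF lD] lin_smul[OF lD] DC DA ..
  have BB: "B i (B j y) = B j (B i y)" for i j y
    unfolding B_def uD uu[of i j] ..
  have cB: "commuting B"
    unfolding commuting_def by (intro conjI allI lB BB)
  have uY: "u i y \<in> Z" if "V.subspace Z" "invariant A Z" "y \<in> Z" for i y Z
    unfolding u_def 
    by (intro V.subspace_diff[OF that(1)] subspace_smul[OF that(1)] invariantD[OF that(2)] CY[OF that(1,2)] that(3))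
  have iB: "invariant B Z" if "V.subspace Z" "invariant A Z" for Z
    unfolding invariant_def B_def by (intro allI ballI DY[OF that] uY[OF that])
  have BW: "B i y \<in> W" if i: "i < d" "y \<in> Y" for i y
  proof -
    have CW: "C y - smul (of_real \<Lambda>) y \<in> W"
    proof -
      have "C y - smul (of_real \<Lambda>) y = (\<Sum>i<d. smul (cnj (lam i)) (A i y - smul (lam i) y))"
        by (simp add: C_def V.scale_right_diff_distrib sum_subtractf flip: cl V.scale_sum_left)
      also have "\<dots> \<in> W" using i by (intro V.subspace_sum[OF W(1)] subspace_smul[OF W(1)] lam(1)) auto
      finally show ?thesis .
    qed
    have L: "complex_of_real \<Lambda> = 1 - of_real s * of_real s"
      unfolding s(3) by (simp add: power2_eq_square)
    have "u i y = smul (- of_real s) (A i y - smul (lam i) y) - smul (\<kappa> i) (C y - smul (of_real \<Lambda>) y)"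
    proof (rule cvec_eqI)
      fix k
      show "coord (u i y) k = coord (smul (- of_real s) (A i y - smul (lam i) y) - smul (\<kappa> i) (C y - smul (of_real \<Lambda>) y)) k"
        unfolding u_def lookup_minus coord_smul L k1[of i] by (simp add: algebra_simps)
    qed
    also have "\<dots> \<in> W" by (intro V.subspace_diff[OF W(1)] subspace_smul[OF W(1)] lam(1) CW i)
    finally show ?thesis unfolding B_def by (intro DY W)
  qed
  have B_contr: "col_contraction d n B Y"
    unfolding col_contraction_def
  proof
    fix x assume x: "x \<in> Y"
    define y where "y = D x"
    have y: "y \<in> Y" "x = y - C y" using DY[OF sY A(2) x] D[OF x] by (simp_all add: y_def)
    have Bx: "B i x = u i y" for i by (simp add: B_def y_def uD)
    have "(nrm n x)\<^sup>2 - (\<Sum>i<d. (nrm n (B i x))\<^sup>2)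
      = (\<Sum>k<n. (cmod (coord x k))\<^sup>2 - (\<Sum>i<d. (cmod (coord (u i y) k))\<^sup>2))"
      unfolding nrm_power2 Bx sum_subtractf by (subst sum.swap) (rule refl)
    also have "\<dots> = (\<Sum>k<n. s\<^sup>2 * ((cmod (coord y k))\<^sup>2 - (\<Sum>i<d. (cmod (coord (A i y) k))\<^sup>2)))"
    proof (rule sum.cong[OF refl])
      fix k
      have "coord (C y) k = (\<Sum>i<d. cnj (lam i) * coord (A i y) k)"
        by (simp add: C_def lookup_sum)
      from moebius_identity[OF s(3)[unfolded \<Lambda>_def] less_imp_le[OF s(1)] this, of "coord y k"]
      show "(cmod (coord x k))\<^sup>2 - (\<Sum>i<d. (cmod (coord (u i y) k))\<^sup>2)
         = s\<^sup>2 * ((cmod (coord y k))\<^sup>2 - (\<Sum>i<d. (cmod (coord (A i y) k))\<^sup>2))"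
        by (simp only: y(2) u_def \<kappa>_def lookup_minus coord_smul)
    qed
    also have "\<dots> = s\<^sup>2 * ((nrm n y)\<^sup>2 - (\<Sum>i<d. (nrm n (A i y))\<^sup>2))"
      unfolding nrm_power2 sum_distrib_left[symmetric] sum_subtractf by (subst (2) sum.swap) (rule refl)
    also have "\<dots> \<ge> 0" using col_contractionD[OF A(3) y(1)] by simp
    finally show "(\<Sum>i<d. (nrm n (B i x))\<^sup>2) \<le> (nrm n x)\<^sup>2" by simp
  qed
  define e where "e = (\<Sum>i<d. cst (cnj (lam i)) * var i)"
  define \<psi> where "\<psi> i = cst (lam i) - cst (of_real s) * var i - cst (\<kappa> i) * e" for i
  \<comment> \<open>The inverse automorphism, approximated by polynomial maps of the ball into itself.\<close>
  define c where "c L = 1 / (1 + l ^ Suc L)" for L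
  define \<Phi> where "\<Phi> L i = cst (of_real (c L)) * ((\<Sum>j\<le>L. e ^ j) * \<psi> i)" for L i
  have c: "0 < c L" "c L \<le> 1" for L
    using l zero_le_power[of l "Suc L"] unfolding c_def by (simp_all add: add_pos_nonneg)
  define E where "E = ev d B e"
  have lE: "lin E" unfolding E_def by (rule lin_ev[OF cB])
  have E: "E y = (\<Sum>i<d. smul (cnj (lam i)) (B i y))" for y
    unfolding E_def e_def ev_sum by (intro sum.cong refl) (simp add: ev_mult[OF cB] ev_cst ev_var)
  have EY: "E y \<in> Y" if "y \<in> Y" for y
    unfolding E_def using iB[OF sY A(2)] by (intro ev_invariant[OF sY _ that]) (rule invariantD)
  have E_le: "nrm n (E y) \<le> l * nrm n y" if "y \<in> Y" for y
    using col_contraction_comb[OF B_contr that, of "\<lambda>i. cnj (lam i)"] by (simp add: E l_def \<Lambda>_def)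
  have Ek: "(E ^^ k) y \<in> Y \<and> nrm n ((E ^^ k) y) \<le> l ^ k * nrm n y" if "y \<in> Y" for k y
  proof (induction k)
    case (Suc k)
    have "nrm n (E ((E ^^ k) y)) \<le> l * nrm n ((E ^^ k) y)" using Suc E_le by blast
    also have "\<dots> \<le> l * (l ^ k * nrm n y)" using Suc l by (intro mult_left_mono) auto
    finally show ?case using Suc EY by (simp add: mult.assoc)
  qed (use that in simp)
  have E_D: "y - E y = smul (1 - of_real \<Lambda>) (D y)" if "y \<in> Y" for y
  proof -
    have "E y = D (\<Sum>i<d. smul (cnj (lam i)) (u i y))"
      unfolding E B_def by (simp add: lin_sum[OF lD] lin_smul[OF lD])
    also have "(\<Sum>i<d. smul (cnj (lam i)) (u i y)) = smul (of_real \<Lambda>) y - C y"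
    proof (rule cvec_eqI)
      fix k
      have kl: "(\<Sum>i<d. cnj (lam i) * \<kappa> i) = 1 - of_real s"
      proof -
        have "(\<Sum>i<d. cnj (lam i) * \<kappa> i) = (\<Sum>i<d. cnj (lam i) * lam i) / of_real (1 + s)"
          by (simp add: \<kappa>_def sum_divide_distrib)
        also have "\<dots> = 1 - of_real s"
          unfolding cl s(3) using s1 by (simp add: field_simps power2_eq_square)
        finally show ?thesis .
      qed
      have "coord (\<Sum>i<d. smul (cnj (lam i)) (u i y)) k
        = (\<Sum>i<d. cnj (lam i) * lam i * coord y k - of_real s * (cnj (lam i) * coord (A i y) k)
            - cnj (lam i) * \<kappa> i * coord (C y) k)"
        unfolding lookup_sum u_def lookup_minus coord_smul
        by (intro sum.cong refl) (simp add: algebra_simps)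
      also have "\<dots> = of_real \<Lambda> * coord y k - of_real s * coord (C y) k - (1 - of_real s) * coord (C y) k"
        unfolding sum_subtractf cl[symmetric] kl[symmetric] sum_distrib_right
        by (simp add: C_def lookup_sum sum_distrib_left)
      also have "\<dots> = coord (smul (of_real \<Lambda>) y - C y) k"
        by (simp add: lookup_minus algebra_simps)
      finally show "coord (\<Sum>i<d. smul (cnj (lam i)) (u i y)) k = coord (smul (of_real \<Lambda>) y - C y) k" .
    qed
    finally have "E y = smul (of_real \<Lambda>) (D y) - C (D y)"
      by (simp add: lin_minus[OF lD] lin_smul[OF lD] DC)
    then have "y - E y = D y - C (D y) - (smul (of_real \<Lambda>) (D y) - C (D y))"
      using D[OF that] by simp
    then show ?thesis by (simp add: V.scale_left_diff_distrib)
  qed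
  have \<psi>: "ev d B (\<psi> i) y = A i y - E (A i y)" if i: "i < d" "y \<in> Y" for i y
  proof -
    have "ev d B (\<psi> i) y = smul (lam i) y - smul (of_real s) (B i y) - smul (\<kappa> i) (E y)"
      by (simp add: \<psi>_def ev_diff ev_mult[OF cB] ev_cst ev_var i E_def)
    also have "E y = y - smul (1 - of_real \<Lambda>) (D y)"
      using E_D[OF i(2)] by (simp add: algebra_simps)
    also have "B i y = smul (lam i) (D y) - smul (of_real s) (A i (D y)) - smul (\<kappa> i) (C (D y))"
      unfolding B_def uD[symmetric] by (simp only: u_def)
    also have "smul (lam i) y - smul (of_real s) (smul (lam i) (D y) - smul (of_real s) (A i (D y)) - smul (\<kappa> i) (C (D y)))
        - smul (\<kappa> i) (y - smul (1 - of_real \<Lambda>) (D y)) = smul (1 - of_real \<Lambda>) (A i (D y))"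
    proof (rule cvec_eqI)
      fix k
      have e1: "coord y k = coord (D y) k - coord (C (D y)) k"
        using D[OF i(2)] by (metis lookup_minus)
      have e2: "complex_of_real \<Lambda> = 1 - of_real s * of_real s"
        unfolding s(3) by (simp add: power2_eq_square)
      show "coord (smul (lam i) y - smul (of_real s) (smul (lam i) (D y) - smul (of_real s) (A i (D y)) - smul (\<kappa> i) (C (D y)))
        - smul (\<kappa> i) (y - smul (1 - of_real \<Lambda>) (D y))) k = coord (smul (1 - of_real \<Lambda>) (A i (D y))) k"
        unfolding lookup_minus coord_smul e1 e2 k1[of i] by (simp add: algebra_simps)
    qed
    also have "\<dots> = A i y - E (A i y)"
      using E_D[OF invariantD[OF A(2) i(2)], of i] by (simp add: DA)
    finally show ?thesis .
  qed
  have \<Phi>: "ev d B (\<Phi> L i) y = smul (of_real (c L)) (A i y - (E ^^ Suc L) (A i y))" if i: "i < d" "y \<in> Y" for L i y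
  proof -
    have "ev d B (\<Phi> L i) y = smul (of_real (c L)) (\<Sum>j\<le>L. (E ^^ j) (ev d B (\<psi> i) y))"
      by (simp only: \<Phi>_def ev_mult[OF cB] ev_cst ev_sum ev_power[OF cB] E_def)
    then show ?thesis unfolding \<psi>[OF i] geometric_telescope[OF lE] .
  qed
  have \<Phi>_polys: "\<Phi> L i \<in> polys d" if "i < d" for L i
    unfolding \<Phi>_def \<psi>_def e_def using that
    by (intro polys_mult polys_cst polys_sum polys_power polys_diff polys_var) auto
  have \<Phi>_ball: "(\<lambda>i. pe d (\<Phi> L i) z) \<in> fun_ball d" if z: "z \<in> fun_ball d" for L z
  proof -
    define \<epsilon> where "\<epsilon> = (\<Sum>i<d. cnj (lam i) * z i)"
    define v where "v i = lam i * 1 - of_real s * z i - lam i / of_real (1 + s) * \<epsilon>" for i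
    define G where "G = of_real (c L) * (\<Sum>j\<le>L. \<epsilon> ^ j)"
    have pe_e: "pe d e z = \<epsilon>" by (simp add: e_def pe_sum pe_mult \<epsilon>_def)
    have pe_\<Phi>: "pe d (\<Phi> L i) z = G * v i" if "i < d" for i
      using that by (simp add: \<Phi>_def \<psi>_def pe_mult pe_sum pe_power pe_diff pe_e v_def G_def \<kappa>_def)
    have id: "(cmod (1 - \<epsilon>))\<^sup>2 - (\<Sum>i<d. (cmod (v i))\<^sup>2) = s\<^sup>2 * ((cmod 1)\<^sup>2 - (\<Sum>i<d. (cmod (z i))\<^sup>2))"
      unfolding v_def by (rule moebius_identity[OF s(3)[unfolded \<Lambda>_def] less_imp_le[OF s(1)] \<epsilon>_def])
    have "0 < s\<^sup>2 * ((cmod 1)\<^sup>2 - (\<Sum>i<d. (cmod (z i))\<^sup>2))"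
      using z s(1) by (simp add: fun_ball_def)
    then have v: "(\<Sum>i<d. (cmod (v i))\<^sup>2) < (cmod (1 - \<epsilon>))\<^sup>2" using id by linarith
    have "cmod \<epsilon> \<le> (\<Sum>i<d. \<bar>cmod (lam i)\<bar> * \<bar>cmod (z i)\<bar>)"
      unfolding \<epsilon>_def using norm_sum[of "\<lambda>i. cnj (lam i) * z i" "{..<d}"] by (simp add: norm_mult)
    also have "\<dots> \<le> L2_set (\<lambda>i. cmod (lam i)) {..<d} * L2_set (\<lambda>i. cmod (z i)) {..<d}"
      by (rule L2_set_mult_ineq)
    also have "\<dots> \<le> l * 1"
      using z l by (intro mult_mono) (simp_all add: L2_set_def l_def \<Lambda>_def fun_ball_def sum_nonneg)
    finally have \<epsilon>: "cmod \<epsilon> \<le> l" by simp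
    have "(\<Sum>j\<le>L. \<epsilon> ^ j) * (1 - \<epsilon>) = 1 - \<epsilon> ^ Suc L"
      using sum_gp_basic[of \<epsilon> L] by (simp add: mult.commute)
    then have "cmod (G * (1 - \<epsilon>)) = c L * cmod (1 - \<epsilon> ^ Suc L)"
      using c[of L] by (simp only: G_def mult.assoc norm_mult norm_of_real abs_of_pos)
    also have "\<dots> \<le> c L * (1 + l ^ Suc L)"
    proof (rule mult_left_mono)
      have "cmod (1 - \<epsilon> ^ Suc L) \<le> 1 + cmod (\<epsilon> ^ Suc L)"
        using norm_triangle_ineq4[of 1 "\<epsilon> ^ Suc L"] by simp
      also have "cmod (\<epsilon> ^ Suc L) \<le> l ^ Suc L"
        unfolding norm_power using \<epsilon> by (intro power_mono) auto
      finally show "cmod (1 - \<epsilon> ^ Suc L) \<le> 1 + l ^ Suc L" by simp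
    qed (use c[of L] in simp)
    also have "\<dots> = 1"
      using l zero_le_power[of l "Suc L"] unfolding c_def by (simp add: add_nonneg_eq_0_iff)
    finally have G1: "(cmod G)\<^sup>2 * (cmod (1 - \<epsilon>))\<^sup>2 \<le> 1"
      by (simp add: norm_mult power_le_one flip: power_mult_distrib)
    have "(\<Sum>i<d. (cmod (pe d (\<Phi> L i) z))\<^sup>2) = (cmod G)\<^sup>2 * (\<Sum>i<d. (cmod (v i))\<^sup>2)"
      by (simp add: pe_\<Phi> norm_mult power_mult_distrib sum_distrib_left)
    also have "\<dots> < 1"
    proof (cases "G = 0")
      case False
      then have "(cmod G)\<^sup>2 * (\<Sum>i<d. (cmod (v i))\<^sup>2) < (cmod G)\<^sup>2 * (cmod (1 - \<epsilon>))\<^sup>2"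
        using v by (intro mult_strict_left_mono) auto
      then show ?thesis using G1 by linarith
    qed simp
    finally show ?thesis by (simp add: fun_ball_def)
  qed
  show ?thesis
  proof (rule nrm_limit_le)
    show "(\<lambda>L. nrm n (ev d (\<lambda>i. ev d B (\<Phi> L i)) p x - ev d A p x)) \<longlonglongrightarrow> 0"
    proof (rule ev_tendsto[where Y = Y and c = 2])
      show "V.subspace Y" by (rule sY)
      show "A i y \<in> Y" if "y \<in> Y" for i y by (rule invariantD[OF A(2) that])
      show "lin (ev d B (\<Phi> L i))" for L i by (rule lin_ev[OF cB])
      show "ev d B (\<Phi> L i) y \<in> Y" if "y \<in> Y" for L i y
        using iB[OF sY A(2)] by (intro ev_invariant[OF sY _ that]) (rule invariantD)
      show "x \<in> Y" by (rule x)
    next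
      fix L i y assume i: "i < d" "y \<in> Y"
      have Ay: "A i y \<in> Y" "nrm n (A i y) \<le> nrm n y"
        using invariantD[OF A(2) i(2)] col_contraction_entry[OF A(3) i(2,1)] by auto
      have "nrm n ((E ^^ Suc L) (A i y)) \<le> l ^ Suc L * nrm n (A i y)" using Ek[OF Ay(1)] by blast
      also have "\<dots> \<le> 1 * nrm n (A i y)" 
        using l by (intro mult_right_mono power_le_one) auto
      finally have "nrm n (A i y - (E ^^ Suc L) (A i y)) \<le> 2 * nrm n y"
        using nrm_triangle_diff[of n "A i y" "(E ^^ Suc L) (A i y)"] Ay(2) by linarith
      then have "c L * nrm n (A i y - (E ^^ Suc L) (A i y)) \<le> 1 * (2 * nrm n y)"
        using c[of L] by (intro mult_mono) auto
      then show "nrm n (ev d B (\<Phi> L i) y) \<le> 2 * nrm n y"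
        unfolding \<Phi>[OF i] nrm_smul using c[of L] by simp
    next
      fix i y assume i: "i < d" "y \<in> Y"
      have Ay: "A i y \<in> Y" using invariantD[OF A(2) i(2)] .
      have ineq: "norm (nrm n (ev d B (\<Phi> L i) y - A i y)) \<le> (1 - c L) * nrm n (A i y) + l ^ Suc L * nrm n (A i y)" for L
      proof -
        have "ev d B (\<Phi> L i) y - A i y = smul (- of_real (1 - c L)) (A i y) - smul (of_real (c L)) ((E ^^ Suc L) (A i y))"
          unfolding \<Phi>[OF i] by (intro cvec_eqI) (simp only: lookup_minus coord_smul, simp add: algebra_simps)
        then have "nrm n (ev d B (\<Phi> L i) y - A i y) \<le> cmod (- of_real (1 - c L)) * nrm n (A i y)
            + cmod (of_real (c L)) * nrm n ((E ^^ Suc L) (A i y))"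
          using nrm_triangle_diff by (metis nrm_smul)
        also have "cmod (- of_real (1 - c L)) = 1 - c L"
          using c[of L] by (simp only: norm_minus_cancel norm_of_real)
        also have "cmod (of_real (c L)) * nrm n ((E ^^ Suc L) (A i y)) \<le> 1 * (l ^ Suc L * nrm n (A i y))"
          using Ek[OF Ay, of "Suc L"] c[of L] by (intro mult_mono) auto
        finally show ?thesis by simp
      qed
      have l0: "(\<lambda>L. l ^ Suc L) \<longlonglongrightarrow> 0"
        using l by (intro LIMSEQ_Suc LIMSEQ_power_zero) auto
      then have "c \<longlonglongrightarrow> 1 / (1 + 0)"
        unfolding c_def[abs_def] by (intro tendsto_divide tendsto_add tendsto_const) auto
      then have "(\<lambda>L. (1 - c L) * nrm n (A i y) + l ^ Suc L * nrm n (A i y)) \<longlonglongrightarrow> (1 - 1 / (1 + 0)) * nrm n (A i y) + 0 * nrm n (A i y)"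
        by (intro tendsto_add tendsto_mult_right tendsto_diff tendsto_const l0)
      then have "(\<lambda>L. (1 - c L) * nrm n (A i y) + l ^ Suc L * nrm n (A i y)) \<longlonglongrightarrow> 0" by simp
      then show "(\<lambda>L. nrm n (ev d B (\<Phi> L i) y - A i y)) \<longlonglongrightarrow> 0"
        by (rule Lim_null_comparison[OF always_eventually, OF allI, OF ineq])
    qed
    show "nrm n (ev d (\<lambda>i. ev d B (\<Phi> L i)) p x) \<le> K * S * nrm n x" for L
    proof -
      have "ball_bound d (psubst d (\<Phi> L) p) S"
        unfolding ball_bound_def pe_psubst using ball_boundD[OF p(2)] \<Phi>_ball by blast
      moreover have "psubst d (\<Phi> L) p \<in> polys d" using \<Phi>_polys by (intro polys_psubst)
      ultimately have "nrm n (ev d B (psubst d (\<Phi> L) p) x) \<le> K * S * nrm n x"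
        by (intro base[OF cB iB[OF sY A(2)] iB[OF W(1,2)] B_contr BW] x)
      then show ?thesis unfolding ev_psubst[OF cB] .
    qed
  qed
qed

section \<open>Operators whose range is one-dimensional\<close>

lemma disc_identity:
  "(cmod (1 - cnj c * g))\<^sup>2 - (cmod (g - c))\<^sup>2 = (1 - (cmod c)\<^sup>2) * (1 - (cmod g)\<^sup>2)"
  unfolding cmod_power2 by (simp add: power2_eq_square algebra_simps)

lemma power2_less_one: "0 \<le> (x::real) \<Longrightarrow> x < 1 \<Longrightarrow> x\<^sup>2 < 1"
  using power_less_one_iff[of x 2] by simp

text \<open>
  With $G(\zeta) = c + \zeta q(\zeta)$, Schwarz's lemma applies to
  $(G - c)/(1 - \bar c G) = \zeta k(\zeta)$ and gives $|k| \le 1$, also at the origin, where the derivative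
  is estimated.
\<close>

lemma schwarz_pick_quotient:
  assumes q: "q holomorphic_on ball 0 1" and g: "\<And>\<zeta>. cmod \<zeta> < 1 \<Longrightarrow> cmod (c + \<zeta> * q \<zeta>) < 1"
    and \<nu>: "cmod \<nu> < 1"
  obtains k where "cmod k \<le> 1" "q \<nu> * (1 + cnj c * k * \<nu>) = k * (1 - cnj c * c)"
proof -
  define G where "G \<zeta> = c + \<zeta> * q \<zeta>" for \<zeta>
  define k where "k \<zeta> = q \<zeta> / (1 - cnj c * G \<zeta>)" for \<zeta>
  define F where "F \<zeta> = \<zeta> * k \<zeta>" for \<zeta>
  have c: "cmod c < 1" using g[of 0] by simp
  have nz: "1 - cnj c * G \<zeta> \<noteq> 0" if "cmod \<zeta> < 1" for \<zeta>
  proof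
    assume "1 - cnj c * G \<zeta> = 0"
    then have "cmod (cnj c * G \<zeta>) = 1" by (metis eq_iff_diff_eq_0 norm_one)
    moreover have "cmod (cnj c * G \<zeta>) \<le> cmod c * 1"
      unfolding norm_mult using g[OF that] by (intro mult_mono) (auto simp: G_def)
    ultimately show False using c by simp
  qed
  have holG: "G holomorphic_on ball 0 1"
    unfolding G_def by (intro holomorphic_intros q)
  have holk: "k holomorphic_on ball 0 1"
    unfolding k_def by (intro holomorphic_intros q holG) (use nz in auto)
  have holF: "F holomorphic_on ball 0 1"
    unfolding F_def by (intro holomorphic_intros holk)
  have F_eq: "F \<zeta> = (G \<zeta> - c) / (1 - cnj c * G \<zeta>)" for \<zeta>
    by (simp add: F_def k_def G_def)
  have F1: "cmod (F \<zeta>) < 1" if "cmod \<zeta> < 1" for \<zeta>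
  proof -
    have "0 < (1 - (cmod c)\<^sup>2) * (1 - (cmod (G \<zeta>))\<^sup>2)"
      using c g[OF that] by (intro mult_pos_pos) (simp_all add: power2_less_one G_def)
    then have "(cmod (G \<zeta> - c))\<^sup>2 < (cmod (1 - cnj c * G \<zeta>))\<^sup>2" using disc_identity[of c "G \<zeta>"] by simp
    then have "cmod (G \<zeta> - c) < cmod (1 - cnj c * G \<zeta>)" by (rule power_less_imp_less_base) simp
    then show ?thesis unfolding F_eq norm_divide using nz[OF that] by (simp add: divide_less_eq)
  qed
  have F0: "F 0 = 0" by (simp add: F_def)
  have "cmod (k \<nu>) \<le> 1"
  proof (cases "\<nu> = 0")
    case True
    have "k field_differentiable at 0"
      using holk by (simp add: holomorphic_on_open field_differentiable_def)
    then obtain k' where "(k has_field_derivative k') (at 0)" by (auto simp: field_differentiable_def)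
    then have "(F has_field_derivative (0 * k' + 1 * k 0)) (at 0)"
      unfolding F_def[abs_def] by (intro DERIV_mult' DERIV_ident)
    then have "deriv F 0 = k 0" by (simp add: DERIV_imp_deriv)
    then show ?thesis using Schwarz_Lemma(2)[OF holF F0 F1, of 0] True by simp
  next
    case False
    have "cmod (F \<nu>) \<le> cmod \<nu>" by (rule Schwarz_Lemma(1)[OF holF F0 F1 \<nu>])
    then show ?thesis using False by (simp add: F_def norm_mult)
  qed
  moreover have "q \<nu> * (1 + cnj c * k \<nu> * \<nu>) = k \<nu> * (1 - cnj c * c)"
  proof -
    have "k \<nu> * (1 - cnj c * G \<nu>) = q \<nu>" using nz[OF \<nu>] by (simp add: k_def)
    then show ?thesis by (simp add: G_def algebra_simps)
  qed
  ultimately show ?thesis by (rule that)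
qed

text \<open>
  Parallel vectors $\mu$ and $b$ are both multiples of a single unit vector $u$. This covers the cases
  in which one of them, or both, vanish.
\<close>

lemma parallel_unit_vector:
  fixes \<mu> b :: "nat \<Rightarrow> complex"
  assumes d: "d \<ge> 1" and cross: "\<And>i j. i < d \<Longrightarrow> j < d \<Longrightarrow> \<mu> i * b j = \<mu> j * b i"
  obtains u where "(\<Sum>i<d. (cmod (u i))\<^sup>2) = 1"
    "\<And>i. i < d \<Longrightarrow> \<mu> i = u i * (\<Sum>j<d. cnj (u j) * \<mu> j)"
    "\<And>i. i < d \<Longrightarrow> b i = u i * (\<Sum>j<d. cnj (u j) * b j)"
proof -
  have key: "\<exists>u. (\<Sum>i<d. (cmod (u i))\<^sup>2) = 1 \<and> (\<forall>b. (\<forall>i<d. \<forall>j<d. a i * b j = a j * b i) \<longrightarrow>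
      (\<forall>i<d. b i = u i * (\<Sum>j<d. cnj (u j) * b j)))"
    if a: "i0 < d" "a i0 \<noteq> 0" for a :: "nat \<Rightarrow> complex" and i0
  proof -
    define m2 where "m2 = (\<Sum>i<d. (cmod (a i))\<^sup>2)"
    define m where "m = sqrt m2"
    have m2: "0 < m2" unfolding m2_def using a by (intro sum_pos2[of _ i0]) auto
    then have m: "0 < m" "m * m = m2" by (simp_all add: m_def)
    define u where "u i = a i / of_real m" for i
    have "(\<Sum>i<d. (cmod (u i))\<^sup>2) = m2 / (m * m)"
      unfolding u_def m2_def sum_divide_distrib using m(1) 
      by (intro sum.cong refl) (simp add: norm_divide power_divide power2_eq_square)
    moreover have "m2 / (m * m) = 1" using m m2 by simp
    moreover have "b i = u i * (\<Sum>j<d. cnj (u j) * b j)"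
      if b: "\<forall>i<d. \<forall>j<d. a i * b j = a j * b i" "i < d" for b i
    proof -
      have "u i * (\<Sum>j<d. cnj (u j) * b j) = (\<Sum>j<d. cnj (a j) * (a i * b j)) / (of_real m * of_real m)"
        unfolding u_def sum_distrib_left sum_divide_distrib by (intro sum.cong refl) (simp add: mult_ac)
      also have "(\<Sum>j<d. cnj (a j) * (a i * b j)) = (\<Sum>j<d. of_real ((cmod (a j))\<^sup>2) * b i)"
      proof (intro sum.cong refl)
        fix j assume "j \<in> {..<d}"
        then have "a i * b j = a j * b i" using b by auto
        then show "cnj (a j) * (a i * b j) = of_real ((cmod (a j))\<^sup>2) * b i"
          by (simp add: complex_norm_square mult_ac del: of_real_power)
      qed
      also have "\<dots> = of_real m2 * b i" by (simp add: m2_def sum_distrib_right)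
      also have "of_real m2 * b i / (of_real m * of_real m) = b i"
        using m m2 by (simp flip: of_real_mult)
      finally show ?thesis ..
    qed
    ultimately show ?thesis by (intro exI[of _ u]) auto
  qed
  consider i0 where "i0 < d" "\<mu> i0 \<noteq> 0" | i0 where "i0 < d" "b i0 \<noteq> 0"
    | "\<forall>i<d. \<mu> i = 0 \<and> b i = 0" by blast
  then show ?thesis
  proof cases
    case 1
    obtain u where u: "(\<Sum>i<d. (cmod (u i))\<^sup>2) = 1" "\<forall>b. (\<forall>i<d. \<forall>j<d. \<mu> i * b j = \<mu> j * b i) \<longrightarrow>
      (\<forall>i<d. b i = u i * (\<Sum>j<d. cnj (u j) * b j))" using key[of i0 \<mu>, OF 1] by blast
    show ?thesis
    proof (rule that[of u])
      have 1: "\<forall>i<d. \<mu> i = u i * (\<Sum>j<d. cnj (u j) * \<mu> j)"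
        by (rule u(2)[THEN spec, THEN mp]) (simp add: mult.commute)
      have 2: "\<forall>i<d. b i = u i * (\<Sum>j<d. cnj (u j) * b j)"
        by (rule u(2)[THEN spec, THEN mp]) (intro allI impI cross)
      show "\<mu> i = u i * (\<Sum>j<d. cnj (u j) * \<mu> j)" if "i < d" for i using 1 that by blast
      show "b i = u i * (\<Sum>j<d. cnj (u j) * b j)" if "i < d" for i using 2 that by blast
    qed (rule u)
  next
    case 2
    obtain u where u: "(\<Sum>i<d. (cmod (u i))\<^sup>2) = 1" "\<forall>c. (\<forall>i<d. \<forall>j<d. b i * c j = b j * c i) \<longrightarrow>
      (\<forall>i<d. c i = u i * (\<Sum>j<d. cnj (u j) * c j))" using key[of i0 b, OF 2] by blast
    show ?thesis
    proof (rule that[of u])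
      have "b i * \<mu> j = b j * \<mu> i" if "i < d" "j < d" for i j
        using cross[OF that] by (simp add: mult.commute)
      then have 1: "\<forall>i<d. \<mu> i = u i * (\<Sum>j<d. cnj (u j) * \<mu> j)"
        by (intro u(2)[THEN spec, THEN mp]) blast
      have 2: "\<forall>i<d. b i = u i * (\<Sum>j<d. cnj (u j) * b j)"
        by (rule u(2)[THEN spec, THEN mp]) (simp add: mult.commute)
      show "\<mu> i = u i * (\<Sum>j<d. cnj (u j) * \<mu> j)" if "i < d" for i using 1 that by blast
      show "b i = u i * (\<Sum>j<d. cnj (u j) * b j)" if "i < d" for i using 2 that by blast
    qed (rule u)
  next
    case 3
    show ?thesis
    proof (rule that[of "\<lambda>i. if i = 0 then 1 else 0"])
      have "(\<Sum>i<d. (cmod (if i = 0 then 1 else 0))\<^sup>2) = (\<Sum>i<d. if i = 0 then 1 else 0 :: real)"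
        by (intro sum.cong) auto
      then show "(\<Sum>i<d. (cmod (if i = 0 then 1 else 0))\<^sup>2) = 1" using d by simp
    qed (use 3 in simp_all)
  qed
qed

lemma monom_op_multiple:
  assumes "lin N"
  shows "monom_op d (\<lambda>i y. smul (u i) (N y)) m x
    = smul (\<Prod>i<d. u i ^ Poly_Mapping.lookup m i) ((N ^^ (\<Sum>i<d. Poly_Mapping.lookup m i)) x)"
proof (induction d arbitrary: x)
  case 0
  then show ?case by simp
next
  case (Suc d)
  have p: "((\<lambda>y. smul (u d) (N y)) ^^ k) x = smul (u d ^ k) ((N ^^ k) x)" for k x
    by (induction k) (simp_all add: lin_smul[OF assms])
  show ?case
    unfolding monom_op_Suc Suc.IH p lin_smul[OF lin_funpow[OF assms]]
    by (simp add: mult.commute funpow_add)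
qed

text \<open>
  The operator $c + qN$ equals $(c + kN)(1 + \bar c k N)^{-1}$ at $x$, a disc automorphism applied to the
  contraction $kN$; hence it is a contraction. The vector $y$ below is $(1 + \bar c k N)^{-1} x$, which is
  explicit because $N^2 x = \nu N x$.
\<close>

lemma contraction_step_rank_one:
  assumes Y: "V.subspace Y" and N: "lin N" "\<And>y. y \<in> Y \<Longrightarrow> N y \<in> Y" "\<And>y. y \<in> Y \<Longrightarrow> nrm n (N y) \<le> nrm n y"
    and x: "x \<in> Y" "N (N x) = smul \<nu> (N x)"
    and k: "cmod k \<le> 1" "q * (1 + cnj c * k * \<nu>) = k * (1 - cnj c * c)"
    and c: "cmod c < 1" and \<nu>: "cmod \<nu> < 1"
  shows "nrm n (smul c x + smul q (N x)) \<le> nrm n x"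
proof -
  define \<tau> where "\<tau> = 1 + cnj c * k * \<nu>"
  have "cmod (cnj c * k * \<nu>) < 1"
  proof -
    have "cmod (cnj c * k * \<nu>) \<le> cmod c * 1 * 1"
      unfolding norm_mult using k(1) \<nu> by (intro mult_mono) auto
    then show ?thesis using c by simp
  qed
  then have \<tau>: "\<tau> \<noteq> 0" unfolding \<tau>_def
    by (metis add_eq_0_iff norm_minus_cancel norm_one less_irrefl add.commute)
  define y where "y = x - smul (cnj c * k / \<tau>) (N x)"
  have Ny: "N y = smul (1 / \<tau>) (N x)"
  proof -
    have "N y = N x - smul (cnj c * k / \<tau>) (smul \<nu> (N x))"
      by (simp add: y_def lin_minus[OF N(1)] lin_smul[OF N(1)] x)
    also have "\<dots> = smul (1 - cnj c * k / \<tau> * \<nu>) (N x)"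
      by (simp add: V.scale_left_diff_distrib)
    also have "1 - cnj c * k / \<tau> * \<nu> = (\<tau> - cnj c * k * \<nu>) / \<tau>"
      using \<tau> by (simp add: diff_divide_distrib)
    also have "\<tau> - cnj c * k * \<nu> = 1" by (simp add: \<tau>_def)
    finally show ?thesis .
  qed
  have xy: "x = y + smul (cnj c) (smul k (N y))"
    unfolding Ny by (simp add: y_def)
  have qk: "q = (k - cnj c * c * k) / \<tau>"
  proof -
    have "q * \<tau> = k - cnj c * c * k"
      using k(2) unfolding \<tau>_def by (simp add: right_diff_distrib mult_ac)
    then show ?thesis using \<tau> by (simp add: eq_divide_eq)
  qed
  have qy: "smul c x + smul q (N x) = smul c y + smul k (N y)"
  proof (rule cvec_eqI)
    fix j
    have yj: "coord y j = coord x j - cnj c * k / \<tau> * coord (N x) j"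
      by (simp add: y_def lookup_minus)
    show "coord (smul c x + smul q (N x)) j = coord (smul c y + smul k (N y)) j"
      unfolding Ny qk lookup_add coord_smul yj using \<tau> by (simp add: field_simps)
  qed
  have y: "y \<in> Y" unfolding y_def by (intro V.subspace_diff[OF Y] subspace_smul[OF Y] x N(2))
  have id: "(cmod (a + cnj c * b))\<^sup>2 - (cmod (c * a + b))\<^sup>2 = (1 - (cmod c)\<^sup>2) * ((cmod a)\<^sup>2 - (cmod b)\<^sup>2)" for a b
    unfolding cmod_power2 by (simp add: power2_eq_square algebra_simps)
  have "(nrm n x)\<^sup>2 - (nrm n (smul c x + smul q (N x)))\<^sup>2
    = (\<Sum>j<n. (1 - (cmod c)\<^sup>2) * ((cmod (coord y j))\<^sup>2 - (cmod (coord (smul k (N y)) j))\<^sup>2))"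
    unfolding qy nrm_power2 sum_subtractf[symmetric]
    by (subst (1) xy) (simp only: lookup_add coord_smul[of "cnj c"] coord_smul[of c] id)
  also have "\<dots> = (1 - (cmod c)\<^sup>2) * ((nrm n y)\<^sup>2 - (nrm n (smul k (N y)))\<^sup>2)"
    by (simp only: nrm_power2 sum_subtractf sum_distrib_left[symmetric])
  also have "\<dots> \<ge> 0"
  proof (rule mult_nonneg_nonneg)
    have "cmod k * nrm n (N y) \<le> 1 * nrm n y" using k(1) N(3)[OF y] by (intro mult_mono) auto
    then show "0 \<le> (nrm n y)\<^sup>2 - (nrm n (smul k (N y)))\<^sup>2"
      by (simp add: nrm_smul power_mono)
    show "0 \<le> 1 - (cmod c)\<^sup>2" using power2_less_one[of "cmod c"] c by simp
  qed
  finally have "(nrm n (smul c x + smul q (N x)))\<^sup>2 \<le> (nrm n x)\<^sup>2" by simp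
  then show ?thesis by (rule power2_le_imp_le) simp
qed

text \<open>
  If all $B_i$ map into the line through $w$, then commutativity forces $B_i w = \mu_i w$ and
  $B_i x = b_i w$ with parallel coefficient vectors. On the span of $x$ and $w$ the tuple is therefore
  $B_i = u_i N$ for a unit vector $u$ and a single contraction $N$, so only the restriction of $h$ to the
  disc through $u$ matters, and there Schwarz's lemma gives von Neumann's inequality with constant 1.
\<close>

lemma rank_one_bound_strict:
  assumes d: "d \<ge> 1" and Y: "V.subspace Y" "Y \<subseteq> supported n" and B: "commuting B" "invariant B Y"
    and contr: "\<And>u y. y \<in> Y \<Longrightarrow> (\<Sum>i<d. (cmod (u i))\<^sup>2) = 1 \<Longrightarrow>
       nrm n (\<Sum>i<d. smul (cnj (u i)) (B i y)) \<le> r * nrm n y" and r: "r < 1"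
    and w: "w \<in> Y" "\<And>i y. i < d \<Longrightarrow> y \<in> Y \<Longrightarrow> \<exists>a. B i y = smul a w"
    and h: "ball_bound d h S" "S < 1" and x: "x \<in> Y"
  shows "nrm n (ev d B h x) \<le> nrm n x"
proof -
  have lB: "lin (B i)" for i using B(1) by (rule commuting_lin)
  obtain \<mu> b where \<mu>: "\<And>i. i < d \<Longrightarrow> B i w = smul (\<mu> i) w" and b: "\<And>i. i < d \<Longrightarrow> B i x = smul (b i) w"
    and cross: "\<And>i j. i < d \<Longrightarrow> j < d \<Longrightarrow> \<mu> i * b j = \<mu> j * b i"
  proof -
    have "\<exists>a. \<forall>i. i < d \<longrightarrow> B i y = smul (a i) w" if "y \<in> Y" for y
      by (rule choice) (use w(2)[OF _ that] in blast)
    from this[OF w(1)] this[OF x] obtain \<mu> b where *: "\<forall>i<d. B i w = smul (\<mu> i) w" "\<forall>i<d. B i x = smul (b i) w" by blast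
    show thesis
    proof (cases "w = 0")
      case True
      then show thesis using * by (intro that[of "\<lambda>_. 0" "\<lambda>_. 0"]) auto
    next
      case False
      have "\<mu> i * b j = \<mu> j * b i" if "i < d" "j < d" for i j
      proof -
        have "B i (B j x) = B j (B i x)" by (rule commuting_commute[OF B(1)])
        then have "smul (b j * \<mu> i) w = smul (b i * \<mu> j) w"
          using * that by (simp add: lin_smul[OF lB])
        then have "b j * \<mu> i = b i * \<mu> j" using False by (simp only: V.scale_cancel_right) simp
        then show ?thesis by (simp add: mult.commute)
      qed
      then show thesis using * by (intro that[of \<mu> b]) auto
    qed
  qed
  obtain u where u: "(\<Sum>i<d. (cmod (u i))\<^sup>2) = 1"
    and u\<mu>: "\<And>i. i < d \<Longrightarrow> \<mu> i = u i * (\<Sum>j<d. cnj (u j) * \<mu> j)"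
    and ub: "\<And>i. i < d \<Longrightarrow> b i = u i * (\<Sum>j<d. cnj (u j) * b j)"
  proof (rule parallel_unit_vector[OF d cross])
    fix u assume "(\<Sum>i<d. (cmod (u i))\<^sup>2) = 1" 
      "\<And>i. i < d \<Longrightarrow> \<mu> i = u i * (\<Sum>j<d. cnj (u j) * \<mu> j)"
      "\<And>i. i < d \<Longrightarrow> b i = u i * (\<Sum>j<d. cnj (u j) * b j)"
    then show thesis by (rule that)
  qed
  define N where "N y = (\<Sum>i<d. smul (cnj (u i)) (B i y))" for y
  have lN: "lin N" unfolding N_def[abs_def] by (intro lin_Sum lin_scale lB)
  have NY: "N y \<in> Y" if "y \<in> Y" for y
    unfolding N_def by (intro V.subspace_sum[OF Y(1)] subspace_smul[OF Y(1)] invariantD[OF B(2) that])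
  have N_le: "nrm n (N y) \<le> r * nrm n y" if "y \<in> Y" for y
    unfolding N_def by (rule contr[OF that u])
  define \<nu>' where "\<nu>' = (\<Sum>j<d. cnj (u j) * \<mu> j)"
  define \<beta> where "\<beta> = (\<Sum>j<d. cnj (u j) * b j)"
  have Nw': "N w = smul \<nu>' w" unfolding N_def \<nu>'_def V.scale_sum_left
    by (intro sum.cong refl) (simp add: \<mu>)
  have Nx: "N x = smul \<beta> w" unfolding N_def \<beta>_def V.scale_sum_left
    by (intro sum.cong refl) (simp add: b)
  \<comment> \<open>For $w = 0$ every scalar is an eigenvalue; 0 keeps it inside the disc.\<close>
  define \<nu> where "\<nu> = (if w = 0 then 0 else \<nu>')"
  have Nw: "N w = smul \<nu> w" using Nw' by (simp add: \<nu>_def)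
  have \<nu>: "cmod \<nu> < 1"
  proof (cases "w = 0")
    case False
    then have "nrm n w \<noteq> 0" using nrm_eq_zero[of w n] w(1) Y(2) by blast
    then have pos: "0 < nrm n w" using nrm_nonneg[of n w] by linarith
    have "cmod \<nu> * nrm n w \<le> r * nrm n w" using N_le[OF w(1)] by (simp add: Nw nrm_smul)
    then have "cmod \<nu> \<le> r" using pos by simp
    then show ?thesis using r by simp
  qed (simp add: \<nu>_def)
  have Nx2: "N (N x) = smul \<nu> (N x)"
    by (simp add: Nx lin_smul[OF lN] Nw mult.commute)
  have Bw: "B i w = smul (u i) (N w)" if "i < d" for i
    using \<mu>[OF that] u\<mu>[OF that] by (simp add: Nw' \<nu>'_def)
  have Bx: "B i x = smul (u i) (N x)" if "i < d" for i
    using b[OF that] ub[OF that] by (simp add: Nx \<beta>_def)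
  define Z where "Z = {smul a x + smul a' w | a a'. True}"
  have ZI: "smul a x + smul a' w \<in> Z" for a a' unfolding Z_def by blast
  have BZ: "B i y = smul (u i) (N y) \<and> smul (u i) (N y) \<in> Z" if i: "i < d" "y \<in> Z" for i y
  proof -
    obtain a a' where y: "y = smul a x + smul a' w" using i(2) unfolding Z_def by blast
    have "smul (u i) (N y) = smul 0 x + smul (u i * (a * \<beta> + a' * \<nu>)) w"
      by (simp add: y lin_add[OF lN] lin_smul[OF lN] Nx Nw V.scale_left_distrib V.scale_right_distrib distrib_left mult_ac)
    moreover have "B i y = smul (u i) (N y)"
      by (simp add: y lin_add[OF lN] lin_smul[OF lN] lin_add[OF lB] lin_smul[OF lB] Bw[OF i(1)] Bx[OF i(1)] V.scale_right_distrib mult.commute)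
    ultimately show ?thesis using ZI by metis
  qed
  have xZ: "x \<in> Z" using ZI[of 1 0] by simp
  let ?K = "Poly_Mapping.keys h" and ?l = "Poly_Mapping.lookup"
  define deg where "deg m = (\<Sum>i<d. ?l m i)" for m :: "nat \<Rightarrow>\<^sub>0 nat"
  define a where "a m = ?l h m * (\<Prod>i<d. u i ^ ?l m i)" for m
  define c where "c = (\<Sum>m\<in>?K. if deg m = 0 then a m else 0)"
  define q where "q \<zeta> = (\<Sum>m\<in>?K. if deg m = 0 then 0 else a m * \<zeta> ^ (deg m - 1))" for \<zeta>
  have pe: "pe d h (\<lambda>i. \<zeta> * u i) = c + \<zeta> * q \<zeta>" for \<zeta>
  proof -
    have "pe d h (\<lambda>i. \<zeta> * u i) = (\<Sum>m\<in>?K. a m * \<zeta> ^ deg m)"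
      unfolding pe_def a_def deg_def power_mult_distrib prod.distrib power_sum
      by (simp add: mult_ac)
    also have "\<dots> = (\<Sum>m\<in>?K. (if deg m = 0 then a m else 0) + \<zeta> * (if deg m = 0 then 0 else a m * \<zeta> ^ (deg m - 1)))"
    proof (intro sum.cong refl)
      fix m
      show "a m * \<zeta> ^ deg m = (if deg m = 0 then a m else 0) + \<zeta> * (if deg m = 0 then 0 else a m * \<zeta> ^ (deg m - 1))"
        by (cases "deg m") simp_all
    qed
    finally show ?thesis by (simp add: c_def q_def sum.distrib sum_distrib_left)
  qed
  have g1: "cmod (c + \<zeta> * q \<zeta>) < 1" if "cmod \<zeta> < 1" for \<zeta>
  proof -
    have "(\<Sum>i<d. (cmod (\<zeta> * u i))\<^sup>2) = (cmod \<zeta>)\<^sup>2"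
      using u by (simp add: norm_mult power_mult_distrib flip: sum_distrib_left)
    then have "(\<lambda>i. \<zeta> * u i) \<in> fun_ball d"
      using power2_less_one[OF norm_ge_zero that] by (simp add: fun_ball_def)
    then show ?thesis using ball_boundD[OF h(1)] h(2) pe[of \<zeta>] by fastforce
  qed
  have holq: "q holomorphic_on ball 0 1"
    unfolding q_def
  proof (rule holomorphic_on_sum)
    fix m
    show "(\<lambda>\<zeta>. if deg m = 0 then 0 else a m * \<zeta> ^ (deg m - 1)) holomorphic_on ball 0 1"
      by (cases "deg m = 0") (auto intro!: holomorphic_intros)
  qed
  have Npow: "(N ^^ Suc k) x = smul (\<nu> ^ k) (N x)" for k
    by (induction k) (simp_all add: lin_smul[OF lN] Nx2 mult.commute)
  have "ev d B h x = ev d (\<lambda>i y. smul (u i) (N y)) h x"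
    using BZ by (intro ev_cong_on[where Y = Z] xZ) auto
  also have "\<dots> = (\<Sum>m\<in>?K. smul (a m) ((N ^^ deg m) x))"
    unfolding ev_def monom_op_multiple[OF lN] a_def deg_def by simp
  also have "\<dots> = (\<Sum>m\<in>?K. smul (if deg m = 0 then a m else 0) x 
      + smul (if deg m = 0 then 0 else a m * \<nu> ^ (deg m - 1)) (N x))"
  proof (intro sum.cong refl)
    fix m
    show "smul (a m) ((N ^^ deg m) x) = smul (if deg m = 0 then a m else 0) x 
      + smul (if deg m = 0 then 0 else a m * \<nu> ^ (deg m - 1)) (N x)"
      using Npow[of "deg m - 1"] by (cases "deg m") simp_all
  qed
  also have "\<dots> = smul c x + smul (q \<nu>) (N x)"
    by (simp only: sum.distrib V.scale_sum_left c_def q_def)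
  finally have eq: "ev d B h x = smul c x + smul (q \<nu>) (N x)" .
  have c1: "cmod c < 1" using g1[of 0] by simp
  have r1: "nrm n (N y) \<le> nrm n y" if "y \<in> Y" for y
  proof -
    have "r * nrm n y \<le> 1 * nrm n y" using r by (intro mult_right_mono) auto
    then show ?thesis using N_le[OF that] by simp
  qed
  obtain k where k: "cmod k \<le> 1" "q \<nu> * (1 + cnj c * k * \<nu>) = k * (1 - cnj c * c)"
    by (rule schwarz_pick_quotient[OF holq g1 \<nu>])
  show ?thesis
    unfolding eq by (rule contraction_step_rank_one[OF Y(1) lN NY r1 x Nx2 k c1 \<nu>])
qed

text \<open>
  The strictness hypotheses are removed by dilating $B$ and rescaling $h$.
\<close>

lemma rank_one_bound:
  assumes d: "d \<ge> 1" and Y: "V.subspace Y" "Y \<subseteq> supported n" and B: "commuting B" "invariant B Y" "col_contraction d n B Y"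
    and w: "w \<in> Y" "\<And>i y. i < d \<Longrightarrow> y \<in> Y \<Longrightarrow> \<exists>a. B i y = smul a w"
    and h: "ball_bound d h S" and x: "x \<in> Y"
  shows "nrm n (ev d B h x) \<le> S * nrm n x"
proof -
  have strict: "nrm n (ev d (\<lambda>i y. smul (of_real r) (B i y)) h x) \<le> S' * nrm n x"
    if r: "0 < r" "r < 1" and S': "S < S'" for r S'
  proof -
    let ?B = "\<lambda>i y. smul (of_real r) (B i y)" and ?h = "cst (of_real (1 / S')) * h"
    have S'0: "0 < S'" using ball_bound_nonneg[OF h] S' by simp
    have lB: "lin (B i)" for i using B(1) by (rule commuting_lin)
    have cB: "commuting ?B"
      unfolding commuting_def
    proof (intro conjI allI)
      fix i j y
      show "lin (?B i)" by (rule lin_scale[OF lB])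
      show "?B i (?B j y) = ?B j (?B i y)"
        by (simp only: lin_smul[OF lB] commuting_commute[OF B(1), of i j])
    qed
    have "nrm n (ev d ?B ?h x) \<le> nrm n x"
    proof (rule rank_one_bound_strict[OF d Y cB _ _ r(2) w(1) _ _ _ x])
      show "invariant ?B Y" using invariantD[OF B(2)] subspace_smul[OF Y(1)] by (simp add: invariant_def)
      show "nrm n (\<Sum>i<d. smul (cnj (u i)) (?B i y)) \<le> r * nrm n y"
        if "y \<in> Y" "(\<Sum>i<d. (cmod (u i))\<^sup>2) = 1" for u y
      proof -
        have "(\<Sum>i<d. smul (cnj (u i)) (?B i y)) = smul (of_real r) (\<Sum>i<d. smul (cnj (u i)) (B i y))"
          by (simp add: V.scale_sum_right mult.commute)
        then show ?thesis
          using col_contraction_comb[OF B(3) that(1), of "\<lambda>i. cnj (u i)"] that(2) r(1) by (simp add: nrm_smul)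
      qed
      show "\<exists>a. ?B i y = smul a w" if i: "i < d" "y \<in> Y" for i y
      proof -
        obtain a where "B i y = smul a w" using w(2)[OF i] ..
        then have "?B i y = smul (of_real r * a) w" by simp
        then show ?thesis ..
      qed
      show "ball_bound d ?h (S / S')"
        unfolding ball_bound_def
      proof
        fix z assume z: "z \<in> fun_ball d"
        have "cmod (pe d ?h z) = cmod (pe d h z) / S'"
          using S'0 by (simp add: pe_mult norm_mult norm_divide)
        then show "cmod (pe d ?h z) \<le> S / S'"
          using ball_boundD[OF h z] S'0 by (simp add: divide_right_mono)
      qed
      show "S / S' < 1" using S' S'0 by simp
    qed
    moreover have "ev d ?B ?h x = smul (of_real (1 / S')) (ev d ?B h x)"
      by (simp only: ev_mult[OF cB] ev_cst)
    ultimately show ?thesis using S'0 by (simp add: nrm_smul norm_divide divide_le_eq mult.commute)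
  qed
  have "nrm n (ev d B h x) \<le> S' * nrm n x" if S': "S < S'" for S'
  proof (rule dilation_limit[OF Y(1) commuting_lin[OF B(1)] _ _ x])
    show "\<And>i y. i < d \<Longrightarrow> y \<in> Y \<Longrightarrow> B i y \<in> Y" using invariantD[OF B(2)] by simp
    show "\<And>i y. i < d \<Longrightarrow> y \<in> Y \<Longrightarrow> nrm n (B i y) \<le> nrm n y" using col_contraction_entry[OF B(3)] by simp
    show "\<And>r. 0 < r \<Longrightarrow> r < 1 \<Longrightarrow> nrm n (ev d (\<lambda>i y. smul (of_real r) (B i y)) h x) \<le> S' * nrm n x"
      using strict S' by simp
  qed
  note bound = this
  show ?thesis
  proof (cases "nrm n x = 0")
    case True
    then show ?thesis using bound[of "S + 1"] by simp
  next
    case False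
    then have pos: "0 < nrm n x" using nrm_nonneg[of n x] by linarith
    have "nrm n (ev d B h x) / nrm n x \<le> S"
    proof (rule dense_ge)
      fix S' assume "S < S'"
      then show "nrm n (ev d B h x) / nrm n x \<le> S'" using bound[of S'] pos by (simp add: divide_le_eq)
    qed
    then show ?thesis using pos by (simp add: divide_le_eq)
  qed
qed

section \<open>Bounded holomorphic functions on the ball\<close>

text \<open>
  The Euclidean norm on $\mathbb{C}^d$ for points that are given as functions; only the first \<open>d\<close>
  coordinates count.
\<close>

definition fun_norm :: "nat \<Rightarrow> (nat \<Rightarrow> complex) \<Rightarrow> real" where
  "fun_norm d w = L2_set (\<lambda>i. cmod (w i)) {..<d}"

lemma fun_norm_nonneg [simp]: "0 \<le> fun_norm d w"
  by (simp add: fun_norm_def L2_set_nonneg)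

lemma fun_ball_iff: "z \<in> fun_ball d \<longleftrightarrow> fun_norm d z < 1"
  by (simp add: fun_ball_def fun_norm_def L2_set_def)

lemma fun_norm_entry: "i < d \<Longrightarrow> cmod (w i) \<le> fun_norm d w"
  unfolding fun_norm_def using member_le_L2_set[of "{..<d}" i "\<lambda>i. cmod (w i)"] by simp

lemma fun_norm_scale: "fun_norm d (\<lambda>i. c * w i) = cmod c * fun_norm d w"
  by (simp add: fun_norm_def norm_mult L2_set_right_distrib)

lemma vnorm_eq_fun_norm: "v \<in> carrier_vec d \<Longrightarrow> vnorm v = fun_norm d (\<lambda>i. vec_index v i)"
  by (simp add: vnorm_def fun_norm_def)

lemma vnorm_vec: "vnorm (Matrix.vec d z) = fun_norm d z"
  unfolding vnorm_def fun_norm_def by (rule L2_set_cong) auto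

lemma vec_mem_unit_ball: "Matrix.vec d z \<in> unit_ball d \<longleftrightarrow> z \<in> fun_ball d"
  by (simp add: unit_ball_def vnorm_vec fun_ball_iff)

lemma unit_ball_fun_ball: "v \<in> unit_ball d \<Longrightarrow> (\<lambda>i. vec_index v i) \<in> fun_ball d \<and> Matrix.vec d (\<lambda>i. vec_index v i) = v"
  by (auto simp: unit_ball_def vnorm_eq_fun_norm fun_ball_iff)

lemma poly_eval_pe: "poly_eval d p v = pe d p (\<lambda>i. vec_index v i)"
  by (simp add: poly_eval_def pe_def)

lemma poly_eval_vec: "poly_eval d p (Matrix.vec d z) = pe d p z"
  unfolding poly_eval_pe by (rule pe_cong) simp

text \<open>
  Differentiability with a quadratic error on displacements of length at most 2, the diameter of the
  ball. Unlike the definition with $\epsilon$ and $\delta$ it is visibly stable under products.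
\<close>

definition quad_diff :: "nat \<Rightarrow> (nat \<Rightarrow> complex) \<Rightarrow> ((nat \<Rightarrow> complex) \<Rightarrow> complex) \<Rightarrow> bool" where
  "quad_diff d a F \<longleftrightarrow> (\<exists>c M. 0 \<le> M \<and> (\<forall>w. fun_norm d w \<le> 2 \<longrightarrow>
     cmod (F (\<lambda>i. a i + w i) - F a - (\<Sum>i<d. c i * w i)) \<le> M * (fun_norm d w)\<^sup>2))"

lemma quad_diff_const: "quad_diff d a (\<lambda>_. k)"
  unfolding quad_diff_def by (intro exI[of _ "\<lambda>_. 0"] exI[of _ 0]) simp

lemma quad_diff_coord:
  assumes "i < d" shows "quad_diff d a (\<lambda>z. z i)"
proof -
  have "(\<Sum>j<d. (if j = i then 1 else 0) * w j) = w i" for w :: "nat \<Rightarrow> complex"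
  proof -
    have "(\<Sum>j<d. (if j = i then 1 else 0) * w j) = (\<Sum>j<d. if j = i then w j else 0)"
      by (intro sum.cong) auto
    then show ?thesis using assms by simp
  qed
  then show ?thesis
    unfolding quad_diff_def by (intro exI[of _ "\<lambda>j. if j = i then 1 else 0"] exI[of _ 0]) simp
qed

lemma quad_diff_add:
  assumes "quad_diff d a F" "quad_diff d a G"
  shows "quad_diff d a (\<lambda>z. F z + G z)"
proof -
  obtain c M where F: "0 \<le> M" "\<And>w. fun_norm d w \<le> 2 \<Longrightarrow>
     cmod (F (\<lambda>i. a i + w i) - F a - (\<Sum>i<d. c i * w i)) \<le> M * (fun_norm d w)\<^sup>2"
    using assms(1) unfolding quad_diff_def by blast
  obtain c' M' where G: "0 \<le> M'" "\<And>w. fun_norm d w \<le> 2 \<Longrightarrow>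
     cmod (G (\<lambda>i. a i + w i) - G a - (\<Sum>i<d. c' i * w i)) \<le> M' * (fun_norm d w)\<^sup>2"
    using assms(2) unfolding quad_diff_def by blast
  have "cmod ((F (\<lambda>i. a i + w i) + G (\<lambda>i. a i + w i)) - (F a + G a) - (\<Sum>i<d. (c i + c' i) * w i))
      \<le> (M + M') * (fun_norm d w)\<^sup>2" if "fun_norm d w \<le> 2" for w
  proof -
    have "(F (\<lambda>i. a i + w i) + G (\<lambda>i. a i + w i)) - (F a + G a) - (\<Sum>i<d. (c i + c' i) * w i)
      = (F (\<lambda>i. a i + w i) - F a - (\<Sum>i<d. c i * w i)) + (G (\<lambda>i. a i + w i) - G a - (\<Sum>i<d. c' i * w i))"
      by (simp add: distrib_right sum.distrib)
    also have "cmod \<dots> \<le> M * (fun_norm d w)\<^sup>2 + M' * (fun_norm d w)\<^sup>2"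
      by (rule norm_triangle_mono[OF F(2)[OF that] G(2)[OF that]])
    finally show ?thesis by (simp add: distrib_right)
  qed
  then show ?thesis
    unfolding quad_diff_def using F(1) G(1) by (intro exI[of _ "\<lambda>i. c i + c' i"] exI[of _ "M + M'"]) simp
qed

lemma quad_diff_mult:
  assumes "quad_diff d a F" "quad_diff d a G"
  shows "quad_diff d a (\<lambda>z. F z * G z)"
proof -
  obtain c M where F: "0 \<le> M" "\<And>w. fun_norm d w \<le> 2 \<Longrightarrow>
     cmod (F (\<lambda>i. a i + w i) - F a - (\<Sum>i<d. c i * w i)) \<le> M * (fun_norm d w)\<^sup>2"
    using assms(1) unfolding quad_diff_def by blast
  obtain c' M' where G: "0 \<le> M'" "\<And>w. fun_norm d w \<le> 2 \<Longrightarrow>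
     cmod (G (\<lambda>i. a i + w i) - G a - (\<Sum>i<d. c' i * w i)) \<le> M' * (fun_norm d w)\<^sup>2"
    using assms(2) unfolding quad_diff_def by blast
  define K where "K = (\<Sum>i<d. cmod (c i))"
  define K' where "K' = (\<Sum>i<d. cmod (c' i))"
  have KK: "0 \<le> K" "0 \<le> K'" by (simp_all add: K_def K'_def sum_nonneg)
  have lin: "cmod (\<Sum>i<d. e i * w i) \<le> (\<Sum>i<d. cmod (e i)) * fun_norm d w" for e w :: "nat \<Rightarrow> complex"
  proof -
    have "cmod (\<Sum>i<d. e i * w i) \<le> (\<Sum>i<d. cmod (e i * w i))" by (rule norm_sum)
    also have "\<dots> \<le> (\<Sum>i<d. cmod (e i) * fun_norm d w)"
      unfolding norm_mult by (intro sum_mono mult_left_mono fun_norm_entry) auto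
    finally show ?thesis by (simp add: sum_distrib_right)
  qed
  define B where "B = K * K' + cmod (F a) * M' + cmod (G a) * M + 2 * K * M' + 2 * M * K' + 4 * M * M'"
  have "cmod (F (\<lambda>i. a i + w i) * G (\<lambda>i. a i + w i) - F a * G a - (\<Sum>i<d. (F a * c' i + G a * c i) * w i))
      \<le> B * (fun_norm d w)\<^sup>2" if w: "fun_norm d w \<le> 2" for w
  proof -
    define t where "t = fun_norm d w"
    have t: "0 \<le> t" "t \<le> 2" using w by (simp_all add: t_def)
    define l where "l = (\<Sum>i<d. c i * w i)"
    define l' where "l' = (\<Sum>i<d. c' i * w i)"
    define R where "R = F (\<lambda>i. a i + w i) - F a - l"
    define R' where "R' = G (\<lambda>i. a i + w i) - G a - l'"
    have R: "cmod R \<le> M * t\<^sup>2" "cmod R' \<le> M' * t\<^sup>2"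
      using F(2)[OF w] G(2)[OF w] by (simp_all add: R_def R'_def l_def l'_def t_def)
    have l: "cmod l \<le> K * t" "cmod l' \<le> K' * t"
      unfolding l_def l'_def K_def K'_def t_def by (rule lin)+
    have t2: "t\<^sup>2 * t \<le> 2 * t\<^sup>2" "t\<^sup>2 * t\<^sup>2 \<le> 4 * t\<^sup>2"
    proof -
      have "t\<^sup>2 * t \<le> t\<^sup>2 * 2" using t by (intro mult_left_mono) auto
      then show "t\<^sup>2 * t \<le> 2 * t\<^sup>2" by simp
      have "t\<^sup>2 \<le> 2\<^sup>2" using t by (intro power_mono) auto
      then have "t\<^sup>2 * t\<^sup>2 \<le> 2\<^sup>2 * t\<^sup>2" by (intro mult_right_mono) auto
      then show "t\<^sup>2 * t\<^sup>2 \<le> 4 * t\<^sup>2" by simp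
    qed
    have "(\<Sum>i<d. (F a * c' i + G a * c i) * w i) = F a * l' + G a * l"
      unfolding l_def l'_def by (simp add: distrib_right sum.distrib sum_distrib_left mult.assoc)
    then have "F (\<lambda>i. a i + w i) * G (\<lambda>i. a i + w i) - F a * G a - (\<Sum>i<d. (F a * c' i + G a * c i) * w i)
      = l * l' + F a * R' + G a * R + l * R' + R * l' + R * R'"
      by (simp add: R_def R'_def algebra_simps)
    also have "cmod \<dots> \<le> K * t * (K' * t) + cmod (F a) * (M' * t\<^sup>2) + cmod (G a) * (M * t\<^sup>2) 
        + K * t * (M' * t\<^sup>2) + M * t\<^sup>2 * (K' * t) + M * t\<^sup>2 * (M' * t\<^sup>2)"
    proof (intro norm_triangle_mono)
      show "cmod (l * l') \<le> K * t * (K' * t)" unfolding norm_mult using l KK t by (intro mult_mono) auto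
      show "cmod (F a * R') \<le> cmod (F a) * (M' * t\<^sup>2)" unfolding norm_mult using R by (intro mult_left_mono) auto
      show "cmod (G a * R) \<le> cmod (G a) * (M * t\<^sup>2)" unfolding norm_mult using R by (intro mult_left_mono) auto
      show "cmod (l * R') \<le> K * t * (M' * t\<^sup>2)" unfolding norm_mult using l R KK t by (intro mult_mono) auto
      show "cmod (R * l') \<le> M * t\<^sup>2 * (K' * t)" unfolding norm_mult using l R KK t F(1) by (intro mult_mono) auto
      show "cmod (R * R') \<le> M * t\<^sup>2 * (M' * t\<^sup>2)" unfolding norm_mult using R F(1) by (intro mult_mono) auto
    qed
    also have "\<dots> = (K * K' + cmod (F a) * M' + cmod (G a) * M) * t\<^sup>2 + (K * M' + M * K') * (t\<^sup>2 * t) + (M * M') * (t\<^sup>2 * t\<^sup>2)"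
      by (simp add: power2_eq_square algebra_simps)
    also have "\<dots> \<le> (K * K' + cmod (F a) * M' + cmod (G a) * M) * t\<^sup>2 + (K * M' + M * K') * (2 * t\<^sup>2) + (M * M') * (4 * t\<^sup>2)"
      using t2 KK F(1) G(1) by (intro add_mono mult_left_mono order_refl) auto
    also have "\<dots> = B * t\<^sup>2" by (simp add: B_def algebra_simps)
    finally show ?thesis by (simp add: t_def)
  qed
  moreover have "0 \<le> B" unfolding B_def using KK F(1) G(1) by (intro add_nonneg_nonneg mult_nonneg_nonneg) auto
  ultimately show ?thesis
    unfolding quad_diff_def by (intro exI[of _ "\<lambda>i. F a * c' i + G a * c i"] exI[of _ B]) simp
qed

lemma quad_diff_sum: "(\<And>m. m \<in> S \<Longrightarrow> quad_diff d a (F m)) \<Longrightarrow> quad_diff d a (\<lambda>z. \<Sum>m\<in>S. F m z)"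
  by (induction S rule: infinite_finite_induct) (simp_all add: quad_diff_const quad_diff_add)

lemma quad_diff_prod: "(\<And>m. m \<in> S \<Longrightarrow> quad_diff d a (F m)) \<Longrightarrow> quad_diff d a (\<lambda>z. \<Prod>m\<in>S. F m z)"
  by (induction S rule: infinite_finite_induct) (simp_all add: quad_diff_const quad_diff_mult)

lemma quad_diff_power: "quad_diff d a F \<Longrightarrow> quad_diff d a (\<lambda>z. F z ^ k)"
  by (induction k) (simp_all add: quad_diff_const quad_diff_mult)

lemma quad_diff_pe: "quad_diff d a (pe d p)"
  unfolding pe_def[abs_def]
  by (rule quad_diff_sum, rule quad_diff_mult, rule quad_diff_const, rule quad_diff_prod,
      rule quad_diff_power, rule quad_diff_coord) simp

lemma fun_norm_diff_triangle: "fun_norm d (\<lambda>i. z i - a i) \<le> fun_norm d z + fun_norm d a"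
proof -
  have "fun_norm d (\<lambda>i. z i - a i) \<le> L2_set (\<lambda>i. cmod (z i) + cmod (a i)) {..<d}"
    unfolding fun_norm_def by (intro L2_set_mono) (auto simp: norm_triangle_ineq4)
  also have "\<dots> \<le> fun_norm d z + fun_norm d a" unfolding fun_norm_def by (rule L2_set_triangle_ineq)
  finally show ?thesis .
qed

lemma fun_norm_vec_diff: "z \<in> carrier_vec d \<Longrightarrow> a \<in> carrier_vec d \<Longrightarrow> 
    vnorm (z - a) = fun_norm d (\<lambda>i. vec_index z i - vec_index a i)"
  unfolding vnorm_def fun_norm_def by (rule L2_set_cong) auto

lemma holomorphic_poly_eval: "holomorphic_vec_on d (poly_eval d p) (unit_ball d)"
  unfolding holomorphic_vec_on_def
proof
  fix a assume a: "a \<in> unit_ball d"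
  have ca: "a \<in> carrier_vec d" using a by (simp add: unit_ball_def)
  obtain c M where c: "0 \<le> M" "\<And>w. fun_norm d w \<le> 2 \<Longrightarrow>
     cmod (pe d p (\<lambda>i. vec_index a i + w i) - pe d p (\<lambda>i. vec_index a i) - (\<Sum>i<d. c i * w i)) \<le> M * (fun_norm d w)\<^sup>2"
    using quad_diff_pe[of d "\<lambda>i. vec_index a i" p] unfolding quad_diff_def by blast
  show "\<exists>c\<in>carrier_vec d. \<forall>\<epsilon>>0. \<exists>\<delta>>0. \<forall>z\<in>unit_ball d. vnorm (z - a) < \<delta> \<longrightarrow>
      cmod (poly_eval d p z - poly_eval d p a - (\<Sum>i<d. vec_index c i * (vec_index z i - vec_index a i))) \<le> \<epsilon> * vnorm (z - a)"
  proof (intro bexI[of _ "Matrix.vec d c"] allI impI)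
    fix \<epsilon> :: real assume \<epsilon>: "0 < \<epsilon>"
    show "\<exists>\<delta>>0. \<forall>z\<in>unit_ball d. vnorm (z - a) < \<delta> \<longrightarrow>
      cmod (poly_eval d p z - poly_eval d p a - (\<Sum>i<d. vec_index (Matrix.vec d c) i * (vec_index z i - vec_index a i))) \<le> \<epsilon> * vnorm (z - a)"
    proof (intro exI[of _ "\<epsilon> / (M + 1)"] conjI ballI impI)
      show "0 < \<epsilon> / (M + 1)" using \<epsilon> c(1) by simp
      fix z assume z: "z \<in> unit_ball d" "vnorm (z - a) < \<epsilon> / (M + 1)"
      have cz: "z \<in> carrier_vec d" using z by (simp add: unit_ball_def)
      let ?w = "\<lambda>i. vec_index z i - vec_index a i"
      have v: "vnorm (z - a) = fun_norm d ?w" by (rule fun_norm_vec_diff[OF cz ca])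
      have w2: "fun_norm d ?w \<le> 2"
        using fun_norm_diff_triangle[of d "\<lambda>i. vec_index z i" "\<lambda>i. vec_index a i"] unit_ball_fun_ball[OF z(1)] unit_ball_fun_ball[OF a]
        by (auto simp: fun_ball_iff)
      have "M * fun_norm d ?w \<le> \<epsilon>"
      proof -
        have "M * fun_norm d ?w \<le> (M + 1) * fun_norm d ?w" by (intro mult_right_mono) auto
        also have "\<dots> \<le> \<epsilon>" using z(2) c(1) unfolding v by (simp add: pos_less_divide_eq mult.commute less_imp_le)
        finally show ?thesis .
      qed
      then have "M * fun_norm d ?w * fun_norm d ?w \<le> \<epsilon> * fun_norm d ?w" by (intro mult_right_mono) auto
      then have "M * (fun_norm d ?w)\<^sup>2 \<le> \<epsilon> * fun_norm d ?w" by (simp add: power2_eq_square mult.assoc)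
      moreover have "(\<Sum>i<d. vec_index (Matrix.vec d c) i * ?w i) = (\<Sum>i<d. c i * ?w i)" by simp
      ultimately show "cmod (poly_eval d p z - poly_eval d p a - (\<Sum>i<d. vec_index (Matrix.vec d c) i * ?w i)) \<le> \<epsilon> * vnorm (z - a)"
        using c(2)[OF w2] unfolding poly_eval_pe v by simp
    qed
  qed simp
qed

lemma pe_bounded: "z \<in> fun_ball d \<Longrightarrow> cmod (pe d p z) \<le> (\<Sum>m\<in>Poly_Mapping.keys p. cmod (Poly_Mapping.lookup p m))"
proof -
  assume z: "z \<in> fun_ball d"
  have "cmod (z i) \<le> 1" if "i < d" for i
    using fun_norm_entry[OF that, of z] z by (simp add: fun_ball_iff)
  then have 1: "cmod (\<Prod>i<d. z i ^ Poly_Mapping.lookup m i) \<le> 1" for m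
    unfolding prod_norm[symmetric] norm_power by (intro prod_le_1) (auto intro: power_le_one)
  have "cmod (pe d p z) \<le> (\<Sum>m\<in>Poly_Mapping.keys p. cmod (Poly_Mapping.lookup p m * (\<Prod>i<d. z i ^ Poly_Mapping.lookup m i)))"
    unfolding pe_def by (rule norm_sum)
  also have "\<dots> \<le> (\<Sum>m\<in>Poly_Mapping.keys p. cmod (Poly_Mapping.lookup p m) * 1)"
    unfolding norm_mult by (intro sum_mono mult_left_mono 1) auto
  finally show ?thesis by simp
qed

lemma poly_eval_H_inf: "poly_eval d p \<in> H_inf d"
proof -
  have "\<forall>z\<in>unit_ball d. cmod (poly_eval d p z) \<le> (\<Sum>m\<in>Poly_Mapping.keys p. cmod (Poly_Mapping.lookup p m))"
    unfolding poly_eval_pe by (intro ballI pe_bounded conjunct1[OF unit_ball_fun_ball])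
  then show ?thesis unfolding H_inf_def using holomorphic_poly_eval by blast
qed

lemma H_inf_minus_const: "f \<in> H_inf d \<Longrightarrow> (\<lambda>z. f z - k) \<in> H_inf d"
proof -
  assume f: "f \<in> H_inf d"
  obtain B where B: "\<forall>z\<in>unit_ball d. cmod (f z) \<le> B" using f by (auto simp: H_inf_def)
  have "\<forall>z\<in>unit_ball d. cmod (f z - k) \<le> B + cmod k"
  proof
    fix z assume "z \<in> unit_ball d"
    then have "cmod (f z) \<le> B" using B by blast
    then show "cmod (f z - k) \<le> B + cmod k" using norm_triangle_ineq4[of "f z" k] by linarith
  qed
  moreover have "holomorphic_vec_on d (\<lambda>z. f z - k) (unit_ball d)"
    using f unfolding H_inf_def holomorphic_vec_on_def by simp
  ultimately show ?thesis unfolding H_inf_def by blast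
qed

lemma sup_norm_ge: "f \<in> H_inf d \<Longrightarrow> z \<in> unit_ball d \<Longrightarrow> cmod (f z) \<le> sup_norm d f"
  unfolding sup_norm_def by (rule cSUP_upper) (auto simp: H_inf_def bdd_above_def)

lemma zero_in_unit_ball: "0\<^sub>v d \<in> unit_ball d"
  by (simp add: unit_ball_def vnorm_def L2_set_def)

lemma sup_norm_le: "(\<And>z. z \<in> unit_ball d \<Longrightarrow> cmod (f z) \<le> S) \<Longrightarrow> sup_norm d f \<le> S"
  unfolding sup_norm_def using zero_in_unit_ball by (intro cSUP_least) auto

section \<open>A polynomial form of the Gleason property\<close>

text \<open>
  Restricting to complex lines through the origin reduces Taylor expansion on the ball to one variable.
\<close>

lemma slice_holomorphic:
  assumes f: "holomorphic_vec_on d f (unit_ball d)" and z: "fun_norm d z * \<rho> < 1" "0 < \<rho>"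
  shows "(\<lambda>\<zeta>. f (Matrix.vec d (\<lambda>i. \<zeta> * z i))) holomorphic_on ball 0 \<rho>"
proof (rule holomorphic_onI)
  let ?v = "\<lambda>\<zeta>. Matrix.vec d (\<lambda>i. \<zeta> * z i)"
  have mem: "?v \<zeta> \<in> unit_ball d" if "\<zeta> \<in> ball 0 \<rho>" for \<zeta>
  proof -
    have "cmod \<zeta> * fun_norm d z \<le> \<rho> * fun_norm d z" using that by (intro mult_right_mono) auto
    then show ?thesis using z unfolding vec_mem_unit_ball fun_ball_iff fun_norm_scale by (simp add: mult.commute)
  qed
  fix \<zeta> :: complex assume \<zeta>: "\<zeta> \<in> ball 0 \<rho>"
  obtain c where c: "\<forall>\<epsilon>>0. \<exists>\<delta>>0. \<forall>y\<in>unit_ball d. vnorm (y - ?v \<zeta>) < \<delta> \<longrightarrow>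
      cmod (f y - f (?v \<zeta>) - (\<Sum>i<d. vec_index c i * (vec_index y i - vec_index (?v \<zeta>) i))) \<le> \<epsilon> * vnorm (y - ?v \<zeta>)"
    using f mem[OF \<zeta>] unfolding holomorphic_vec_on_def by blast
  define D where "D = (\<Sum>i<d. vec_index c i * z i)"
  have diff: "vnorm (?v \<xi> - ?v \<zeta>) = cmod (\<xi> - \<zeta>) * fun_norm d z" for \<xi>
  proof -
    have "vnorm (?v \<xi> - ?v \<zeta>) = fun_norm d (\<lambda>i. vec_index (?v \<xi>) i - vec_index (?v \<zeta>) i)"
      by (rule fun_norm_vec_diff) simp_all
    also have "\<dots> = fun_norm d (\<lambda>i. (\<xi> - \<zeta>) * z i)"
      unfolding fun_norm_def by (rule L2_set_cong) (auto simp: left_diff_distrib)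
    finally show ?thesis by (simp only: fun_norm_scale)
  qed
  have "((\<lambda>\<zeta>. f (?v \<zeta>)) has_field_derivative D) (at \<zeta> within ball 0 \<rho>)"
    unfolding has_field_derivative_def has_derivative_within_alt
  proof (intro conjI allI impI)
    show "bounded_linear ((*) D)" by (rule bounded_linear_mult_right)
    fix e :: real assume e: "0 < e"
    define \<epsilon> where "\<epsilon> = e / (fun_norm d z + 1)"
    have \<epsilon>: "0 < \<epsilon>" "\<epsilon> * fun_norm d z \<le> e"
      using e fun_norm_nonneg[of d z] by (simp_all add: \<epsilon>_def divide_le_eq add_nonneg_pos mult_left_mono)
    obtain \<delta> where \<delta>: "0 < \<delta>" "\<forall>y\<in>unit_ball d. vnorm (y - ?v \<zeta>) < \<delta> \<longrightarrow>
      cmod (f y - f (?v \<zeta>) - (\<Sum>i<d. vec_index c i * (vec_index y i - vec_index (?v \<zeta>) i))) \<le> \<epsilon> * vnorm (y - ?v \<zeta>)"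
      using c \<epsilon>(1) by blast
    show "\<exists>\<delta>>0. \<forall>\<xi>\<in>ball 0 \<rho>. norm (\<xi> - \<zeta>) < \<delta> \<longrightarrow>
        norm (f (?v \<xi>) - f (?v \<zeta>) - D * (\<xi> - \<zeta>)) \<le> e * norm (\<xi> - \<zeta>)"
    proof (intro exI[of _ "\<delta> / (fun_norm d z + 1)"] conjI ballI impI)
      show "0 < \<delta> / (fun_norm d z + 1)" using \<delta>(1) by (simp add: add_nonneg_pos)
      fix \<xi> :: complex assume \<xi>: "\<xi> \<in> ball 0 \<rho>" "norm (\<xi> - \<zeta>) < \<delta> / (fun_norm d z + 1)"
      have "cmod (\<xi> - \<zeta>) * fun_norm d z \<le> cmod (\<xi> - \<zeta>) * (fun_norm d z + 1)" by (intro mult_left_mono) auto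
      also have "\<dots> < \<delta>" using \<xi>(2) by (simp add: pos_less_divide_eq add_nonneg_pos)
      finally have "vnorm (?v \<xi> - ?v \<zeta>) < \<delta>" by (simp only: diff)
      then have "cmod (f (?v \<xi>) - f (?v \<zeta>) - (\<Sum>i<d. vec_index c i * (vec_index (?v \<xi>) i - vec_index (?v \<zeta>) i)))
          \<le> \<epsilon> * vnorm (?v \<xi> - ?v \<zeta>)"
        using \<delta>(2) mem[OF \<xi>(1)] by blast
      also have "(\<Sum>i<d. vec_index c i * (vec_index (?v \<xi>) i - vec_index (?v \<zeta>) i)) = D * (\<xi> - \<zeta>)"
        unfolding D_def sum_distrib_right by (intro sum.cong refl) (simp add: algebra_simps)
      also have "\<epsilon> * vnorm (?v \<xi> - ?v \<zeta>) = (\<epsilon> * fun_norm d z) * cmod (\<xi> - \<zeta>)" by (simp add: diff)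
      also have "\<dots> \<le> e * cmod (\<xi> - \<zeta>)" using \<epsilon>(2) by (intro mult_right_mono) auto
      finally show "norm (f (?v \<xi>) - f (?v \<zeta>) - D * (\<xi> - \<zeta>)) \<le> e * norm (\<xi> - \<zeta>)" .
    qed
  qed
  then show "(\<lambda>\<zeta>. f (?v \<zeta>)) field_differentiable at \<zeta> within ball 0 \<rho>"
    by (auto simp: field_differentiable_def)
qed

text \<open>
  A power series that is $O(|\zeta|^N)$ at the origin starts at degree $N$.
\<close>

lemma power_series_coeffs_zero:
  fixes e :: "nat \<Rightarrow> complex"
  assumes s: "\<And>\<zeta>. cmod \<zeta> < 1 \<Longrightarrow> (\<lambda>k. e k * \<zeta> ^ k) sums \<psi> \<zeta>"
    and B: "\<And>\<zeta>. cmod \<zeta> < 1 \<Longrightarrow> cmod (\<psi> \<zeta>) \<le> B * cmod \<zeta> ^ N" and k: "k < N"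
  shows "e k = 0"
  using k
proof (induction k rule: less_induct)
  case (less k)
  have "((\<lambda>\<zeta>. \<psi> \<zeta> / \<zeta> ^ k) \<longlongrightarrow> e (0 + k)) (at 0)"
  proof (rule powser_limit_0_strong[of 1])
    fix \<zeta> :: complex assume \<zeta>: "\<zeta> \<noteq> 0" "norm \<zeta> < 1"
    have "(\<lambda>j. e (j + k) * \<zeta> ^ (j + k)) sums (\<psi> \<zeta> - (\<Sum>j<k. e j * \<zeta> ^ j))"
      by (rule sums_split_initial_segment[OF s[OF \<zeta>(2)]])
    also have "(\<Sum>j<k. e j * \<zeta> ^ j) = 0" using less by (intro sum.neutral) auto
    finally have "(\<lambda>j. e (j + k) * \<zeta> ^ (j + k) / \<zeta> ^ k) sums ((\<psi> \<zeta> - 0) / \<zeta> ^ k)" by (rule sums_divide)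
    then show "(\<lambda>j. e (j + k) * \<zeta> ^ j) sums (\<psi> \<zeta> / \<zeta> ^ k)" using \<zeta>(1) by (simp add: power_add)
  qed simp
  moreover have "((\<lambda>\<zeta>. \<psi> \<zeta> / \<zeta> ^ k) \<longlongrightarrow> 0) (at 0)"
  proof (rule Lim_null_comparison)
    have "0 < N - k" using less by simp
    have "((\<lambda>\<zeta>::complex. B * cmod \<zeta> ^ (N - k)) \<longlongrightarrow> B * cmod 0 ^ (N - k)) (at 0)"
      by (intro tendsto_intros)
    then show "((\<lambda>\<zeta>::complex. B * cmod \<zeta> ^ (N - k)) \<longlongrightarrow> 0) (at 0)" using zero_power[OF \<open>0 < N - k\<close>, where ?'a = real] by simp
    have "norm (\<psi> \<zeta> / \<zeta> ^ k) \<le> B * cmod \<zeta> ^ (N - k)" if "\<zeta> \<in> ball 0 1" "\<zeta> \<noteq> 0" for \<zeta>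
    proof -
      have "cmod (\<psi> \<zeta>) \<le> B * cmod \<zeta> ^ (N - k) * cmod \<zeta> ^ k"
        using B[of \<zeta>] that less.prems by (simp add: mult.assoc flip: power_add)
      then show ?thesis using that(2) by (simp add: norm_divide norm_power divide_le_eq)
    qed
    then show "\<forall>\<^sub>F \<zeta> in at 0. norm (\<psi> \<zeta> / \<zeta> ^ k) \<le> B * cmod \<zeta> ^ (N - k)"
      unfolding eventually_at_topological by (intro exI[of _ "ball 0 1"]) auto
  qed
  ultimately show "e k = 0" using tendsto_unique[OF at_neq_bot] by auto
qed

lemma gleason_constantD:
  assumes "gleason_constant k c" "f \<in> H_inf k" "f (0\<^sub>v k) = 0"
  obtains g where "\<forall>i<k. g i \<in> H_inf k \<and> sup_norm k (g i) \<le> c * sup_norm k f"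
    "\<forall>z\<in>unit_ball k. f z = (\<Sum>i<k. vec_index z i * g i z)"
proof -
  have "f (0\<^sub>v k) = 0 \<longrightarrow> (\<exists>g. (\<forall>i<k. g i \<in> H_inf k \<and> sup_norm k (g i) \<le> c * sup_norm k f) \<and>
    (\<forall>z\<in>unit_ball k. f z = (\<Sum>i<k. vec_index z i * g i z)))"
    using assms(1,2) unfolding gleason_constant_def by (rule bspec)
  then show thesis using assms(3) that by auto
qed

text \<open>
  Iterating the Gleason property $N$ times writes $f$ as a polynomial of degree less than $N$, up to an
  error of order $|z|^N$. In this way the Gleason property itself supplies the Taylor polynomials of a
  bounded holomorphic function of several variables.
\<close>

lemma gleason_jet:
  assumes C: "gleason_constant d c" and f: "f \<in> H_inf d"
  shows "\<exists>a B. (\<forall>k<N. a k \<in> polys d \<and> (\<forall>t z. pe d (a k) (\<lambda>i. t * z i) = t ^ k * pe d (a k) z)) \<and>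
    (\<forall>z\<in>fun_ball d. cmod (f (Matrix.vec d z) - (\<Sum>k<N. pe d (a k) z)) \<le> B * fun_norm d z ^ N)"
  using f
proof (induction N arbitrary: f)
  case 0
  then obtain B where "\<forall>z\<in>unit_ball d. cmod (f z) \<le> B" by (auto simp: H_inf_def)
  then show ?case by (intro exI[of _ "\<lambda>_. 0"] exI[of _ B]) (simp add: vec_mem_unit_ball)
next
  case (Suc N)
  define f0 where "f0 = f (0\<^sub>v d)"
  have 1: "(\<lambda>z. f z - f0) \<in> H_inf d" using Suc.prems by (rule H_inf_minus_const)
  have 2: "f (0\<^sub>v d) - f0 = 0" by (simp add: f0_def)
  obtain g where g: "\<forall>i<d. g i \<in> H_inf d \<and> sup_norm d (g i) \<le> c * sup_norm d (\<lambda>z. f z - f0)"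
    "\<forall>z\<in>unit_ball d. f z - f0 = (\<Sum>i<d. vec_index z i * g i z)"
    by (rule gleason_constantD[OF C 1 2])
  define P where "P i a B \<longleftrightarrow> (\<forall>k<N. a k \<in> polys d \<and> (\<forall>t z. pe d (a k) (\<lambda>i. t * z i) = t ^ k * pe d (a k) z)) \<and>
    (\<forall>z\<in>fun_ball d. cmod (g i (Matrix.vec d z) - (\<Sum>k<N. pe d (a k) z)) \<le> B * fun_norm d z ^ N)" for i a B
  have "\<forall>i. \<exists>ab. i < d \<longrightarrow> P i (fst ab) (snd ab)"
  proof
    fix i
    show "\<exists>ab. i < d \<longrightarrow> P i (fst ab) (snd ab)"
    proof (cases "i < d")
      case True
      then obtain a B where "P i a B" using Suc.IH[of "g i"] g(1) unfolding P_def by blast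
      then show ?thesis by (intro exI[of _ "(a, B)"]) simp
    qed simp
  qed
  then obtain ab where ab: "\<And>i. i < d \<Longrightarrow> P i (fst (ab i)) (snd (ab i))"
    using choice[of "\<lambda>i ab. i < d \<longrightarrow> P i (fst ab) (snd ab)"] by blast
  define a where "a k = (if k = 0 then cst f0 else (\<Sum>i<d. var i * fst (ab i) (k - 1)))" for k
  have a: "a k \<in> polys d \<and> (\<forall>t z. pe d (a k) (\<lambda>i. t * z i) = t ^ k * pe d (a k) z)" if "k < Suc N" for k
  proof (cases k)
    case 0
    then show ?thesis by (simp add: a_def polys_cst)
  next
    case (Suc j)
    then have j: "j < N" using that by simp
    have aj: "a k = (\<Sum>i<d. var i * fst (ab i) j)" by (simp add: a_def Suc)
    have "a k \<in> polys d"
      unfolding aj using ab j unfolding P_def by (intro polys_sum polys_mult polys_var) auto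
    moreover have "pe d (a k) (\<lambda>i. t * z i) = t ^ k * pe d (a k) z" for t z
      unfolding aj pe_sum pe_mult sum_distrib_left
      using ab j unfolding P_def by (intro sum.cong refl) (auto simp: Suc mult_ac)
    ultimately show ?thesis by blast
  qed
  moreover have "cmod (f (Matrix.vec d z) - (\<Sum>k<Suc N. pe d (a k) z)) \<le> (\<Sum>i<d. \<bar>snd (ab i)\<bar>) * fun_norm d z ^ Suc N"
    if z: "z \<in> fun_ball d" for z
  proof -
    have "(\<Sum>k<Suc N. pe d (a k) z) = f0 + (\<Sum>k<N. \<Sum>i<d. z i * pe d (fst (ab i) k) z)"
      unfolding sum.lessThan_Suc_shift by (simp add: a_def pe_sum pe_mult)
    also have "(\<Sum>k<N. \<Sum>i<d. z i * pe d (fst (ab i) k) z) = (\<Sum>i<d. z i * (\<Sum>k<N. pe d (fst (ab i) k) z))"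
      unfolding sum_distrib_left by (rule sum.swap)
    finally have "f (Matrix.vec d z) - (\<Sum>k<Suc N. pe d (a k) z)
      = (f (Matrix.vec d z) - f0) - (\<Sum>i<d. z i * (\<Sum>k<N. pe d (fst (ab i) k) z))" by simp
    also have "f (Matrix.vec d z) - f0 = (\<Sum>i<d. z i * g i (Matrix.vec d z))"
      using g(2) z by (simp add: vec_mem_unit_ball)
    also have "\<dots> - (\<Sum>i<d. z i * (\<Sum>k<N. pe d (fst (ab i) k) z))
      = (\<Sum>i<d. z i * (g i (Matrix.vec d z) - (\<Sum>k<N. pe d (fst (ab i) k) z)))"
      by (simp only: right_diff_distrib sum_subtractf)
    also have "cmod \<dots> \<le> (\<Sum>i<d. fun_norm d z * (\<bar>snd (ab i)\<bar> * fun_norm d z ^ N))"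
    proof (rule order_trans[OF norm_sum], rule sum_mono)
      fix i assume i: "i \<in> {..<d}"
      have "cmod (g i (Matrix.vec d z) - (\<Sum>k<N. pe d (fst (ab i) k) z)) \<le> snd (ab i) * fun_norm d z ^ N"
        using ab[of i] i z unfolding P_def by blast
      also have "\<dots> \<le> \<bar>snd (ab i)\<bar> * fun_norm d z ^ N" by (intro mult_right_mono) auto
      finally show "cmod (z i * (g i (Matrix.vec d z) - (\<Sum>k<N. pe d (fst (ab i) k) z))) \<le> fun_norm d z * (\<bar>snd (ab i)\<bar> * fun_norm d z ^ N)"
        unfolding norm_mult using fun_norm_entry[of i d z] i by (intro mult_mono) auto
    qed
    finally show ?thesis by (simp add: sum_distrib_left sum_distrib_right mult_ac)
  qed
  ultimately show ?case by (intro exI[of _ a] exI[of _ "\<Sum>i<d. \<bar>snd (ab i)\<bar>"]) blast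
qed

text \<open>
  On each slice the Taylor coefficients exist by one-variable theory, and comparison with the jets shows
  that the $k$-th coefficient is a homogeneous polynomial in the direction. Cauchy's estimate bounds each
  of them by the supremum of $f$.
\<close>

lemma homogeneous_expansion:
  assumes C: "gleason_constant d c" and f: "f \<in> H_inf d"
    and T: "\<And>z. z \<in> fun_ball d \<Longrightarrow> cmod (f (Matrix.vec d z)) \<le> T"
  obtains a where "\<And>k. a k \<in> polys d" "\<And>k. ball_bound d (a k) T"
    "\<And>z \<zeta>. z \<in> fun_ball d \<Longrightarrow> cmod \<zeta> \<le> 1 \<Longrightarrow> (\<lambda>k. pe d (a k) z * \<zeta> ^ k) sums f (Matrix.vec d (\<lambda>i. \<zeta> * z i))"
proof -
  define t where "t z k = (deriv ^^ k) (\<lambda>\<zeta>. f (Matrix.vec d (\<lambda>i. \<zeta> * z i))) 0 / fact k" for z k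
  have slice: "\<exists>\<rho>>1. (\<lambda>\<zeta>. f (Matrix.vec d (\<lambda>i. \<zeta> * z i))) holomorphic_on ball 0 \<rho>" if z: "z \<in> fun_ball d" for z
  proof (intro exI[of _ "2 / (1 + fun_norm d z)"] conjI slice_holomorphic)
    have n: "0 < 1 + fun_norm d z" "fun_norm d z < 1" using z fun_norm_nonneg[of d z] by (simp_all add: fun_ball_iff add_pos_nonneg)
    then show "1 < 2 / (1 + fun_norm d z)" by (simp add: less_divide_eq)
    show "fun_norm d z * (2 / (1 + fun_norm d z)) < 1" using n by (simp add: divide_less_eq)
    show "0 < 2 / (1 + fun_norm d z)" using n by simp
  qed (use f in \<open>simp add: H_inf_def\<close>)
  have sums: "(\<lambda>k. t z k * \<zeta> ^ k) sums f (Matrix.vec d (\<lambda>i. \<zeta> * z i))" 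
    if z: "z \<in> fun_ball d" and \<zeta>: "cmod \<zeta> \<le> 1" for z \<zeta>
  proof -
    obtain \<rho> where \<rho>: "\<rho> > 1" "(\<lambda>\<zeta>. f (Matrix.vec d (\<lambda>i. \<zeta> * z i))) holomorphic_on ball 0 \<rho>"
      using slice[OF z] by blast
    show ?thesis using holomorphic_power_series[OF \<rho>(2), of \<zeta>] \<zeta> \<rho>(1) by (simp add: t_def)
  qed
  have dil: "(\<lambda>i. \<zeta> * z i) \<in> fun_ball d" if "z \<in> fun_ball d" "cmod \<zeta> \<le> 1" for z \<zeta>
  proof -
    have "cmod \<zeta> * fun_norm d z \<le> 1 * fun_norm d z" using that(2) by (intro mult_right_mono) auto
    then show ?thesis using that(1) by (simp add: fun_ball_iff fun_norm_scale)
  qed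
  have tT: "cmod (t z k) \<le> T" if z: "z \<in> fun_ball d" for z k
  proof -
    obtain \<rho> where \<rho>: "\<rho> > 1" "(\<lambda>\<zeta>. f (Matrix.vec d (\<lambda>i. \<zeta> * z i))) holomorphic_on ball 0 \<rho>"
      using slice[OF z] by blast
    have sub: "ball 0 1 \<subseteq> ball (0::complex) \<rho>" "cball 0 1 \<subseteq> ball (0::complex) \<rho>" using \<rho>(1) by auto
    have "cmod ((deriv ^^ k) (\<lambda>\<zeta>. f (Matrix.vec d (\<lambda>i. \<zeta> * z i))) 0) \<le> fact k * T / 1 ^ k"
    proof (rule Cauchy_inequality)
      show "(\<lambda>\<zeta>. f (Matrix.vec d (\<lambda>i. \<zeta> * z i))) holomorphic_on ball 0 1"
        using holomorphic_on_subset[OF \<rho>(2) sub(1)] .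
      show "continuous_on (cball 0 1) (\<lambda>\<zeta>. f (Matrix.vec d (\<lambda>i. \<zeta> * z i)))"
        using holomorphic_on_imp_continuous_on[OF holomorphic_on_subset[OF \<rho>(2) sub(2)]] .
      show "cmod (f (Matrix.vec d (\<lambda>i. x * z i))) \<le> T" if "cmod (0 - x) = 1" for x
        using that by (intro T dil[OF z]) simp
    qed simp
    then show ?thesis by (simp add: t_def norm_divide divide_le_eq mult.commute)
  qed
  have "\<forall>k. \<exists>a. a \<in> polys d \<and> (\<forall>z\<in>fun_ball d. pe d a z = t z k)"
  proof
    fix k
    obtain a B where a: "\<forall>j<Suc k. a j \<in> polys d \<and> (\<forall>t z. pe d (a j) (\<lambda>i. t * z i) = t ^ j * pe d (a j) z)"
      and B: "\<forall>z\<in>fun_ball d. cmod (f (Matrix.vec d z) - (\<Sum>j<Suc k. pe d (a j) z)) \<le> B * fun_norm d z ^ Suc k"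
      using gleason_jet[OF C f, of "Suc k"] by (elim exE conjE)
    have "pe d (a k) z = t z k" if z: "z \<in> fun_ball d" for z
    proof -
      define e where "e j = t z j - (if j < Suc k then pe d (a j) z else 0)" for j
      have "e k = 0"
      proof (rule power_series_coeffs_zero)
        fix \<zeta> :: complex assume \<zeta>: "cmod \<zeta> < 1"
        let ?\<psi> = "\<lambda>\<zeta>. f (Matrix.vec d (\<lambda>i. \<zeta> * z i)) - (\<Sum>j<Suc k. pe d (a j) (\<lambda>i. \<zeta> * z i))"
        have eq: "(\<Sum>j<Suc k. pe d (a j) (\<lambda>i. \<zeta> * z i)) = (\<Sum>j<Suc k. (if j < Suc k then pe d (a j) z else 0) * \<zeta> ^ j)"
          using a by (intro sum.cong refl) (auto simp: mult.commute)
        have "(\<lambda>j. (if j < Suc k then pe d (a j) z else 0) * \<zeta> ^ j) sums (\<Sum>j<Suc k. (if j < Suc k then pe d (a j) z else 0) * \<zeta> ^ j)"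
          by (rule sums_finite) auto
        from sums_diff[OF sums[OF z less_imp_le[OF \<zeta>]] this]
        show "(\<lambda>j. e j * \<zeta> ^ j) sums ?\<psi> \<zeta>" by (simp only: eq e_def left_diff_distrib)
        have "cmod (?\<psi> \<zeta>) \<le> B * (cmod \<zeta> * fun_norm d z) ^ Suc k"
          using B dil[OF z less_imp_le[OF \<zeta>]] unfolding fun_norm_scale[symmetric] by blast
        then show "cmod (?\<psi> \<zeta>) \<le> (B * fun_norm d z ^ Suc k) * cmod \<zeta> ^ Suc k"
          by (simp only: power_mult_distrib mult_ac)
      qed simp
      then show ?thesis by (simp add: e_def)
    qed
    then show "\<exists>a. a \<in> polys d \<and> (\<forall>z\<in>fun_ball d. pe d a z = t z k)" using a by (intro exI[of _ "a k"]) simp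
  qed
  from choice[OF this] obtain a where a: "\<And>k. a k \<in> polys d" "\<And>k z. z \<in> fun_ball d \<Longrightarrow> pe d (a k) z = t z k"
    by blast
  show ?thesis
  proof (rule that[of a])
    show "a k \<in> polys d" for k by (rule a(1))
    show "ball_bound d (a k) T" for k unfolding ball_bound_def using a(2) tT by simp
    show "(\<lambda>k. pe d (a k) z * \<zeta> ^ k) sums f (Matrix.vec d (\<lambda>i. \<zeta> * z i))" if "z \<in> fun_ball d" "cmod \<zeta> \<le> 1" for z \<zeta>
      using sums[OF that] a(2)[OF that(1)] by simp
  qed
qed

text \<open>
  The Gleason property produces bounded holomorphic functions, which cannot be evaluated at matrices.
  Here they are replaced by polynomials. The homogeneous components of $p = \sum_i z_i g_i$ are compared:
  those of $p$ vanish above its degree, so truncating the expansions of the $g_i$ beyond that degree does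
  not change the sum $\sum_i z_i g_i(rz)$ at all. The dilation by $r$ makes the discarded tails of the
  $g_i$ uniformly small, which costs only $\epsilon$ in the bounds.
\<close>

lemma gleason_polynomial:
  assumes C: "gleason_constant d c" and c: "0 \<le> c" and p: "pe d p (\<lambda>_. 0) = 0" "ball_bound d p S"
    and r: "0 < r" "r < 1" and \<epsilon>: "0 < \<epsilon>"
  obtains q where "\<And>i. i < d \<Longrightarrow> q i \<in> polys d" "\<And>i. i < d \<Longrightarrow> ball_bound d (q i) (c * S + \<epsilon>)"
    "\<And>z. z \<in> fun_ball d \<Longrightarrow> pe d p (\<lambda>i. of_real r * z i) = (\<Sum>i<d. z i * pe d (q i) z)"
proof -
  define T where "T = c * S"
  have T: "0 \<le> T" unfolding T_def using c ball_bound_nonneg[OF p(2)] by simp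
  have "poly_eval d p (0\<^sub>v d) = 0"
  proof -
    have "poly_eval d p (0\<^sub>v d) = pe d p (\<lambda>_. 0)" unfolding poly_eval_pe by (rule pe_cong) simp
    then show ?thesis using p(1) by simp
  qed
  then obtain g where g0: "\<forall>i<d. g i \<in> H_inf d \<and> sup_norm d (g i) \<le> c * sup_norm d (poly_eval d p)"
    "\<forall>z\<in>unit_ball d. poly_eval d p z = (\<Sum>i<d. vec_index z i * g i z)"
    by (rule gleason_constantD[OF C poly_eval_H_inf])
  have g: "\<And>i. i < d \<Longrightarrow> g i \<in> H_inf d" 
    "\<And>i. i < d \<Longrightarrow> sup_norm d (g i) \<le> c * sup_norm d (poly_eval d p)"
    "\<And>z. z \<in> unit_ball d \<Longrightarrow> poly_eval d p z = (\<Sum>i<d. vec_index z i * g i z)"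
    using g0 by auto
  have "sup_norm d (poly_eval d p) \<le> S"
    using ball_boundD[OF p(2)] unit_ball_fun_ball by (intro sup_norm_le) (simp add: poly_eval_pe)
  then have "c * sup_norm d (poly_eval d p) \<le> T" unfolding T_def using c by (rule mult_left_mono)
  then have gT: "cmod (g i (Matrix.vec d z)) \<le> T" if "i < d" "z \<in> fun_ball d" for i z
    using sup_norm_ge[OF g(1)[OF that(1)], of "Matrix.vec d z"] g(2)[OF that(1)] that(2)
    by (simp add: vec_mem_unit_ball)
  define P where "P i a \<longleftrightarrow> (\<forall>k. a k \<in> polys d \<and> ball_bound d (a k) T) \<and> (\<forall>z\<in>fun_ball d. \<forall>\<zeta>. cmod \<zeta> \<le> 1 \<longrightarrow>
      (\<lambda>k. pe d (a k) z * \<zeta> ^ k) sums g i (Matrix.vec d (\<lambda>i. \<zeta> * z i)))" for i a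
  have "\<forall>i. \<exists>a. i < d \<longrightarrow> P i a"
  proof
    fix i
    show "\<exists>a. i < d \<longrightarrow> P i a"
    proof (cases "i < d")
      case True
      show ?thesis
      proof (rule homogeneous_expansion[OF C g(1)[OF True] gT[OF True]])
        fix a assume "\<And>k. a k \<in> polys d" "\<And>k. ball_bound d (a k) T"
          "\<And>z \<zeta>. z \<in> fun_ball d \<Longrightarrow> cmod \<zeta> \<le> 1 \<Longrightarrow> (\<lambda>k. pe d (a k) z * \<zeta> ^ k) sums g i (Matrix.vec d (\<lambda>i. \<zeta> * z i))"
        then have "P i a" unfolding P_def by simp
        then show ?thesis by blast
      qed
    qed simp
  qed
  from choice[OF this] obtain a where a: "\<And>i. i < d \<Longrightarrow> P i (a i)" by blast
  have aT: "cmod (pe d (a i k) z) \<le> T" if "i < d" "z \<in> fun_ball d" for i k z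
    using a[OF that(1)] that(2) unfolding P_def ball_bound_def by blast
  have asums: "(\<lambda>k. pe d (a i k) z * \<zeta> ^ k) sums g i (Matrix.vec d (\<lambda>i. \<zeta> * z i))"
    if "i < d" "z \<in> fun_ball d" "cmod \<zeta> \<le> 1" for i z \<zeta>
    using a[OF that(1)] that(2,3) unfolding P_def by blast
  have dil: "(\<lambda>i. \<zeta> * z i) \<in> fun_ball d" if "z \<in> fun_ball d" "cmod \<zeta> \<le> 1" for z \<zeta>
  proof -
    have "cmod \<zeta> * fun_norm d z \<le> 1 * fun_norm d z" using that(2) by (intro mult_right_mono) auto
    then show ?thesis using that(1) by (simp add: fun_ball_iff fun_norm_scale)
  qed
  let ?K = "Poly_Mapping.keys p" and ?l = "Poly_Mapping.lookup"
  define deg where "deg m = (\<Sum>i<d. ?l m i)" for m :: "nat \<Rightarrow>\<^sub>0 nat"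
  define b where "b z k = (\<Sum>m\<in>?K. if deg m = k then ?l p m * (\<Prod>i<d. z i ^ ?l m i) else 0)" for z k
  define D where "D = Suc (\<Sum>m\<in>?K. deg m)"
  have D: "deg m < D" if "m \<in> ?K" for m
    unfolding D_def using member_le_sum[of m ?K deg] that by (simp add: le_imp_less_Suc)
  have b0: "b z k = 0" if "D \<le> k" for z k
    unfolding b_def using D that by (intro sum.neutral) fastforce
  have pb: "pe d p (\<lambda>i. \<zeta> * z i) = (\<Sum>k<D. b z k * \<zeta> ^ k)" for z \<zeta>
  proof -
    have "(\<Sum>k<D. b z k * \<zeta> ^ k) = (\<Sum>m\<in>?K. \<Sum>k<D. if deg m = k then ?l p m * (\<Prod>i<d. z i ^ ?l m i) * \<zeta> ^ k else 0)"
      unfolding b_def sum_distrib_right by (subst sum.swap) (intro sum.cong refl, simp)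
    also have "\<dots> = (\<Sum>m\<in>?K. ?l p m * (\<Prod>i<d. z i ^ ?l m i) * \<zeta> ^ deg m)"
      using D by (intro sum.cong refl) simp
    also have "\<dots> = pe d p (\<lambda>i. \<zeta> * z i)"
      unfolding pe_def deg_def power_mult_distrib prod.distrib power_sum by (simp add: mult_ac)
    finally show ?thesis ..
  qed
  \<comment> \<open>Comparison of the homogeneous components of both sides of $p = \sum_i z_i g_i$ on a slice.\<close>
  have comp: "b z (Suc k) = (\<Sum>i<d. z i * pe d (a i k) z)" and b00: "b z 0 = 0" if z: "z \<in> fun_ball d" for z k
  proof -
    define e where "e k = b z k - (case k of 0 \<Rightarrow> 0 | Suc j \<Rightarrow> (\<Sum>i<d. z i * pe d (a i j) z))" for k
    have e: "(\<lambda>k. e k * \<zeta> ^ k) sums 0" if \<zeta>: "cmod \<zeta> < 1" for \<zeta>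
    proof -
      have 1: "(\<lambda>k. b z k * \<zeta> ^ k) sums pe d p (\<lambda>i. \<zeta> * z i)"
        unfolding pb by (rule sums_finite) (use b0 in \<open>auto simp: not_less\<close>)
      have "(\<lambda>j. \<Sum>i<d. (\<zeta> * z i) * (pe d (a i j) z * \<zeta> ^ j)) sums (\<Sum>i<d. (\<zeta> * z i) * g i (Matrix.vec d (\<lambda>i. \<zeta> * z i)))"
        using z \<zeta> by (intro sums_sum sums_mult asums) auto
      also have "(\<Sum>i<d. (\<zeta> * z i) * g i (Matrix.vec d (\<lambda>i. \<zeta> * z i))) = pe d p (\<lambda>i. \<zeta> * z i)"
        using g(3)[of "Matrix.vec d (\<lambda>i. \<zeta> * z i)"] dil[OF z less_imp_le[OF \<zeta>]]
        by (simp add: vec_mem_unit_ball poly_eval_vec)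
      also have "(\<lambda>j. \<Sum>i<d. (\<zeta> * z i) * (pe d (a i j) z * \<zeta> ^ j))
         = (\<lambda>j. (case Suc j of 0 \<Rightarrow> 0 | Suc j \<Rightarrow> (\<Sum>i<d. z i * pe d (a i j) z)) * \<zeta> ^ Suc j)"
        by (rule ext) (simp add: sum_distrib_left sum_distrib_right mult_ac)
      finally have "(\<lambda>k. (case k of 0 \<Rightarrow> 0 | Suc j \<Rightarrow> (\<Sum>i<d. z i * pe d (a i j) z)) * \<zeta> ^ k) sums pe d p (\<lambda>i. \<zeta> * z i)"
        by (subst (asm) sums_Suc_iff) simp
      from sums_diff[OF 1 this] show ?thesis by (simp add: e_def left_diff_distrib)
    qed
    have "e k = 0" for k
      by (rule power_series_coeffs_zero[of e "\<lambda>_. 0" 0 "Suc k"]) (use e in auto)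
    from this[of "Suc k"] this[of 0] show "b z (Suc k) = (\<Sum>i<d. z i * pe d (a i k) z)" "b z 0 = 0"
      by (simp_all add: e_def)
  qed
  have "(\<lambda>L. T / (1 - r) * r ^ L) \<longlonglongrightarrow> T / (1 - r) * 0"
    using r by (intro tendsto_mult_left LIMSEQ_power_zero) simp
  then have "\<forall>\<^sub>F L in sequentially. T / (1 - r) * r ^ L < \<epsilon>"
    using \<epsilon> by (intro order_tendstoD(2)) auto
  then obtain L0 where L0: "\<And>L. L0 \<le> L \<Longrightarrow> T / (1 - r) * r ^ L < \<epsilon>"
    unfolding eventually_sequentially by blast
  define L where "L = max L0 D"
  \<comment> \<open>One factor $r$ belongs to the variable $z_i$ in front of $q_i$, hence the shifted exponent.\<close>
  define q where "q i = (\<Sum>k<L. cst (of_real (r ^ Suc k)) * a i k)" for i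
  have pe_q: "pe d (q i) z = of_real r * (\<Sum>k<L. pe d (a i k) z * of_real r ^ k)" for i z
    unfolding q_def pe_sum pe_mult pe_cst sum_distrib_left by (intro sum.cong refl) (simp add: mult_ac)
  show ?thesis
  proof (rule that[of q])
    fix i assume i: "i < d"
    show "q i \<in> polys d"
      unfolding q_def using a[OF i] unfolding P_def by (intro polys_sum polys_mult polys_cst) simp
    show "ball_bound d (q i) (c * S + \<epsilon>)"
      unfolding ball_bound_def
    proof
      fix z assume z: "z \<in> fun_ball d"
      let ?f = "\<lambda>k. pe d (a i k) z * of_real r ^ k"
      have s: "?f sums g i (Matrix.vec d (\<lambda>i. of_real r * z i))" using r by (intro asums i z) simp
      have rs: "(\<lambda>k. T * r ^ L * r ^ k) sums (T * r ^ L * (1 / (1 - r)))"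
        using r by (intro sums_mult geometric_sums) simp
      have tail: "cmod (suminf (\<lambda>k. ?f (k + L))) \<le> suminf (\<lambda>k. T * r ^ L * r ^ k)"
      proof (rule norm_suminf_le)
        show "cmod (?f (k + L)) \<le> T * r ^ L * r ^ k" for k
        proof -
          have "cmod (?f (k + L)) = cmod (pe d (a i (k + L)) z) * (r ^ L * r ^ k)"
            using r by (simp add: norm_mult norm_power power_add mult_ac)
          also have "\<dots> \<le> T * (r ^ L * r ^ k)" using r by (intro mult_right_mono aT i z) auto
          finally show ?thesis by (simp add: mult.assoc)
        qed
        show "summable (\<lambda>k. T * r ^ L * r ^ k)" using rs by (rule sums_summable)
      qed
      have "(\<Sum>k<L. ?f k) = g i (Matrix.vec d (\<lambda>i. of_real r * z i)) - (suminf (\<lambda>k. ?f (k + L)))"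
        using suminf_split_initial_segment[OF sums_summable[OF s], of L] sums_unique[OF s] by simp
      then have "cmod (\<Sum>k<L. ?f k) \<le> cmod (g i (Matrix.vec d (\<lambda>i. of_real r * z i))) + cmod (suminf (\<lambda>k. ?f (k + L)))"
        by (simp add: norm_triangle_ineq4)
      also have "\<dots> \<le> T + T / (1 - r) * r ^ L"
        using gT[OF i dil[OF z, of "of_real r"]] r tail sums_unique[OF rs] by simp
      also have "\<dots> \<le> T + \<epsilon>" using L0[of L] by (simp add: L_def)
      finally have "r * cmod (\<Sum>k<L. ?f k) \<le> 1 * (T + \<epsilon>)" using r by (intro mult_mono) auto
      then show "cmod (pe d (q i) z) \<le> c * S + \<epsilon>"
        unfolding pe_q norm_mult using r by (simp add: T_def)
    qed
  next
    fix z assume z: "z \<in> fun_ball d"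
    have "pe d p (\<lambda>i. of_real r * z i) = (\<Sum>k<D. b z k * of_real r ^ k)" by (rule pb)
    also have "\<dots> = (\<Sum>k<Suc L. b z k * of_real r ^ k)"
      using b0 by (intro sum.mono_neutral_left) (auto simp: L_def)
    also have "\<dots> = (\<Sum>k<L. (\<Sum>i<d. z i * pe d (a i k) z) * of_real r ^ Suc k)"
      unfolding sum.lessThan_Suc_shift by (simp add: comp[OF z] b00[OF z] del: power_Suc)
    also have "\<dots> = (\<Sum>i<d. \<Sum>k<L. z i * pe d (a i k) z * of_real r ^ Suc k)"
      unfolding sum_distrib_right by (rule sum.swap)
    also have "\<dots> = (\<Sum>i<d. z i * pe d (q i) z)"
      unfolding pe_q sum_distrib_left by (intro sum.cong refl) (simp add: mult_ac)
    finally show "pe d p (\<lambda>i. of_real r * z i) = (\<Sum>i<d. z i * pe d (q i) z)" .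
  qed
qed

section \<open>Induction on the dimension\<close>

lemma ev_eqI_ball:
  assumes "p \<in> polys d" "q \<in> polys d" "\<And>z. z \<in> fun_ball d \<Longrightarrow> pe d p z = pe d q z"
  shows "ev d A p x = ev d A q x"
proof -
  have "p - q = 0"
    using assms(3) by (intro polys_eq_zeroI[of _ d] polys_diff assms) (simp add: pe_diff)
  then show ?thesis by simp
qed

text \<open>
  Writing $h = h(0) + \sum_i z_i q_i$ gives $h(B)x = h(0)x + \sum_i q_i(B) B_i x$, and $B_i x$ lies in the
  smaller space $W$, where the constant $K$ is available for $q_i(B)$. The factor 2 comes from
  $\|h - h(0)\| \le 2\|h\|$ and $\sqrt d$ from Cauchy-Schwarz applied to $\sum_i \|B_i x\|$.
\<close>

lemma gleason_step:
  assumes C: "gleason_constant d c" "0 \<le> c" 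
    and B: "commuting B" "V.subspace Y" "invariant B Y" "col_contraction d n B Y"
    and W: "\<And>i y. i < d \<Longrightarrow> y \<in> Y \<Longrightarrow> B i y \<in> W"
    and K: "0 \<le> K" "\<And>q S y. q \<in> polys d \<Longrightarrow> ball_bound d q S \<Longrightarrow> y \<in> W \<Longrightarrow> nrm n (ev d B q y) \<le> K * S * nrm n y"
    and h: "h \<in> polys d" "ball_bound d h S" and x: "x \<in> Y"
  shows "nrm n (ev d B h x) \<le> (1 + 2 * c * sqrt (real d) * K) * S * nrm n x"
proof (rule dilation_limit[OF B(2) commuting_lin[OF B(1)] _ _ x])
  show "B i y \<in> Y" if "y \<in> Y" for i y using invariantD[OF B(3) that] .
  show "nrm n (B i y) \<le> nrm n y" if "i < d" "y \<in> Y" for i y using col_contraction_entry[OF B(4) that(2,1)] .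
  fix r :: real assume r: "0 < r" "r < 1"
  let ?rB = "\<lambda>i y. smul (of_real r) (B i y)"
  define h0 where "h0 = pe d h (\<lambda>_. 0)"
  define p where "p = h - cst h0"
  have h0: "cmod h0 \<le> S" unfolding h0_def by (rule ball_boundD[OF h(2) zero_in_fun_ball])
  have p: "p \<in> polys d" unfolding p_def by (intro polys_diff polys_cst h)
  have p0: "pe d p (\<lambda>_. 0) = 0" by (simp add: p_def pe_diff h0_def)
  have pS: "ball_bound d p (2 * S)"
    unfolding ball_bound_def
  proof
    fix z assume "z \<in> fun_ball d"
    then have "cmod (pe d h z) \<le> S" by (rule ball_boundD[OF h(2)])
    then show "cmod (pe d p z) \<le> 2 * S"
      using norm_triangle_ineq4[of "pe d h z" h0] h0 by (simp add: p_def pe_diff)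
  qed
  have main: "nrm n (ev d ?rB h x) \<le> S * nrm n x + K * (c * (2 * S) + \<epsilon>) * (sqrt (real d) * nrm n x)" 
    if \<epsilon>: "0 < \<epsilon>" for \<epsilon>
  proof -
    obtain q where q: "\<forall>i<d. q i \<in> polys d" "\<forall>i<d. ball_bound d (q i) (c * (2 * S) + \<epsilon>)"
      "\<forall>z\<in>fun_ball d. pe d p (\<lambda>i. of_real r * z i) = (\<Sum>i<d. z i * pe d (q i) z)"
    proof (rule gleason_polynomial[OF C p0 pS r \<epsilon>])
      fix q assume "\<And>i. i < d \<Longrightarrow> q i \<in> polys d" "\<And>i. i < d \<Longrightarrow> ball_bound d (q i) (c * (2 * S) + \<epsilon>)"
       "\<And>z. z \<in> fun_ball d \<Longrightarrow> pe d p (\<lambda>i. of_real r * z i) = (\<Sum>i<d. z i * pe d (q i) z)"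
      then show thesis by (intro that) auto
    qed
    define \<Phi> where "\<Phi> i = cst (of_real r) * var i" for i
    have "ev d B (psubst d \<Phi> p) x = ev d B (\<Sum>i<d. q i * var i) x"
    proof (rule ev_eqI_ball)
      show "psubst d \<Phi> p \<in> polys d" unfolding \<Phi>_def by (intro polys_psubst polys_mult polys_cst polys_var)
      show "(\<Sum>i<d. q i * var i) \<in> polys d" using q(1) by (intro polys_sum polys_mult polys_var) auto
      fix z assume z: "z \<in> fun_ball d"
      have "pe d (psubst d \<Phi> p) z = pe d p (\<lambda>i. of_real r * z i)"
        unfolding pe_psubst by (rule pe_cong) (simp add: \<Phi>_def pe_mult)
      also have "\<dots> = (\<Sum>i<d. z i * pe d (q i) z)" using q(3) z by blast
      also have "\<dots> = pe d (\<Sum>i<d. q i * var i) z"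
        unfolding pe_sum by (intro sum.cong refl) (simp add: pe_mult mult.commute)
      finally show "pe d (psubst d \<Phi> p) z = pe d (\<Sum>i<d. q i * var i) z" .
    qed
    moreover have "ev d B (psubst d \<Phi> p) x = ev d ?rB p x"
      unfolding ev_psubst[OF B(1)]
    proof (rule ev_cong_on[where Y = UNIV])
      show "ev d B (\<Phi> i) y = smul (of_real r) (B i y)" if "i < d" for i y
        using that by (simp add: \<Phi>_def ev_mult[OF B(1)] ev_cst ev_var)
    qed auto
    moreover have "ev d B (\<Sum>i<d. q i * var i) x = (\<Sum>i<d. ev d B (q i) (B i x))"
      unfolding ev_sum by (intro sum.cong refl) (simp add: ev_mult[OF B(1)] ev_var)
    ultimately have e1: "ev d ?rB p x = (\<Sum>i<d. ev d B (q i) (B i x))" by simp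
    have "h = cst h0 + p" by (simp add: p_def)
    then have "ev d ?rB h x = smul h0 x + (\<Sum>i<d. ev d B (q i) (B i x))"
      using ev_add[of d ?rB "cst h0" p x] by (simp only: ev_cst e1)
    then have "nrm n (ev d ?rB h x) \<le> cmod h0 * nrm n x + nrm n (\<Sum>i<d. ev d B (q i) (B i x))"
      using nrm_triangle[of n "smul h0 x"] by (simp only: nrm_smul)
    moreover have "cmod h0 * nrm n x \<le> S * nrm n x" using h0 by (intro mult_right_mono) auto
    moreover have "nrm n (\<Sum>i<d. ev d B (q i) (B i x)) \<le> K * (c * (2 * S) + \<epsilon>) * (sqrt (real d) * nrm n x)"
    proof -
      have "nrm n (\<Sum>i<d. ev d B (q i) (B i x)) \<le> (\<Sum>i<d. nrm n (ev d B (q i) (B i x)))" by (rule nrm_sum)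
      also have "\<dots> \<le> (\<Sum>i<d. K * (c * (2 * S) + \<epsilon>) * nrm n (B i x))"
        using q(1,2) W[OF _ x] by (intro sum_mono K(2)) auto
      also have "\<dots> = K * (c * (2 * S) + \<epsilon>) * (\<Sum>i<d. \<bar>1\<bar> * \<bar>nrm n (B i x)\<bar>)"
        by (simp add: sum_distrib_left)
      also have "\<dots> \<le> K * (c * (2 * S) + \<epsilon>) * (sqrt (real d) * nrm n x)"
      proof (rule mult_left_mono)
        have "(\<Sum>i<d. \<bar>1::real\<bar> * \<bar>nrm n (B i x)\<bar>) \<le> L2_set (\<lambda>_. 1) {..<d} * L2_set (\<lambda>i. nrm n (B i x)) {..<d}"
          by (rule L2_set_mult_ineq)
        also have "\<dots> \<le> sqrt (real d) * nrm n x"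
        proof (rule mult_mono)
          show "L2_set (\<lambda>i. nrm n (B i x)) {..<d} \<le> nrm n x"
            using col_contractionD[OF B(4) x] unfolding L2_set_def by (simp add: real_le_lsqrt)
        qed (simp_all add: L2_set_def sum_nonneg)
        finally show "(\<Sum>i<d. \<bar>1\<bar> * \<bar>nrm n (B i x)\<bar>) \<le> sqrt (real d) * nrm n x" .
        show "0 \<le> K * (c * (2 * S) + \<epsilon>)"
          using K(1) C(2) ball_bound_nonneg[OF h(2)] \<epsilon> by (intro mult_nonneg_nonneg add_nonneg_nonneg) auto
      qed
      finally show ?thesis .
    qed
    ultimately show ?thesis by linarith
  qed
  show "nrm n (ev d ?rB h x) \<le> (1 + 2 * c * sqrt (real d) * K) * S * nrm n x"
  proof (rule field_le_epsilon)
    fix \<delta> :: real assume \<delta>: "0 < \<delta>"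
    define M where "M = K * (sqrt (real d) * nrm n x)"
    have M: "0 \<le> M" using K(1) by (simp add: M_def)
    have "nrm n (ev d ?rB h x) \<le> S * nrm n x + K * (c * (2 * S) + \<delta> / (M + 1)) * (sqrt (real d) * nrm n x)"
      using \<delta> M by (intro main) simp
    also have "\<dots> = (1 + 2 * c * sqrt (real d) * K) * S * nrm n x + \<delta> * (M / (M + 1))"
      by (simp add: M_def algebra_simps)
    also have "\<delta> * (M / (M + 1)) \<le> \<delta> * 1" using \<delta> M by (intro mult_left_mono) (auto simp: divide_le_eq)
    finally show "nrm n (ev d ?rB h x) \<le> (1 + 2 * c * sqrt (real d) * K) * S * nrm n x + \<delta>" by simp
  qed
qed

text \<open>
  The step estimate only yields $K_m = 1 + M K_{m-1}$. Starting this recursion with 1 in dimension 2, and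
  not only in dimension 1, is what keeps $K_m$ below $M^{m-1}$.
\<close>

fun bound_const :: "real \<Rightarrow> nat \<Rightarrow> real" where
  "bound_const M m = (if m \<le> 2 then 1 else 1 + M * bound_const M (m - 1))"

declare bound_const.simps [simp del]

lemma bound_const_ge_1: "0 \<le> M \<Longrightarrow> 1 \<le> bound_const M m"
proof (induction m rule: less_induct)
  case (less m)
  show ?case
  proof (cases "m \<le> 2")
    case False
    then have "1 \<le> bound_const M (m - 1)" using less by simp
    then have "0 \<le> M * bound_const M (m - 1)" using less.prems by simp
    then show ?thesis using False by (simp add: bound_const.simps[of M m])
  qed (simp add: bound_const.simps)
qed

text \<open>
  The slack of 1 absorbs the additive term in the recursion; it is available from dimension 2 on because
  $M \ge 2$.
\<close>

lemma bound_const_le_power: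
  assumes M: "2 \<le> M" and m: "2 \<le> m"
  shows "bound_const M m \<le> M ^ (m - 1) - 1"
  using m
proof (induction m rule: dec_induct)
  case base
  then show ?case using M by (simp add: bound_const.simps)
next
  case (step m)
  have "bound_const M (Suc m) = 1 + M * bound_const M m" using step by (simp add: bound_const.simps[of M "Suc m"])
  also have "\<dots> \<le> 1 + M * (M ^ (m - 1) - 1)" using step M by (intro add_mono mult_left_mono) auto
  also have "\<dots> = M ^ m + 1 - M" using step by (simp add: right_diff_distrib power_eq_if[of M m])
  also have "\<dots> \<le> M ^ m - 1" using M by simp
  finally show ?case by simp
qed

lemma bound_const_mono_Suc: 
  assumes M: "2 \<le> M" shows "bound_const M m \<le> bound_const M (Suc m)"
proof (cases "m \<le> 2")
  case True
  then have "bound_const M m = 1" by (simp add: bound_const.simps)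
  then show ?thesis using bound_const_ge_1[of M "Suc m"] M by simp
next
  case False
  have k: "1 \<le> bound_const M m" using bound_const_ge_1[of M m] M by simp
  then have "1 * bound_const M m \<le> M * bound_const M m" using M by (intro mult_right_mono) auto
  then show ?thesis using False by (simp add: bound_const.simps[of M "Suc m"])
qed

lemma bound_const_mono: "2 \<le> M \<Longrightarrow> m \<le> m' \<Longrightarrow> bound_const M m \<le> bound_const M m'"
  using lift_Suc_mono_le[of "bound_const M" m m'] bound_const_mono_Suc by blast

lemma subspace_dim_0:
  assumes "fin_subspace W" "V.dim W = 0" shows "W = {0}"
proof -
  obtain B where "finite B" "W = V.span B" "card B = V.dim W" using fin_subspace_basis[OF assms(1)] by metis
  then show ?thesis using assms(2) by auto
qed

lemma subspace_dim_1:
  assumes "fin_subspace W" "V.dim W \<le> 1"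
  obtains w where "w \<in> W" "\<And>y. y \<in> W \<Longrightarrow> \<exists>a. y = smul a w"
proof -
  obtain B where B: "finite B" "B \<subseteq> W" "W = V.span B" "card B = V.dim W"
    using fin_subspace_basis[OF assms(1)] by metis
  show thesis
  proof (cases "B = {}")
    case True
    then show thesis using B V.subspace_0[OF fin_subspaceD[OF assms(1)]] by (intro that[of 0]) auto
  next
    case False
    then have "card B = 1" using B assms(2) by (metis One_nat_def Suc_leI card_gt_0_iff le_antisym)
    then obtain w where w: "B = {w}" by (rule card_1_singletonE)
    show thesis
    proof (rule that[of w])
      show "w \<in> W" using B w by auto
      show "\<exists>a. y = smul a w" if "y \<in> W" for y using that B w by (auto simp: V.span_singleton)
    qed
  qed
qed

text \<open>
  The operator $C = \sum_i \bar\lambda_i A_i$ acts on $Y/W$ as $|\lambda|^2$, so $C - |\lambda|^2$ is not onto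
  and, in finite dimension, not injective. An eigenvector together with $\|C\| \le |\lambda|$ gives
  $|\lambda|^2 \le |\lambda|$.
\<close>

lemma joint_eigenvalue_bound:
  assumes Y: "fin_subspace Y" "Y \<subseteq> supported n" and A: "commuting A" "invariant A Y" "col_contraction d n A Y"
    and W: "V.subspace W" "W \<subseteq> Y" "W \<noteq> Y" "\<And>i y. i < d \<Longrightarrow> y \<in> Y \<Longrightarrow> A i y - smul (lam i) y \<in> W"
  shows "(\<Sum>i<d. (cmod (lam i))\<^sup>2) \<le> 1"
proof -
  have sY: "V.subspace Y" using Y(1) by (rule fin_subspaceD)
  have lA: "lin (A i)" for i using A(1) by (rule commuting_lin)
  define \<Lambda> where "\<Lambda> = (\<Sum>i<d. (cmod (lam i))\<^sup>2)"
  have \<Lambda>: "0 \<le> \<Lambda>" by (simp add: \<Lambda>_def sum_nonneg)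
  have cl: "(\<Sum>i<d. cnj (lam i) * lam i) = of_real \<Lambda>"
    unfolding \<Lambda>_def of_real_sum by (intro sum.cong refl) (simp add: complex_norm_square mult.commute del: of_real_power)
  define C where "C y = (\<Sum>i<d. smul (cnj (lam i)) (A i y))" for y
  have lC: "lin C" unfolding C_def[abs_def] by (intro lin_Sum lin_scale lA)
  have CY: "C y \<in> Y" if "y \<in> Y" for y
    unfolding C_def by (intro V.subspace_sum[OF sY] subspace_smul[OF sY] invariantD[OF A(2)] that)
  have CW: "C y - smul (of_real \<Lambda>) y \<in> W" if y: "y \<in> Y" for y
  proof -
    have "C y - smul (of_real \<Lambda>) y = (\<Sum>i<d. smul (cnj (lam i)) (A i y - smul (lam i) y))"
      by (simp add: C_def V.scale_right_diff_distrib sum_subtractf flip: cl V.scale_sum_left)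
    also have "\<dots> \<in> W" using y by (intro V.subspace_sum[OF W(1)] subspace_smul[OF W(1)] W(4)) auto
    finally show ?thesis .
  qed
  have "\<exists>y\<in>Y. C y = smul (of_real \<Lambda>) y \<and> y \<noteq> 0"
  proof (rule ccontr)
    assume "\<not> ?thesis"
    then have inj: "\<And>y. y \<in> Y \<Longrightarrow> C y = smul (of_real \<Lambda>) y \<Longrightarrow> y = 0" by blast
    show False
    proof (rule inverse_is_poly[OF Y(1) lC CY inj])
      fix h assume h: "\<And>y. y \<in> Y \<Longrightarrow> C (poly_op h C y) - smul (of_real \<Lambda>) (poly_op h C y) = y"
      have "Y \<subseteq> W"
      proof
        fix y assume y: "y \<in> Y"
        have "C (poly_op h C y) - smul (of_real \<Lambda>) (poly_op h C y) \<in> W"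
          by (intro CW poly_op_invariant[OF lC sY CY y])
        then show "y \<in> W" using h[OF y] by simp
      qed
      then show False using W(2,3) by blast
    qed
  qed
  then obtain y where y: "y \<in> Y" "C y = smul (of_real \<Lambda>) y" "y \<noteq> 0" by blast
  have "nrm n y \<noteq> 0" using nrm_eq_zero[of y n] y Y(2) by blast
  then have pos: "0 < nrm n y" using nrm_nonneg[of n y] by linarith
  have "nrm n (C y) \<le> sqrt \<Lambda> * nrm n y"
    using col_contraction_comb[OF A(3) y(1), of "\<lambda>i. cnj (lam i)"] by (simp add: C_def \<Lambda>_def)
  then have "\<Lambda> \<le> sqrt \<Lambda>" using pos \<Lambda> by (simp add: y(2) nrm_smul)
  then have "sqrt \<Lambda> * sqrt \<Lambda> \<le> sqrt \<Lambda> * 1" using \<Lambda> by simp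
  then have "\<Lambda> = 0 \<or> sqrt \<Lambda> \<le> 1" using \<Lambda> by (metis mult_le_cancel_left_pos real_sqrt_gt_0_iff order_le_less)
  then show ?thesis using \<Lambda> by (auto simp: \<Lambda>_def[symmetric])
qed

text \<open>
  Induction on the dimension of the invariant subspace. A joint eigenvalue $\lambda$ modulo a proper
  invariant subspace $W$ lies in the closed ball, and after a dilation in the open ball. The automorphism
  $\varphi_\lambda$ moves it to the origin, and then either the case of a one-dimensional range or the
  Gleason step applies.
\<close>

theorem von_neumann_subspace:
  assumes C: "gleason_constant d c" "0 \<le> c" and d: "d \<ge> 1" and M: "M = 2 * c * sqrt (real d)" "2 \<le> M"
    and Y: "fin_subspace Y" "Y \<subseteq> supported n" and A: "commuting A" "invariant A Y" "col_contraction d n A Y"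
    and p: "p \<in> polys d" "ball_bound d p S" and x: "x \<in> Y"
  shows "nrm n (ev d A p x) \<le> bound_const M (V.dim Y) * S * nrm n x"
  using Y A p x
proof (induction "V.dim Y" arbitrary: Y A p S x rule: less_induct)
  case less
  have sY: "V.subspace Y" using less.prems(1) by (rule fin_subspaceD)
  show ?case
  proof (cases "Y = {0}")
    case True
    then have "x = 0" using less.prems by blast
    then have "ev d A p x = 0" by (simp add: lin_zero[OF lin_ev[OF less.prems(3)]])
    then show ?thesis using \<open>x = 0\<close> by simp
  next
    case False
    then have Y0: "{0} \<noteq> Y" "{0} \<subseteq> Y" using V.subspace_0[OF sY] by auto
    have inv0: "invariant A {0}" by (simp add: invariant_def lin_zero[OF commuting_lin[OF less.prems(3)]])
    obtain lam W where W: "V.subspace W" "W \<subseteq> Y" "W \<noteq> Y" "invariant A W"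
      and lam: "\<forall>i<d. \<forall>y\<in>Y. A i y - smul (lam i) y \<in> W"
    proof (rule ex_joint_coeigenvalue[OF less.prems(1,3,4) V.subspace_single_0 Y0(2,1) inv0, of d])
      fix W lam assume "V.subspace W" "W \<subseteq> Y" "W \<noteq> Y" "invariant A W"
        "\<And>i y. i < d \<Longrightarrow> y \<in> Y \<Longrightarrow> A i y - smul (lam i) y \<in> W"
      then show thesis by (intro that) auto
    qed
    have finW: "fin_subspace W" by (rule fin_subspace_mono[OF less.prems(1) W(1,2)])
    have dW: "V.dim W < V.dim Y" by (rule dim_less[OF less.prems(1) W(1,2,3)])
    define K where "K = bound_const M (V.dim Y)"
    have base: "nrm n (ev d B h u) \<le> K * T * nrm n u"
      if B: "commuting B" "invariant B Y" "invariant B W" "col_contraction d n B Y"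
        and BW: "\<And>i y. i < d \<Longrightarrow> y \<in> Y \<Longrightarrow> B i y \<in> W" and h: "h \<in> polys d" "ball_bound d h T" and u: "u \<in> Y" for B h T u
    proof (cases "V.dim Y \<le> 2")
      case True
      then have "V.dim W \<le> 1" using dW by simp
      then obtain w where w: "w \<in> W" "\<forall>y\<in>W. \<exists>a. y = smul a w"
        using subspace_dim_1[OF finW] by metis
      have "nrm n (ev d B h u) \<le> T * nrm n u"
        by (rule rank_one_bound[OF d sY less.prems(2) B(1,2,4) _ _ h(2) u, of w]) (use w W(2) BW in blast)+
      then show ?thesis using True by (simp add: K_def bound_const.simps)
    next
      case False
      have "col_contraction d n B W" using B(4) W(2) unfolding col_contraction_def by blast
      then have IH: "nrm n (ev d B q y) \<le> bound_const M (V.dim W) * T' * nrm n y"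
        if "q \<in> polys d" "ball_bound d q T'" "y \<in> W" for q T' y
        using less.hyps[OF dW finW _ B(1,3) _ that] W(2) less.prems(2) by blast
      have K0: "0 \<le> bound_const M (V.dim W)" using bound_const_ge_1[of M "V.dim W"] M(2) by simp
      have "nrm n (ev d B h u) \<le> (1 + 2 * c * sqrt (real d) * bound_const M (V.dim W)) * T * nrm n u"
        by (rule gleason_step[OF C B(1) sY B(2,4) BW K0 IH h u])
      also have "\<dots> \<le> K * T * nrm n u"
      proof -
        have "1 + 2 * c * sqrt (real d) * bound_const M (V.dim W) \<le> 1 + M * bound_const M (V.dim Y - 1)"
          unfolding M(1)[symmetric] using M(2) dW by (intro add_mono mult_left_mono bound_const_mono) auto
        also have "\<dots> = K" using False by (simp add: K_def bound_const.simps[of M "V.dim Y"])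
        finally show ?thesis using ball_bound_nonneg[OF h(2)] by (intro mult_right_mono) auto
      qed
      finally show ?thesis .
    qed
    show ?thesis
      unfolding K_def[symmetric]
    proof (rule dilation_limit[OF sY commuting_lin[OF less.prems(3)] _ _ less.prems(8)])
      show "A i y \<in> Y" if "y \<in> Y" for i y using invariantD[OF less.prems(4) that] .
      show "nrm n (A i y) \<le> nrm n y" if "i < d" "y \<in> Y" for i y
        using col_contraction_entry[OF less.prems(5) that(2,1)] .
      fix r :: real assume r: "0 < r" "r < 1"
      let ?A = "\<lambda>i y. smul (of_real r) (A i y)" and ?lam = "\<lambda>i. of_real r * lam i"
      have lA: "lin (A i)" for i using less.prems(3) by (rule commuting_lin)
      have cA: "commuting ?A"
        unfolding commuting_def
      proof (intro conjI allI)
        fix i j y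
        show "lin (?A i)" by (rule lin_scale[OF lA])
        show "?A i (?A j y) = ?A j (?A i y)"
          by (simp only: lin_smul[OF lA] commuting_commute[OF less.prems(3), of i j])
      qed
      have inv: "invariant ?A Z" if "V.subspace Z" "invariant A Z" for Z
        unfolding invariant_def by (intro allI ballI subspace_smul[OF that(1)] invariantD[OF that(2)])
      have contr: "col_contraction d n ?A Y"
        unfolding col_contraction_def
      proof
        fix y assume y: "y \<in> Y"
        have "(\<Sum>i<d. (nrm n (?A i y))\<^sup>2) = r\<^sup>2 * (\<Sum>i<d. (nrm n (A i y))\<^sup>2)"
          by (simp add: nrm_smul power_mult_distrib sum_distrib_left)
        also have "\<dots> \<le> 1 * (nrm n y)\<^sup>2"
          using r col_contractionD[OF less.prems(5) y] power2_less_one[of r] 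
          by (intro mult_mono) (auto simp: sum_nonneg)
        finally show "(\<Sum>i<d. (nrm n (?A i y))\<^sup>2) \<le> (nrm n y)\<^sup>2" by simp
      qed
      have "(\<Sum>i<d. (cmod (lam i))\<^sup>2) \<le> 1"
        by (rule joint_eigenvalue_bound[OF less.prems(1-5) W(1-3)]) (use lam in blast)
      then have "r\<^sup>2 * (\<Sum>i<d. (cmod (lam i))\<^sup>2) \<le> r\<^sup>2 * 1" by (intro mult_left_mono) auto
      also have "\<dots> < 1" using power2_less_one[of r] r by simp
      also have "r\<^sup>2 * (\<Sum>i<d. (cmod (lam i))\<^sup>2) = (\<Sum>i<d. (cmod (?lam i))\<^sup>2)"
        by (simp add: norm_mult power_mult_distrib sum_distrib_left)
      finally have l1: "(\<Sum>i<d. (cmod (?lam i))\<^sup>2) < 1" .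
      have lW: "?A i y - smul (?lam i) y \<in> W" if "i < d" "y \<in> Y" for i y
      proof -
        have "?A i y - smul (?lam i) y = smul (of_real r) (A i y - smul (lam i) y)"
          by (simp add: V.scale_right_diff_distrib)
        also have "\<dots> \<in> W" using lam that by (intro subspace_smul[OF W(1)]) blast
        finally show ?thesis .
      qed
      show "nrm n (ev d ?A p x) \<le> K * S * nrm n x"
        by (rule moebius_transfer[OF less.prems(1,2) cA inv[OF sY less.prems(4)] contr W(1) inv[OF W(1,4)] W(2)
              lW l1 base less.prems(6,7,8)])
    qed
  qed
qed

text \<open>
  The function $z_0$ forces its own coefficient to be 1 on the first coordinate axis.
\<close>

lemma gleason_constant_ge_1:
  assumes C: "gleason_constant d c" and c: "0 \<le> c" and d: "d \<ge> 1"
  shows "1 \<le> c"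
proof -
  let ?f = "poly_eval d (var 0)"
  have f: "?f z = vec_index z 0" for z using d by (simp add: poly_eval_pe)
  have f0: "?f (0\<^sub>v d) = 0" using d by (simp add: f)
  obtain g where g0: "\<forall>i<d. g i \<in> H_inf d \<and> sup_norm d (g i) \<le> c * sup_norm d ?f"
    "\<forall>z\<in>unit_ball d. ?f z = (\<Sum>i<d. vec_index z i * g i z)"
    by (rule gleason_constantD[OF C poly_eval_H_inf f0])
  have fs: "sup_norm d ?f \<le> 1"
  proof (rule sup_norm_le)
    fix z assume "z \<in> unit_ball d"
    then have "fun_norm d (\<lambda>i. vec_index z i) < 1" using unit_ball_fun_ball by (simp add: fun_ball_iff)
    then show "cmod (?f z) \<le> 1" using fun_norm_entry[of 0 d "\<lambda>i. vec_index z i"] d by (simp add: f)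
  qed
  \<comment> \<open>A nonzero point of the first coordinate axis inside the ball.\<close>
  define z where "z = Matrix.vec d (\<lambda>i. if i = 0 then (1/2::complex) else 0)"
  have "fun_norm d (\<lambda>i. if i = 0 then (1/2::complex) else 0) = 1/2"
  proof -
    have "(\<Sum>i<d. (cmod (if i = 0 then (1/2::complex) else 0))\<^sup>2) = (\<Sum>i<d. if i = 0 then 1/4 else 0 :: real)"
      by (intro sum.cong) (auto simp: power2_eq_square)
    also have "\<dots> = (1/2)\<^sup>2" using d by (simp add: power2_eq_square)
    finally show ?thesis unfolding fun_norm_def L2_set_def by (simp add: real_sqrt_unique)
  qed
  then have z: "z \<in> unit_ball d" by (simp add: z_def vec_mem_unit_ball fun_ball_iff)
  have "?f z = (\<Sum>i<d. vec_index z i * g i z)" using g0(2) z by blast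
  also have "\<dots> = (\<Sum>i<d. if i = 0 then 1/2 * g 0 z else 0)"
    by (intro sum.cong) (auto simp: z_def)
  also have "\<dots> = 1/2 * g 0 z" using d by simp
  finally have "g 0 z = 1" using d by (simp add: f z_def)
  then have "1 \<le> sup_norm d (g 0)" using sup_norm_ge[of "g 0" d z] g0(1) d z by simp
  also have "\<dots> \<le> c * sup_norm d ?f" using g0(1) d by simp
  also have "\<dots> \<le> c * 1" using fs c by (rule mult_left_mono)
  finally show ?thesis by simp
qed

section \<open>The dimension of a commuting family of operators\<close>

lemma direct_sum_dim_le:
  assumes Y: "fin_subspace Y" and sub: "V.subspace Y1" "V.subspace Y2" "Y1 \<subseteq> Y" "Y2 \<subseteq> Y" and int: "Y1 \<inter> Y2 \<subseteq> {0}"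
  shows "V.dim Y1 + V.dim Y2 \<le> V.dim Y"
proof -
  obtain B1 where B1: "finite B1" "B1 \<subseteq> Y1" "V.independent B1" "Y1 = V.span B1" "card B1 = V.dim Y1"
    by (rule fin_subspace_basis[OF fin_subspace_mono[OF Y sub(1,3)]])
  obtain B2 where B2: "finite B2" "B2 \<subseteq> Y2" "V.independent B2" "Y2 = V.span B2" "card B2 = V.dim Y2"
    by (rule fin_subspace_basis[OF fin_subspace_mono[OF Y sub(2,4)]])
  have disj: "B1 \<inter> B2 = {}"
    using int B1(2,3) B2(2) V.dependent_zero[of B1] by blast
  have "V.independent (B1 \<union> B2)"
  proof (rule V.independent_if_scalars_zero)
    show "finite (B1 \<union> B2)" using B1 B2 by simp
    fix f x assume z: "(\<Sum>x\<in>B1 \<union> B2. smul (f x) x) = 0" and x: "x \<in> B1 \<union> B2"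
    define s1 where "s1 = (\<Sum>x\<in>B1. smul (f x) x)"
    define s2 where "s2 = (\<Sum>x\<in>B2. smul (f x) x)"
    have "s1 + s2 = 0" using z B1(1) B2(1) disj by (simp add: s1_def s2_def sum.union_disjoint)
    have s1: "s1 \<in> Y1" unfolding s1_def using B1(2) by (intro V.subspace_sum[OF sub(1)] subspace_smul[OF sub(1)]) auto
    have s2: "s2 \<in> Y2" unfolding s2_def using B2(2) by (intro V.subspace_sum[OF sub(2)] subspace_smul[OF sub(2)]) auto
    have "s1 = - s2" using \<open>s1 + s2 = 0\<close> by (simp add: eq_neg_iff_add_eq_0)
    then have "s1 \<in> Y2" using V.subspace_neg[OF sub(2) s2] by simp
    then have "s1 = 0" using s1 int by blast
    then have "s2 = 0" using \<open>s1 + s2 = 0\<close> by simp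
    have "f x = 0" if "x \<in> B1" for x
      using V.independentD[OF B1(3,1) order_refl _ that, of f] \<open>s1 = 0\<close> by (simp add: s1_def)
    moreover have "f x = 0" if "x \<in> B2" for x
      using V.independentD[OF B2(3,1) order_refl _ that, of f] \<open>s2 = 0\<close> by (simp add: s2_def)
    ultimately show "f x = 0" using x by blast
  qed
  moreover have "B1 \<union> B2 \<subseteq> Y" using B1(2) B2(2) sub by blast
  ultimately have "card (B1 \<union> B2) \<le> V.dim Y" using independent_card_le_dim[OF Y] by blast
  then show ?thesis using card_Un_disjoint[OF B1(1) B2(1) disj] B1(5) B2(5) by simp
qed

lemma lin_image_subspace:
  assumes "lin T" "V.subspace Y" shows "V.subspace (T ` Y)"
proof (rule V.subspaceI)
  show "0 \<in> T ` Y" using lin_zero[OF assms(1)] V.subspace_0[OF assms(2)] by (metis imageI)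
  show "x + y \<in> T ` Y" if "x \<in> T ` Y" "y \<in> T ` Y" for x y
    using that lin_add[OF assms(1), symmetric] V.subspace_add[OF assms(2)] by auto
  show "smul c x \<in> T ` Y" if "x \<in> T ` Y" for c x
    using that lin_smul[OF assms(1), symmetric] subspace_smul[OF assms(2)] by auto
qed

text \<open>
  Contrapositive of the division argument: when $q(\mu) \neq 0$, the operator minus $\mu$ is onto.
\<close>

lemma annihilator_root:
  assumes Y: "V.subspace Y" and A: "lin A" "\<And>y. y \<in> Y \<Longrightarrow> A y \<in> Y"
    and q: "\<And>y. y \<in> Y \<Longrightarrow> poly_op q A y = 0" and z: "z \<in> Y" "\<And>y. y \<in> Y \<Longrightarrow> z \<noteq> A y - smul \<mu> y"
  shows "poly q \<mu> = 0"
proof (rule ccontr)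
  assume nz: "poly q \<mu> \<noteq> 0"
  define c where "c = poly q \<mu>"
  have "poly (q - [:c:]) \<mu> = 0" by (simp add: c_def)
  then obtain r where r: "q - [:c:] = [:-\<mu>, 1:] * r" by (metis poly_eq_0_iff_dvd dvdE)
  define y where "y = smul (-1/c) (poly_op r A z)"
  have "q = [:-\<mu>, 1:] * r + [:c:]" using r by (metis diff_add_cancel)
  then have "poly_op q A z = (smul (-\<mu>) (poly_op r A z) + A (poly_op r A z)) + smul c z"
    by (simp only: poly_op_add[OF A(1)] poly_op_mult[OF A(1)] poly_op_linear[OF A(1)] poly_op_const[OF A(1)])
  then have 0: "(smul (-\<mu>) (poly_op r A z) + A (poly_op r A z)) + smul c z = 0" using q[OF z(1)] by simp
  have "A y - smul \<mu> y = smul (-1/c) (smul (-\<mu>) (poly_op r A z) + A (poly_op r A z))"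
    unfolding y_def lin_smul[OF A(1)] by (intro cvec_eqI) (simp add: lookup_minus lookup_add algebra_simps)
  also have "smul (-\<mu>) (poly_op r A z) + A (poly_op r A z) = smul (- c) z"
    using 0 by (simp add: eq_neg_iff_add_eq_0)
  also have "smul (-1/c) (smul (- c) z) = z" using nz by (simp add: c_def)
  finally have "z = A y - smul \<mu> y" ..
  moreover have "y \<in> Y" unfolding y_def by (intro subspace_smul[OF Y] poly_op_invariant[OF A(1) Y A(2)] z(1))
  ultimately show False using z(2) by blast
qed

text \<open>
  The polynomial $1 - q/q(a)$ vanishes at $a$. Its $k$-th power is divisible by $(X-a)^k$ and is congruent
  to 1 modulo $q$.
\<close>

lemma bezout_linear_power:
  fixes q :: "complex poly"
  assumes "poly q a \<noteq> 0"
  obtains u v where "u * [:-a, 1:] ^ k + v * q = 1"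
proof -
  define c where "c = 1 / poly q a"
  define x where "x = 1 - smult c q"
  have "poly x a = 0" using assms by (simp add: x_def c_def)
  then obtain g where g: "x = [:-a, 1:] * g" by (metis poly_eq_0_iff_dvd dvdE)
  have "1 - x ^ k = (1 - x) * (\<Sum>i<k. x ^ i)" by (rule one_diff_power_eq)
  also have "1 - x = smult c q" by (simp add: x_def)
  finally have "x ^ k + smult c q * (\<Sum>i<k. x ^ i) = 1" by (simp add: algebra_simps)
  moreover have "x ^ k = g ^ k * [:-a, 1:] ^ k" by (simp only: g power_mult_distrib mult.commute)
  moreover have "smult c q * (\<Sum>i<k. x ^ i) = smult c (\<Sum>i<k. x ^ i) * q"
    by (simp add: mult.commute)
  ultimately have "g ^ k * [:-a, 1:] ^ k + smult c (\<Sum>i<k. x ^ i) * q = 1" by simp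
  then show ?thesis by (rule that)
qed

lemma quarter_square: "r * s \<le> (r + s)\<^sup>2 div (4::nat)"
proof -
  have "int (4 * (r * s)) \<le> int ((r + s)\<^sup>2)"
    using zero_le_power2[of "int r - int s"] by (simp add: power2_eq_square algebra_simps)
  then have "4 * (r * s) \<le> (r + s)\<^sup>2" by linarith
  then show ?thesis by simp
qed

text \<open>
  The case $a = b = 1$ is the one in which rounding down matters.
\<close>

lemma quarter_square_add:
  fixes a b :: nat
  assumes "1 \<le> a" "1 \<le> b" "a + b \<le> m"
  shows "(a\<^sup>2 div 4 + 1) + (b\<^sup>2 div 4 + 1) \<le> m\<^sup>2 div 4 + 1"
proof -
  have "a\<^sup>2 div 4 + b\<^sup>2 div 4 + 1 \<le> (a + b)\<^sup>2 div 4"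
  proof (cases "a = 1 \<and> b = 1")
    case False
    then have "2 \<le> a \<or> 2 \<le> b" using assms by auto
    then have "2 \<le> a * b"
      using mult_le_mono[of 2 a 1 b] mult_le_mono[of 1 a 2 b] assms by auto
    then have "a\<^sup>2 + b\<^sup>2 + 4 \<le> (a + b)\<^sup>2" by (simp add: power2_sum)
    then show ?thesis by linarith
  qed (simp add: power2_eq_square)
  also have "\<dots> \<le> m\<^sup>2 div 4" using assms(3) by (intro div_le_mono power_mono) auto
  finally show ?thesis by simp
qed

text \<open>
  A combination $\sum_i a_i A_i$ vanishes on $Y$ as soon as all functionals in $\Phi$ vanish at $a$. So
  \<open>card \<Phi>\<close> bounds the dimension of the span of the $A_i$ on $Y$, without introducing a vector space of
  operators.
\<close>

definition determined_by :: "nat \<Rightarrow> (nat \<Rightarrow> cvec \<Rightarrow> cvec) \<Rightarrow> cvec set \<Rightarrow> (nat \<Rightarrow> complex) set \<Rightarrow> bool" where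
  "determined_by d A Y \<Phi> \<longleftrightarrow> (\<forall>a. (\<forall>\<phi>\<in>\<Phi>. (\<Sum>i<d. a i * \<phi> i) = 0) \<longrightarrow> (\<forall>y\<in>Y. (\<Sum>i<d. smul (a i) (A i y)) = 0))"

text \<open>
  When every $A_i$ has a single eigenvalue $\lambda_i$, the space $Y$ is generated as a module by a basis
  $R$ of a complement of $W = \sum_i (A_i - \lambda_i)Y$. A combination $\sum_i a_i A_i$ is therefore
  determined by the scalar $\sum_i a_i \lambda_i$ and by the values of $\sum_i a_i (A_i - \lambda_i)$ on $R$,
  which lie in $W$: altogether $1 + r(m - r)$ parameters, where $m$ is the dimension of $Y$ and $r$ the
  number of elements of $R$. That $R$ generates is seen by applying the existence of a joint eigenvalue to
  the kernel of the combination.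
\<close>

lemma determined_local:
  assumes Y: "fin_subspace Y" and A: "commuting A" "invariant A Y"
    and W: "V.subspace W" "W \<subseteq> Y" "W \<noteq> Y" "invariant A W"
    and lam: "\<And>i y. i < d \<Longrightarrow> y \<in> Y \<Longrightarrow> A i y - smul (lam i) y \<in> W"
    and min: "\<And>W'. V.subspace W' \<Longrightarrow> (\<And>i y. i < d \<Longrightarrow> y \<in> Y \<Longrightarrow> A i y - smul (lam i) y \<in> W') \<Longrightarrow> W \<subseteq> W'"
    and uniq: "\<And>i \<mu> z. i < d \<Longrightarrow> z \<in> Y \<Longrightarrow> (\<And>y. y \<in> Y \<Longrightarrow> z \<noteq> A i y - smul \<mu> y) \<Longrightarrow> \<mu> = lam i"
  shows "\<exists>\<Phi>. finite \<Phi> \<and> card \<Phi> \<le> (V.dim Y)\<^sup>2 div 4 + 1 \<and> determined_by d A Y \<Phi>"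
proof -
  have sY: "V.subspace Y" using Y by (rule fin_subspaceD)
  have lA: "lin (A i)" for i using A(1) by (rule commuting_lin)
  obtain D where D: "finite D" "D \<subseteq> W" "V.independent D" "W = V.span D" "card D = V.dim W"
    by (rule fin_subspace_basis[OF fin_subspace_mono[OF Y W(1,2)]])
  have "D \<subseteq> Y" using D(2) W(2) by blast
  then obtain B where B: "D \<subseteq> B" "finite B" "B \<subseteq> Y" "V.independent B" "Y = V.span B" "card B = V.dim Y"
    using fin_subspace_basis_extend[OF Y _ D(3)] by metis
  define R where "R = B - D"
  have fR: "finite R" using B(2) by (simp add: R_def)
  have cRD: "card R + card D = V.dim Y"
    using B(1,2,6) D(1) card_mono[OF B(2,1)] by (simp add: R_def card_Diff_subset)
  define coef where "coef v b i = V.representation D (A i v - smul (lam i) v) b" for v b i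
  define \<Phi> where "\<Phi> = insert lam ((\<lambda>(v, b). coef v b) ` (R \<times> D))"
  have "finite \<Phi>" unfolding \<Phi>_def using fR D(1) by simp
  moreover have "card \<Phi> \<le> (V.dim Y)\<^sup>2 div 4 + 1"
  proof -
    have "card \<Phi> \<le> Suc (card ((\<lambda>(v, b). coef v b) ` (R \<times> D)))"
      unfolding \<Phi>_def by (rule card_insert_le_m1) auto
    also have "card ((\<lambda>(v, b). coef v b) ` (R \<times> D)) \<le> card (R \<times> D)"
      using fR D(1) by (intro card_image_le) simp
    also have "card (R \<times> D) = card R * card D" by (rule card_cartesian_product)
    also have "\<dots> \<le> (V.dim Y)\<^sup>2 div 4" unfolding cRD[symmetric] by (rule quarter_square)
    finally show ?thesis by simp
  qed
  moreover have "determined_by d A Y \<Phi>"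
    unfolding determined_by_def
  proof (intro allI impI)
    fix a assume a: "\<forall>\<phi>\<in>\<Phi>. (\<Sum>i<d. a i * \<phi> i) = 0"
    define T where "T y = (\<Sum>i<d. smul (a i) (A i y))" for y
    have lT: "lin T" unfolding T_def[abs_def] by (intro lin_Sum lin_scale lA)
    have TA: "T (A i y) = A i (T y)" for i y
      unfolding T_def lin_sum[OF lA] lin_smul[OF lA] by (intro sum.cong refl) (simp only: commuting_commute[OF A(1), of _ i])
    have TR: "T v = 0" if v: "v \<in> R" for v
    proof -
      have vY: "v \<in> Y" using v B(3) by (auto simp: R_def)
      have a0: "(\<Sum>i<d. a i * lam i) = 0" using a by (simp add: \<Phi>_def)
      have ab: "(\<Sum>i<d. a i * coef v b i) = 0" if "b \<in> D" for b
      proof -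
        have "coef v b \<in> \<Phi>" unfolding \<Phi>_def using v that by (intro insertI2 image_eqI[of _ _ "(v, b)"]) auto
        then show ?thesis using a by blast
      qed
      have "T v = (\<Sum>i<d. smul (a i) (A i v - smul (lam i) v)) + smul (\<Sum>i<d. a i * lam i) v"
        by (simp add: T_def V.scale_right_diff_distrib sum_subtractf V.scale_sum_left)
      also have "\<dots> = (\<Sum>i<d. smul (a i) (A i v - smul (lam i) v))" unfolding a0 by simp
      also have "\<dots> = (\<Sum>i<d. \<Sum>b\<in>D. smul (a i * coef v b i) b)"
      proof (rule sum.cong[OF refl])
        fix i assume "i \<in> {..<d}"
        then have "A i v - smul (lam i) v \<in> V.span D" using lam[OF _ vY] D(4) by auto
        then have "(\<Sum>b\<in>D. smul (coef v b i) b) = A i v - smul (lam i) v"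
          unfolding coef_def by (rule V.sum_representation_eq[OF D(3) _ D(1) order_refl])
        then show "smul (a i) (A i v - smul (lam i) v) = (\<Sum>b\<in>D. smul (a i * coef v b i) b)"
          by (simp only: V.scale_sum_right V.scale_scale flip: \<open>(\<Sum>b\<in>D. smul (coef v b i) b) = A i v - smul (lam i) v\<close>)
      qed
      also have "\<dots> = (\<Sum>b\<in>D. smul (\<Sum>i<d. a i * coef v b i) b)"
        unfolding V.scale_sum_left by (rule sum.swap)
      also have "\<dots> = 0" using ab by simp
      finally show ?thesis .
    qed
    define U where "U = {y \<in> Y. T y = 0}"
    have sU: "V.subspace U"
      unfolding U_def using sY 
      by (intro V.subspaceI) (simp_all add: V.subspace_0 V.subspace_add subspace_smul lin_zero[OF lT] lin_add[OF lT] lin_smul[OF lT])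
    have iU: "invariant A U"
      unfolding invariant_def U_def using invariantD[OF A(2)] by (simp add: TA lin_zero[OF lA])
    have "U = Y"
    proof (rule ccontr)
      assume ne: "U \<noteq> Y"
      have UY: "U \<subseteq> Y" by (auto simp: U_def)
      show False
      proof (rule ex_joint_coeigenvalue[OF Y A sU UY ne iU, of d])
        fix W' lam' assume W': "V.subspace W'" "U \<subseteq> W'" "W' \<subseteq> Y" "W' \<noteq> Y"
          and lam': "\<And>i y. i < d \<Longrightarrow> y \<in> Y \<Longrightarrow> A i y - smul (lam' i) y \<in> W'"
        obtain z where z: "z \<in> Y" "z \<notin> W'" using W' by blast
        have eq: "lam' i = lam i" if "i < d" for i
        proof (rule uniq[OF that z(1)])
          show "z \<noteq> A i y - smul (lam' i) y" if y: "y \<in> Y" for y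
            using lam'[OF \<open>i < d\<close> y] z(2) by auto
        qed
        have "W \<subseteq> W'"
        proof (rule min[OF W'(1)])
          show "A i y - smul (lam i) y \<in> W'" if "i < d" "y \<in> Y" for i y
            using lam'[OF that] eq[OF that(1)] by simp
        qed
        moreover have "R \<subseteq> U" using TR B(3) by (auto simp: U_def R_def)
        ultimately have "B \<subseteq> W'" using D(2) W'(2) by (auto simp: R_def)
        then have "Y \<subseteq> W'" unfolding B(5) by (rule V.span_minimal[OF _ W'(1)])
        then show False using W' by blast
      qed
    qed
    then show "\<forall>y\<in>Y. (\<Sum>i<d. smul (a i) (A i y)) = 0" unfolding U_def T_def by blast
  qed
  ultimately show ?thesis by blast
qed

text \<open>
  Fitting's decomposition: an annihilating polynomial is split into a power of $X - \mu$ and a coprime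
  factor, and $Y$ is the direct sum of the ranges of the two factors.
\<close>

lemma fitting_split:
  assumes Y: "fin_subspace Y" and A: "lin A" "\<And>y. y \<in> Y \<Longrightarrow> A y \<in> Y" and ne: "\<mu> \<noteq> \<nu>"
    and z: "z \<in> Y" "\<And>y. y \<in> Y \<Longrightarrow> z \<noteq> A y - smul \<mu> y"
    and z': "z' \<in> Y" "\<And>y. y \<in> Y \<Longrightarrow> z' \<noteq> A y - smul \<nu> y"
  obtains P Q where "z \<notin> poly_op P A ` Y" "z' \<notin> poly_op Q A ` Y" "poly_op P A ` Y \<inter> poly_op Q A ` Y \<subseteq> {0}"
    "\<And>y. y \<in> Y \<Longrightarrow> \<exists>y1\<in>Y. \<exists>y2\<in>Y. y = poly_op P A y1 + poly_op Q A y2"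
proof -
  have sY: "V.subspace Y" using Y by (rule fin_subspaceD)
  have inv: "poly_op p A y \<in> Y" if "y \<in> Y" for p y by (rule poly_op_invariant[OF A(1) sY A(2) that])
  obtain q where q: "q \<noteq> 0" "\<forall>y\<in>Y. poly_op q A y = 0" using annihilating_poly[OF Y A(1) A(2)] by auto
  have r1: "poly q \<mu> = 0" by (rule annihilator_root[OF sY A _ z]) (use q in auto)
  have r2: "poly q \<nu> = 0" by (rule annihilator_root[OF sY A _ z']) (use q in auto)
  obtain Q where Q: "q = [:-\<mu>, 1:] ^ order \<mu> q * Q" "\<not> [:-\<mu>, 1:] dvd Q"
    using order_decomp[OF q(1), of \<mu>] by auto
  define k where "k = order \<mu> q"
  define P where "P = [:-\<mu>, 1:] ^ k"
  have qPQ: "q = P * Q" using Q(1) by (simp add: P_def k_def)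
  have "k \<noteq> 0" using r1 q(1) by (simp add: k_def order_root)
  then obtain k' where k': "P = [:-\<mu>, 1:] * [:-\<mu>, 1:] ^ k'" by (cases k) (auto simp: P_def)
  have "poly Q \<nu> = 0" using r2 ne unfolding qPQ P_def by simp
  then obtain Q' where Q': "Q = [:-\<nu>, 1:] * Q'" by (metis poly_eq_0_iff_dvd dvdE)
  have "poly Q \<mu> \<noteq> 0" using Q(2) by (simp add: poly_eq_0_iff_dvd)
  then obtain u v where uv: "u * P + v * Q = 1" unfolding P_def by (rule bezout_linear_power)
  have one: "poly_op 1 A y = y" for y using poly_op_const[OF A(1), of 1 y] by (simp add: one_pCons)
  have lin_fact: "poly_op ([:-a, 1:] * r) A y = A (poly_op r A y) - smul a (poly_op r A y)" for a r y
    unfolding poly_op_mult[OF A(1)] poly_op_linear[OF A(1)] by simp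
  show ?thesis
  proof (rule that[of P Q])
    show "z \<notin> poly_op P A ` Y"
      unfolding k' using z(2) inv by (auto simp: lin_fact simp del: mult_pCons_left mult_pCons_right)
    show "z' \<notin> poly_op Q A ` Y"
      unfolding Q' using z'(2) inv by (auto simp: lin_fact simp del: mult_pCons_left mult_pCons_right)
    show "poly_op P A ` Y \<inter> poly_op Q A ` Y \<subseteq> {0}"
    proof
      fix y assume y: "y \<in> poly_op P A ` Y \<inter> poly_op Q A ` Y"
      then obtain y1 y2 where y1: "y1 \<in> Y" "y = poly_op P A y1" and y2: "y2 \<in> Y" "y = poly_op Q A y2" by blast
      have "poly_op Q A y = poly_op q A y1" unfolding y1(2) qPQ by (simp only: poly_op_mult[OF A(1), symmetric] mult.commute)
      then have Q0: "poly_op Q A y = 0" using q(2) y1(1) by simp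
      have "poly_op P A y = poly_op q A y2" unfolding y2(2) qPQ by (simp only: poly_op_mult[OF A(1), symmetric])
      then have P0: "poly_op P A y = 0" using q(2) y2(1) by simp
      have "y = poly_op (u * P + v * Q) A y" by (simp only: uv one)
      also have "\<dots> = poly_op u A (poly_op P A y) + poly_op v A (poly_op Q A y)"
        by (simp only: poly_op_add[OF A(1)] poly_op_mult[OF A(1)])
      also have "\<dots> = 0" unfolding P0 Q0 by (simp add: lin_zero[OF lin_poly_op[OF A(1)]])
      finally show "y \<in> {0}" by simp
    qed
    show "\<exists>y1\<in>Y. \<exists>y2\<in>Y. y = poly_op P A y1 + poly_op Q A y2" if y: "y \<in> Y" for y
    proof (intro bexI)
      have "y = poly_op (P * u + Q * v) A y" using uv by (simp only: mult.commute one)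
      then show "y = poly_op P A (poly_op u A y) + poly_op Q A (poly_op v A y)"
        by (simp only: poly_op_add[OF A(1)] poly_op_mult[OF A(1)])
    qed (rule inv[OF y])+
  qed
qed

text \<open>
  Schur's bound on the dimension of a commuting family, proved as by Gustafson: the one-eigenvalue case
  counts parameters, and otherwise Fitting's decomposition reduces to two smaller spaces, whose bounds add
  up to at most the bound for $Y$.
\<close>

theorem commuting_determined:
  assumes "fin_subspace Y" "commuting A" "invariant A Y"
  shows "\<exists>\<Phi>. finite \<Phi> \<and> card \<Phi> \<le> (V.dim Y)\<^sup>2 div 4 + 1 \<and> determined_by d A Y \<Phi>"
  using assms
proof (induction "V.dim Y" arbitrary: Y rule: less_induct)
  case less
  note Y = less.prems(1) and A = less.prems(2,3)
  have sY: "V.subspace Y" using Y by (rule fin_subspaceD)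
  have lA: "lin (A i)" for i using A(1) by (rule commuting_lin)
  show ?case
  proof (cases "Y = {0}")
    case True
    then have "determined_by d A Y {}" by (simp add: determined_by_def lin_zero[OF lA])
    then show ?thesis by (intro exI[of _ "{}"]) simp
  next
    case False
    then have Y0: "{0} \<noteq> Y" "{0} \<subseteq> Y" using V.subspace_0[OF sY] by auto
    have inv0: "invariant A {0}" by (simp add: invariant_def lin_zero[OF lA])
    show ?thesis
    proof (rule ex_joint_coeigenvalue[OF Y A V.subspace_single_0 Y0(2,1) inv0, of d])
      fix lam W assume W: "V.subspace W" "W \<subseteq> Y" "W \<noteq> Y" "invariant A W"
        and lam: "\<And>i y. i < d \<Longrightarrow> y \<in> Y \<Longrightarrow> A i y - smul (lam i) y \<in> W"
        and min: "\<And>W'. V.subspace W' \<Longrightarrow> {0} \<subseteq> W' \<Longrightarrow> 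
          (\<And>i y. i < d \<Longrightarrow> y \<in> Y \<Longrightarrow> A i y - smul (lam i) y \<in> W') \<Longrightarrow> W \<subseteq> W'"
      obtain z where z: "z \<in> Y" "z \<notin> W" using W by blast
      show ?thesis
      proof (cases "\<exists>i<d. \<exists>\<nu>. \<exists>z'\<in>Y. \<nu> \<noteq> lam i \<and> (\<forall>y\<in>Y. z' \<noteq> A i y - smul \<nu> y)")
        case False
        show ?thesis
        proof (rule determined_local[OF Y A W lam])
          show "W \<subseteq> W'" if "V.subspace W'" "\<And>i y. i < d \<Longrightarrow> y \<in> Y \<Longrightarrow> A i y - smul (lam i) y \<in> W'" for W'
            using V.subspace_0[OF that(1)] that(2) by (intro min[OF that(1)]) auto
          show "\<mu> = lam i" if "i < d" "z \<in> Y" "\<And>y. y \<in> Y \<Longrightarrow> z \<noteq> A i y - smul \<mu> y" for i \<mu> z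
            using False that by auto
        qed
      next
        case True
        then obtain i \<nu> z' where i: "i < d" and z': "z' \<in> Y" "\<nu> \<noteq> lam i" "\<forall>y\<in>Y. z' \<noteq> A i y - smul \<nu> y" by blast
        show ?thesis
        proof (rule fitting_split[OF Y lA[of i] invariantD[OF A(2)] z'(2)[symmetric] z(1) _ z'(1)])
          show "z \<noteq> A i y - smul (lam i) y" if "y \<in> Y" for y using lam[OF i that] z(2) by auto
          show "z' \<noteq> A i y - smul \<nu> y" if "y \<in> Y" for y using z'(3) that by blast
          fix P Q assume PQ: "z \<notin> poly_op P (A i) ` Y" "z' \<notin> poly_op Q (A i) ` Y" "poly_op P (A i) ` Y \<inter> poly_op Q (A i) ` Y \<subseteq> {0}"
            "\<And>y. y \<in> Y \<Longrightarrow> \<exists>y1\<in>Y. \<exists>y2\<in>Y. y = poly_op P (A i) y1 + poly_op Q (A i) y2"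
          define Y1 where "Y1 = poly_op P (A i) ` Y"
          define Y2 where "Y2 = poly_op Q (A i) ` Y"
          have sub: "V.subspace (poly_op p (A i) ` Y) \<and> poly_op p (A i) ` Y \<subseteq> Y \<and> invariant A (poly_op p (A i) ` Y)" for p
          proof (intro conjI)
            show "V.subspace (poly_op p (A i) ` Y)" by (rule lin_image_subspace[OF lin_poly_op[OF lA] sY])
            show "poly_op p (A i) ` Y \<subseteq> Y" by (intro image_subsetI poly_op_invariant[OF lA sY invariantD[OF A(2)]])
            show "invariant A (poly_op p (A i) ` Y)"
              unfolding invariant_def
            proof (intro allI ballI)
              fix j y assume "y \<in> poly_op p (A i) ` Y"
              then obtain u where u: "u \<in> Y" "y = poly_op p (A i) u" by blast
              have "poly_op p (A i) (A j u) = A j (poly_op p (A i) u)"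
                by (rule poly_op_commute[of "A i" "A j", OF lA lA commuting_commute[OF A(1), of i j]])
              then have "A j y = poly_op p (A i) (A j u)" unfolding u(2) by (rule sym)
              then show "A j y \<in> poly_op p (A i) ` Y" by (rule image_eqI) (rule invariantD[OF A(2) u(1)])
            qed
          qed
          have Y1: "V.subspace Y1" "Y1 \<subseteq> Y" "invariant A Y1" and Y2: "V.subspace Y2" "Y2 \<subseteq> Y" "invariant A Y2"
            unfolding Y1_def Y2_def using sub by blast+
          have f1: "fin_subspace Y1" and f2: "fin_subspace Y2"
            using fin_subspace_mono[OF Y] Y1 Y2 by blast+
          have n1: "Y1 \<noteq> Y" and n2: "Y2 \<noteq> Y" using PQ(1,2) z(1) z'(1) by (auto simp: Y1_def Y2_def)
          have sum: "\<exists>y1\<in>Y1. \<exists>y2\<in>Y2. y = y1 + y2" if "y \<in> Y" for y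
            using PQ(4)[OF that] unfolding Y1_def Y2_def by blast
          have d1: "V.dim Y1 \<noteq> 0"
          proof
            assume "V.dim Y1 = 0"
            then have Y10: "Y1 = {0}" by (rule subspace_dim_0[OF f1])
            have "Y \<subseteq> Y2"
            proof
              fix y assume "y \<in> Y"
              then obtain y1 y2 where "y1 \<in> Y1" "y2 \<in> Y2" "y = y1 + y2" using sum by blast
              then show "y \<in> Y2" using Y10 by simp
            qed
            then show False using n2 Y2(2) by blast
          qed
          have d2: "V.dim Y2 \<noteq> 0"
          proof
            assume "V.dim Y2 = 0"
            then have Y20: "Y2 = {0}" by (rule subspace_dim_0[OF f2])
            have "Y \<subseteq> Y1"
            proof
              fix y assume "y \<in> Y"
              then obtain y1 y2 where "y1 \<in> Y1" "y2 \<in> Y2" "y = y1 + y2" using sum by blast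
              then show "y \<in> Y1" using Y20 by simp
            qed
            then show False using n1 Y1(2) by blast
          qed
          have dd: "V.dim Y1 + V.dim Y2 \<le> V.dim Y"
            by (rule direct_sum_dim_le[OF Y Y1(1) Y2(1) Y1(2) Y2(2)]) (use PQ(3) in \<open>simp add: Y1_def Y2_def\<close>)
          obtain \<Phi>1 where \<Phi>1: "finite \<Phi>1" "card \<Phi>1 \<le> (V.dim Y1)\<^sup>2 div 4 + 1" "determined_by d A Y1 \<Phi>1"
            using less.hyps[OF _ f1 A(1) Y1(3)] dd d2 by auto
          obtain \<Phi>2 where \<Phi>2: "finite \<Phi>2" "card \<Phi>2 \<le> (V.dim Y2)\<^sup>2 div 4 + 1" "determined_by d A Y2 \<Phi>2"
            using less.hyps[OF _ f2 A(1) Y2(3)] dd d1 by auto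
          have "card (\<Phi>1 \<union> \<Phi>2) \<le> (V.dim Y)\<^sup>2 div 4 + 1"
            using card_Un_le[of \<Phi>1 \<Phi>2] \<Phi>1(2) \<Phi>2(2) quarter_square_add[OF _ _ dd] d1 d2 by linarith
          moreover have "determined_by d A Y (\<Phi>1 \<union> \<Phi>2)"
            unfolding determined_by_def
          proof (intro allI impI ballI)
            fix a y assume a: "\<forall>\<phi>\<in>\<Phi>1 \<union> \<Phi>2. (\<Sum>i<d. a i * \<phi> i) = 0" and y: "y \<in> Y"
            obtain y1 y2 where y12: "y1 \<in> Y1" "y2 \<in> Y2" "y = y1 + y2" using sum[OF y] by blast
            have 1: "(\<Sum>i<d. smul (a i) (A i y1)) = 0" using \<Phi>1(3) a y12(1) unfolding determined_by_def by blast
            have 2: "(\<Sum>i<d. smul (a i) (A i y2)) = 0" using \<Phi>2(3) a y12(2) unfolding determined_by_def by blast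
            show "(\<Sum>i<d. smul (a i) (A i y)) = 0"
              unfolding y12(3) lin_add[OF lA] V.scale_right_distrib sum.distrib 1 2 by simp
          qed
          ultimately show ?thesis using \<Phi>1(1) \<Phi>2(1) by (intro exI[of _ "\<Phi>1 \<union> \<Phi>2"]) simp
        qed
      qed
    qed
  qed
qed

section \<open>Reducing the number of variables\<close>

definition cip :: "nat \<Rightarrow> cvec \<Rightarrow> cvec \<Rightarrow> complex" where
  "cip d x y = (\<Sum>i<d. coord x i * cnj (coord y i))"

lemma cip_add_left: "cip d (x + y) z = cip d x z + cip d y z"
  by (simp add: cip_def lookup_add distrib_right sum.distrib)

lemma cip_diff_left: "cip d (x - y) z = cip d x z - cip d y z"
  by (simp add: cip_def lookup_minus left_diff_distrib sum_subtractf)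

lemma cip_diff_right: "cip d z (x - y) = cip d z x - cip d z y"
  by (simp add: cip_def lookup_minus right_diff_distrib sum_subtractf)

lemma cip_smul_left: "cip d (smul c x) z = c * cip d x z"
  by (simp add: cip_def sum_distrib_left mult.assoc)

lemma cip_cnj: "cip d y x = cnj (cip d x y)"
  by (simp add: cip_def mult.commute)

lemma cip_add_right: "cip d z (x + y) = cip d z x + cip d z y"
  by (simp add: cip_def lookup_add distrib_left sum.distrib)

lemma cip_smul_right: "cip d z (smul c x) = cnj c * cip d z x"
  by (simp add: cip_def sum_distrib_left mult_ac)

lemma cip_sum_left: "cip d (sum f S) z = (\<Sum>j\<in>S. cip d (f j) z)"
  by (induction S rule: infinite_finite_induct) (simp_all add: cip_add_left, simp_all add: cip_def)

lemma cip_sum_right: "cip d z (sum f S) = (\<Sum>j\<in>S. cip d z (f j))"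
  by (induction S rule: infinite_finite_induct) (simp_all add: cip_add_right, simp_all add: cip_def)

lemma cip_self: "cip d x x = of_real ((nrm d x)\<^sup>2)"
  unfolding nrm_power2 cip_def of_real_sum
  by (intro sum.cong refl) (simp add: complex_norm_square del: of_real_power)

lemma nrm_pythagoras:
  assumes "cip d x y = 0" shows "(nrm d (x + y))\<^sup>2 = (nrm d x)\<^sup>2 + (nrm d y)\<^sup>2"
proof -
  have "cip d (x + y) (x + y) = cip d x x + cip d y y"
    using assms cip_cnj[of d y x] by (simp add: cip_add_left cip_add_right)
  then have "complex_of_real ((nrm d (x + y))\<^sup>2) = of_real ((nrm d x)\<^sup>2 + (nrm d y)\<^sup>2)"
    by (simp only: cip_self of_real_add)
  then show ?thesis by (simp only: of_real_eq_iff)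
qed

text \<open>
  Members of the system may be zero: this allows exactly \<open>N\<close> of them for every subspace of dimension at
  most \<open>N\<close>, so that the number of variables does not depend on the tuple.
\<close>

lemma ex_orthonormal_system:
  assumes "fin_subspace L" "L \<subseteq> supported d" "V.dim L \<le> N"
  shows "\<exists>v. (\<forall>j<N. v j \<in> L) \<and> (\<forall>x\<in>L. x = (\<Sum>j<N. smul (cip d x (v j)) (v j))) \<and>
    (\<forall>x\<in>L. (nrm d x)\<^sup>2 = (\<Sum>j<N. (cmod (cip d x (v j)))\<^sup>2)) \<and>
    (\<forall>c. (nrm d (\<Sum>j<N. smul (c j) (v j)))\<^sup>2 \<le> (\<Sum>j<N. (cmod (c j))\<^sup>2))"
  using assms
proof (induction N arbitrary: L)
  case 0
  then have "L = {0}" using subspace_dim_0[of L] by simp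
  then show ?case by simp
next
  case (Suc N)
  have sL: "V.subspace L" using Suc.prems(1) by (rule fin_subspaceD)
  show ?case
  proof (cases "L = {0}")
    case True
    then show ?thesis by (intro exI[of _ "\<lambda>_. 0"]) (simp add: cip_def sum_nonneg)
  next
    case False
    then obtain y where y: "y \<in> L" "y \<noteq> 0" using V.subspace_0[OF sL] by blast
    have "nrm d y \<noteq> 0" using nrm_eq_zero y Suc.prems(2) by blast
    then have ny: "0 < nrm d y" using nrm_nonneg[of d y] by linarith
    define e where "e = smul (of_real (1 / nrm d y)) y"
    have e: "e \<in> L" unfolding e_def by (rule subspace_smul[OF sL y(1)])
    have ne: "nrm d e = 1" using ny by (simp add: e_def nrm_smul norm_divide)
    then have ee: "cip d e e = 1" by (simp add: cip_self)
    define L' where "L' = {x \<in> L. cip d x e = 0}"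
    have sL': "V.subspace L'"
      unfolding L'_def using V.subspace_0[OF sL] V.subspace_add[OF sL] subspace_smul[OF sL]
      by (intro V.subspaceI) (auto simp: cip_add_left cip_smul_left, simp add: cip_def)
    have L'L: "L' \<subseteq> L" by (auto simp: L'_def)
    have "e \<notin> L'" using ee by (simp add: L'_def)
    then have "V.dim L' < V.dim L" using dim_less[OF Suc.prems(1) sL' L'L] e by blast
    then have dL': "V.dim L' \<le> N" using Suc.prems(3) by simp
    obtain v where v: "\<forall>j<N. v j \<in> L'" "\<forall>x\<in>L'. x = (\<Sum>j<N. smul (cip d x (v j)) (v j))"
      "\<forall>x\<in>L'. (nrm d x)\<^sup>2 = (\<Sum>j<N. (cmod (cip d x (v j)))\<^sup>2)"
      "\<forall>c. (nrm d (\<Sum>j<N. smul (c j) (v j)))\<^sup>2 \<le> (\<Sum>j<N. (cmod (c j))\<^sup>2)"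
      using Suc.IH[OF fin_subspace_mono[OF Suc.prems(1) sL' L'L] subset_trans[OF L'L Suc.prems(2)] dL']
      by (elim exE conjE)
    \<comment> \<open>The new vector comes last, so that sums over the first $N$ indices are those of the smaller subspace.\<close>
    define w where "w = v(N := e)"
    have wsum: "(\<Sum>j<Suc N. smul (c j) (w j)) = (\<Sum>j<N. smul (c j) (v j)) + smul (c N) e" for c
      by (simp add: w_def)
    have vL': "(\<Sum>j<N. smul (c j) (v j)) \<in> L'" for c
      using v(1) by (intro V.subspace_sum[OF sL'] subspace_smul[OF sL']) auto
    have split: "\<exists>x'\<in>L'. x = x' + smul (cip d x e) e \<and> (\<forall>j<N. cip d x (v j) = cip d x' (v j))" if x: "x \<in> L" for x
    proof (intro bexI conjI allI impI)
      show "x = (x - smul (cip d x e) e) + smul (cip d x e) e" by simp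
      show "x - smul (cip d x e) e \<in> L'"
        unfolding L'_def using x e V.subspace_diff[OF sL] subspace_smul[OF sL]
        by (simp add: cip_diff_left cip_smul_left ee)
      fix j assume "j < N"
      then have "cip d (v j) e = 0" using v(1) by (simp add: L'_def)
      then have "cip d e (v j) = 0" using cip_cnj[of d e "v j"] by simp
      then show "cip d x (v j) = cip d (x - smul (cip d x e) e) (v j)"
        by (simp add: cip_diff_left cip_smul_left)
    qed
    show ?thesis
    proof (intro exI[of _ w] conjI allI impI ballI)
      show "w j \<in> L" if "j < Suc N" for j using that v(1) e L'L by (auto simp: w_def less_Suc_eq)
    next
      fix x assume x: "x \<in> L"
      obtain x' where x': "x' \<in> L'" "x = x' + smul (cip d x e) e" "\<forall>j<N. cip d x (v j) = cip d x' (v j)"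
        using split[OF x] by blast
      have wv: "w j = v j" if "j < N" for j using that by (simp add: w_def)
      have "x' = (\<Sum>j<N. smul (cip d x' (v j)) (v j))" using v(2) x'(1) by blast
      also have "\<dots> = (\<Sum>j<N. smul (cip d x (w j)) (w j))" using x'(3) wv by (intro sum.cong refl) simp
      finally have x'_eq: "x' = (\<Sum>j<N. smul (cip d x (w j)) (w j))" .
      have wN: "w N = e" by (simp add: w_def)
      have "x' + smul (cip d x e) e = (\<Sum>j<Suc N. smul (cip d x (w j)) (w j))"
        using x'_eq by (simp add: wN)
      then show "x = (\<Sum>j<Suc N. smul (cip d x (w j)) (w j))" using x'(2) by simp
      have "cip d x' (smul (cip d x e) e) = 0" using x'(1) by (simp add: L'_def cip_smul_right)
      from nrm_pythagoras[OF this] have "(nrm d x)\<^sup>2 = (nrm d x')\<^sup>2 + (cmod (cip d x e))\<^sup>2"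
        using x'(2) by (simp add: nrm_smul ne)
      also have "(nrm d x')\<^sup>2 = (\<Sum>j<N. (cmod (cip d x' (v j)))\<^sup>2)" using v(3) x'(1) by blast
      also have "\<dots> = (\<Sum>j<N. (cmod (cip d x (w j)))\<^sup>2)" using x'(3) wv by (intro sum.cong refl) simp
      finally show "(nrm d x)\<^sup>2 = (\<Sum>j<Suc N. (cmod (cip d x (w j)))\<^sup>2)" by (simp add: wN)
    next
      fix c
      have "cip d (\<Sum>j<N. smul (c j) (v j)) (smul (c N) e) = 0"
        using vL'[of c] by (simp add: L'_def cip_smul_right)
      from nrm_pythagoras[OF this]
      have "(nrm d (\<Sum>j<Suc N. smul (c j) (w j)))\<^sup>2 = (nrm d (\<Sum>j<N. smul (c j) (v j)))\<^sup>2 + (cmod (c N))\<^sup>2"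
        unfolding wsum by (simp add: nrm_smul ne)
      also have "\<dots> \<le> (\<Sum>j<Suc N. (cmod (c j))\<^sup>2)" using v(4) by simp
      finally show "(nrm d (\<Sum>j<Suc N. smul (c j) (w j)))\<^sup>2 \<le> (\<Sum>j<Suc N. (cmod (c j))\<^sup>2)" .
    qed
  qed
qed

text \<open>
  The double annihilator of a subspace: the difference of $b$ and its projection is orthogonal to the
  subspace, hence annihilates $b$ and itself.
\<close>

lemma mem_span_of_annihilated:
  assumes L: "L = V.span (vec_of d ` \<Phi>)" "finite \<Phi>"
    and v: "\<forall>x\<in>L. x = (\<Sum>j<N. smul (cip d x (v j)) (v j))" "\<forall>j<N. v j \<in> L"
    and b: "b \<in> supported d" "\<And>a. (\<forall>\<phi>\<in>\<Phi>. (\<Sum>i<d. a i * \<phi> i) = 0) \<Longrightarrow> (\<Sum>i<d. a i * coord b i) = 0"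
  shows "b \<in> L"
proof -
  define pr where "pr = (\<Sum>j<N. smul (cip d b (v j)) (v j))"
  define c where "c = b - pr"
  have sL: "V.subspace L" unfolding L by (rule V.subspace_span)
  have prL: "pr \<in> L" unfolding pr_def using v(2) by (intro V.subspace_sum[OF sL] subspace_smul[OF sL]) auto
  have LS: "L \<subseteq> supported d"
    unfolding L by (rule V.span_minimal[OF _ subspace_supported]) (auto simp: supported_def)
  have orth: "cip d x c = 0" if x: "x \<in> L" for x
  proof -
    have "cip d x pr = (\<Sum>j<N. cnj (cip d b (v j)) * cip d x (v j))"
      unfolding pr_def by (simp add: cip_sum_right cip_smul_right)
    also have "\<dots> = (\<Sum>j<N. cip d (smul (cip d x (v j)) (v j)) b)"
      by (intro sum.cong refl) (simp add: cip_smul_left cip_cnj[of d _ b] mult.commute)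
    also have "\<dots> = cip d (\<Sum>j<N. smul (cip d x (v j)) (v j)) b" by (simp add: cip_sum_left)
    also have "(\<Sum>j<N. smul (cip d x (v j)) (v j)) = x" using v(1) x by simp
    finally have "cip d x pr = cip d x b" .
    then show ?thesis by (simp add: c_def cip_diff_right)
  qed
  have "(\<Sum>i<d. cnj (coord c i) * \<phi> i) = 0" if "\<phi> \<in> \<Phi>" for \<phi>
  proof -
    have "vec_of d \<phi> \<in> L" unfolding L using that by (intro V.span_base imageI)
    then have "cip d (vec_of d \<phi>) c = 0" by (rule orth)
    then show ?thesis by (simp add: cip_def mult.commute)
  qed
  then have "(\<Sum>i<d. cnj (coord c i) * coord b i) = 0" by (intro b(2)) simp
  then have "cip d b c = 0" by (simp add: cip_def mult.commute)
  then have "cip d c c = 0" using orth[OF prL] by (simp add: c_def cip_diff_left)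
  then have "nrm d c = 0" by (simp add: cip_self)
  moreover have "c \<in> supported d"
    unfolding c_def using b(1) prL LS by (intro V.subspace_diff[OF subspace_supported]) auto
  ultimately have "c = 0" by (intro nrm_eq_zero)
  then show ?thesis using prL by (simp add: c_def)
qed

text \<open>
  If the $A_i$ depend on at most $N$ parameters, then $A_i = \sum_{j<N} v_{ij} R_j$, where the columns of
  $v$ are orthonormal or zero. The $R_j = \sum_i \bar v_{ij} A_i$ form a column contraction, and $v$ maps the
  ball of $\mathbb{C}^N$ into that of $\mathbb{C}^d$; so $p(A) = h(R)$ for the polynomial $h = p \circ v$ in
  $N$ variables, whose supremum is at most that of $p$.
\<close>

theorem reduce_variables:
  assumes A: "commuting A" "V.subspace Y" "invariant A Y" "col_contraction d n A Y"
    and \<Phi>: "finite \<Phi>" "card \<Phi> \<le> N" "determined_by d A Y \<Phi>"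
  obtains R where "commuting R" "invariant R Y" "col_contraction N n R Y"
    "\<And>p S. ball_bound d p S \<Longrightarrow> \<exists>h\<in>polys N. ball_bound N h S \<and> (\<forall>y\<in>Y. ev d A p y = ev N R h y)"
proof -
  define L where "L = V.span (vec_of d ` \<Phi>)"
  have L: "fin_subspace L"
    unfolding L_def fin_subspace_def using \<Phi>(1) by (intro conjI V.subspace_span exI[of _ "vec_of d ` \<Phi>"]) auto
  have LS: "L \<subseteq> supported d"
    unfolding L_def by (rule V.span_minimal[OF _ subspace_supported]) (auto simp: supported_def)
  have "V.dim L \<le> card (vec_of d ` \<Phi>)" using \<Phi>(1) by (intro V.dim_le_card) (auto simp: L_def)
  then have dL: "V.dim L \<le> N" using card_image_le[OF \<Phi>(1), of "vec_of d"] \<Phi>(2) by linarith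
  obtain v where v: "\<forall>j<N. v j \<in> L" "\<forall>x\<in>L. x = (\<Sum>j<N. smul (cip d x (v j)) (v j))"
      "\<forall>x\<in>L. (nrm d x)\<^sup>2 = (\<Sum>j<N. (cmod (cip d x (v j)))\<^sup>2)"
      "\<forall>c. (nrm d (\<Sum>j<N. smul (c j) (v j)))\<^sup>2 \<le> (\<Sum>j<N. (cmod (c j))\<^sup>2)"
    using ex_orthonormal_system[OF L LS dL] by (elim exE conjE)
  define R where "R j = ev d A (\<Sum>i<d. cst (cnj (coord (v j) i)) * var i)" for j
  have R: "R j y = (\<Sum>i<d. smul (cnj (coord (v j) i)) (A i y))" for j y
    unfolding R_def ev_sum by (intro sum.cong refl) (simp add: ev_mult[OF A(1)] ev_cst ev_var)
  define b where "b y k = vec_of d (\<lambda>i. coord (A i y) k)" for y k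
  have bL: "b y k \<in> L" if y: "y \<in> Y" for y k
  proof (rule mem_span_of_annihilated[OF L_def \<Phi>(1) v(2,1)])
    show "b y k \<in> supported d" by (simp add: b_def supported_def)
    fix a assume "\<forall>\<phi>\<in>\<Phi>. (\<Sum>i<d. a i * \<phi> i) = 0"
    then have "(\<Sum>i<d. smul (a i) (A i y)) = 0" using \<Phi>(3) y unfolding determined_by_def by blast
    then have "coord (\<Sum>i<d. smul (a i) (A i y)) k = 0" by simp
    then show "(\<Sum>i<d. a i * coord (b y k) i) = 0" by (simp add: b_def lookup_sum)
  qed
  have bR: "cip d (b y k) (v j) = coord (R j y) k" for y k j
    by (simp add: cip_def b_def R lookup_sum mult.commute)
  have AR: "A i y = (\<Sum>j<N. smul (coord (v j) i) (R j y))" if i: "i < d" "y \<in> Y" for i y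
  proof (rule cvec_eqI)
    fix k
    have "coord (A i y) k = coord (b y k) i" using i by (simp add: b_def)
    also have "b y k = (\<Sum>j<N. smul (cip d (b y k) (v j)) (v j))" using v(2) bL[OF i(2)] by blast
    also have "coord \<dots> i = coord (\<Sum>j<N. smul (coord (v j) i) (R j y)) k"
      by (simp add: lookup_sum bR mult.commute)
    finally show "coord (A i y) k = coord (\<Sum>j<N. smul (coord (v j) i) (R j y)) k" .
  qed
  have cR: "commuting R" unfolding R_def[abs_def] by (rule commuting_ev[OF A(1)])
  have iR: "invariant R Y"
    unfolding invariant_def R_def by (intro allI ballI ev_invariant[OF A(2) invariantD[OF A(3)]])
  have contr: "col_contraction N n R Y"
    unfolding col_contraction_def
  proof
    fix y assume y: "y \<in> Y"
    have "(\<Sum>j<N. (nrm n (R j y))\<^sup>2) = (\<Sum>k<n. \<Sum>j<N. (cmod (cip d (b y k) (v j)))\<^sup>2)"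
      unfolding nrm_power2 bR by (rule sum.swap)
    also have "\<dots> = (\<Sum>k<n. (nrm d (b y k))\<^sup>2)" using v(3) bL[OF y] by (intro sum.cong refl) simp
    also have "\<dots> = (\<Sum>k<n. \<Sum>i<d. (cmod (coord (A i y) k))\<^sup>2)" by (simp add: nrm_power2 b_def)
    also have "\<dots> = (\<Sum>i<d. (nrm n (A i y))\<^sup>2)" unfolding nrm_power2 by (rule sum.swap)
    also have "\<dots> \<le> (nrm n y)\<^sup>2" by (rule col_contractionD[OF A(4) y])
    finally show "(\<Sum>j<N. (nrm n (R j y))\<^sup>2) \<le> (nrm n y)\<^sup>2" .
  qed
  define \<Psi> where "\<Psi> i = (\<Sum>j<N. cst (coord (v j) i) * var j)" for i
  show ?thesis
  proof (rule that[OF cR iR contr])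
    fix p S assume pS: "ball_bound d p S"
    show "\<exists>h\<in>polys N. ball_bound N h S \<and> (\<forall>y\<in>Y. ev d A p y = ev N R h y)"
    proof (intro bexI[of _ "psubst d \<Psi> p"] conjI ballI)
      show "psubst d \<Psi> p \<in> polys N"
        unfolding \<Psi>_def by (intro polys_psubst polys_sum polys_mult polys_cst polys_var) simp
      show "ball_bound N (psubst d \<Psi> p) S"
        unfolding ball_bound_def
      proof
        fix z assume z: "z \<in> fun_ball N"
        have "(\<Sum>i<d. (cmod (pe N (\<Psi> i) z))\<^sup>2) = (nrm d (\<Sum>j<N. smul (z j) (v j)))\<^sup>2"
          unfolding nrm_power2 by (intro sum.cong refl) (simp add: \<Psi>_def pe_sum pe_mult lookup_sum mult.commute)
        also have "\<dots> \<le> (\<Sum>j<N. (cmod (z j))\<^sup>2)" using v(4) by blast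
        finally have "(\<lambda>i. pe N (\<Psi> i) z) \<in> fun_ball d" using z by (simp add: fun_ball_def)
        then show "cmod (pe N (psubst d \<Psi> p) z) \<le> S" unfolding pe_psubst by (rule ball_boundD[OF pS])
      qed
      fix y assume y: "y \<in> Y"
      have "ev N R (psubst d \<Psi> p) y = ev d (\<lambda>i. ev N R (\<Psi> i)) p y" by (rule ev_psubst[OF cR])
      also have "\<dots> = ev d A p y"
      proof (rule ev_cong_on[OF _ _ y])
        show "A i u \<in> Y" if "u \<in> Y" for i u by (rule invariantD[OF A(3) that])
        show "ev N R (\<Psi> i) u = A i u" if "i < d" "u \<in> Y" for i u
          unfolding AR[OF that] \<Psi>_def ev_sum by (intro sum.cong refl) (simp add: ev_mult[OF cR] ev_cst ev_var)
      qed
      finally show "ev d A p y = ev N R (psubst d \<Psi> p) y" ..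
    qed
  qed
qed

section \<open>Matrices and their transposes\<close>

text \<open>
  Transposes, rather than adjoints, turn row contractions into column contractions without conjugating
  the coefficients of polynomials.
\<close>

definition transpose_op :: "nat \<Rightarrow> complex mat \<Rightarrow> cvec \<Rightarrow> cvec" where
  "transpose_op n M x = vec_of n (\<lambda>r. \<Sum>c<n. M $$ (c, r) * coord x c)"

lemma coord_transpose_op: "r < n \<Longrightarrow> coord (transpose_op n M x) r = (\<Sum>c<n. M $$ (c, r) * coord x c)"
  by (simp add: transpose_op_def)

lemma lin_transpose_op: "lin (transpose_op n M)"
  unfolding lin_def
  by (intro conjI allI cvec_eqI)
    (simp_all add: transpose_op_def lookup_add distrib_left sum.distrib sum_distrib_left mult_ac)

lemma transpose_op_supported: "transpose_op n M x \<in> supported n"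
  by (simp add: transpose_op_def supported_def)

lemma index_mult_mat_sum:
  assumes "M \<in> carrier_mat n n" "N \<in> carrier_mat n n" "e < n" "r < n"
  shows "(M * N) $$ (e, r) = (\<Sum>c<n. M $$ (e, c) * N $$ (c, r))"
  using assms by (simp add: scalar_prod_def atLeast0LessThan)

lemma transpose_op_mult:
  assumes M: "M \<in> carrier_mat n n" "N \<in> carrier_mat n n"
  shows "transpose_op n (M * N) x = transpose_op n N (transpose_op n M x)"
proof (rule cvec_eqI)
  fix r
  show "coord (transpose_op n (M * N) x) r = coord (transpose_op n N (transpose_op n M x)) r"
  proof (cases "r < n")
    case True
    have "coord (transpose_op n (M * N) x) r = (\<Sum>e<n. \<Sum>c<n. N $$ (c, r) * (M $$ (e, c) * coord x e))"
      unfolding coord_transpose_op[OF True]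
      using index_mult_mat_sum[OF M _ True] by (intro sum.cong refl) (simp add: sum_distrib_left sum_distrib_right mult_ac)
    also have "\<dots> = (\<Sum>c<n. \<Sum>e<n. N $$ (c, r) * (M $$ (e, c) * coord x e))" by (rule sum.swap)
    also have "\<dots> = coord (transpose_op n N (transpose_op n M x)) r"
      unfolding coord_transpose_op[OF True] by (intro sum.cong refl) (simp add: coord_transpose_op sum_distrib_left)
    finally show ?thesis .
  qed (simp add: transpose_op_def)
qed

lemma transpose_op_one: "x \<in> supported n \<Longrightarrow> transpose_op n (1\<^sub>m n) x = x"
proof (rule cvec_eqI)
  fix r assume x: "x \<in> supported n"
  show "coord (transpose_op n (1\<^sub>m n) x) r = coord x r"
  proof (cases "r < n")
    case True
    have "coord (transpose_op n (1\<^sub>m n) x) r = (\<Sum>c<n. if c = r then coord x c else 0)"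
      unfolding coord_transpose_op[OF True] using True by (intro sum.cong refl) auto
    then show ?thesis using True by simp
  qed (use x in \<open>simp add: transpose_op_def supported_def\<close>)
qed

lemma transpose_op_power:
  assumes M: "M \<in> carrier_mat n n" and x: "x \<in> supported n"
  shows "transpose_op n (M ^\<^sub>m k) x = (transpose_op n M ^^ k) x"
proof (induction k)
  case 0
  have "M ^\<^sub>m 0 = 1\<^sub>m n" using M by simp
  then show ?case using transpose_op_one[OF x] by simp
next
  case (Suc k)
  have "M ^\<^sub>m Suc k = M ^\<^sub>m k * M" by simp
  then show ?case using transpose_op_mult[OF pow_carrier_mat[OF M, of k] M, of x] Suc by simp
qed

definition op_tuple :: "nat \<Rightarrow> nat \<Rightarrow> (nat \<Rightarrow> complex mat) \<Rightarrow> nat \<Rightarrow> cvec \<Rightarrow> cvec" where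
  "op_tuple d n T i = (if i < d then transpose_op n (T i) else (\<lambda>_. 0))"

lemma commuting_op_tuple:
  assumes "\<And>i. i < d \<Longrightarrow> T i \<in> carrier_mat n n" "\<And>i j. i < d \<Longrightarrow> j < d \<Longrightarrow> T i * T j = T j * T i"
  shows "commuting (op_tuple d n T)"
  unfolding commuting_def
proof (intro conjI allI)
  fix i j x
  show "lin (op_tuple d n T i)" by (auto simp: op_tuple_def lin_transpose_op) (simp add: lin_def)
  show "op_tuple d n T i (op_tuple d n T j x) = op_tuple d n T j (op_tuple d n T i x)"
  proof (cases "i < d \<and> j < d")
    case True
    then show ?thesis
      using transpose_op_mult[of "T i" n "T j" x] transpose_op_mult[of "T j" n "T i" x] assms by (simp add: op_tuple_def)
  next
    case False
    then show ?thesis by (auto simp: op_tuple_def lin_zero[OF lin_transpose_op])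
  qed
qed

lemma invariant_op_tuple: "invariant (op_tuple d n T) (supported n)"
  unfolding invariant_def op_tuple_def
  using transpose_op_supported V.subspace_0[OF subspace_supported] by auto

text \<open>
  Transposition reverses the order of the factors, and commutativity restores it.
\<close>

lemma transpose_op_monom_mat:
  assumes T: "\<And>i. i < d \<Longrightarrow> T i \<in> carrier_mat n n" "\<And>i j. i < d \<Longrightarrow> j < d \<Longrightarrow> T i * T j = T j * T i"
    and x: "x \<in> supported n"
  shows "transpose_op n (monom_mat d n m T) x = monom_op d (op_tuple d n T) m x"
proof -
  let ?l = "Poly_Mapping.lookup m" and ?A = "op_tuple d n T"
  have cA: "commuting ?A" using T by (rule commuting_op_tuple)
  have "foldr (\<lambda>i M. (T i ^\<^sub>m ?l i) * M) js (1\<^sub>m n) \<in> carrier_mat n n \<and>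
    (\<forall>x\<in>supported n. transpose_op n (foldr (\<lambda>i M. (T i ^\<^sub>m ?l i) * M) js (1\<^sub>m n)) x = fold (\<lambda>i. ?A i ^^ ?l i) js x)"
    if "set js \<subseteq> {..<d}" for js
    using that
  proof (induction js)
    case Nil
    then show ?case by (simp add: transpose_op_one)
  next
    case (Cons i js)
    have i: "i < d" using Cons.prems by simp
    let ?F = "foldr (\<lambda>i M. (T i ^\<^sub>m ?l i) * M) js (1\<^sub>m n)"
    have F: "?F \<in> carrier_mat n n" and
      IH: "\<And>x. x \<in> supported n \<Longrightarrow> transpose_op n ?F x = fold (\<lambda>i. ?A i ^^ ?l i) js x" using Cons by auto
    have P: "T i ^\<^sub>m ?l i \<in> carrier_mat n n" using T(1)[OF i] by (rule pow_carrier_mat)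
    have "transpose_op n (T i ^\<^sub>m ?l i * ?F) x = fold (\<lambda>i. ?A i ^^ ?l i) js ((?A i ^^ ?l i) x)" if x: "x \<in> supported n" for x
    proof -
      have "transpose_op n (T i ^\<^sub>m ?l i * ?F) x = transpose_op n ?F (transpose_op n (T i ^\<^sub>m ?l i) x)" by (rule transpose_op_mult[OF P F])
      also have "\<dots> = fold (\<lambda>i. ?A i ^^ ?l i) js (transpose_op n (T i ^\<^sub>m ?l i) x)" by (rule IH[OF transpose_op_supported])
      also have "transpose_op n (T i ^\<^sub>m ?l i) x = (?A i ^^ ?l i) x"
        using transpose_op_power[OF T(1)[OF i] x] i by (simp add: op_tuple_def)
      finally show ?thesis .
    qed
    then show ?case using P F by simp
  qed
  moreover have "set [0..<d] \<subseteq> {..<d}" by auto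
  ultimately have "transpose_op n (monom_mat d n m T) x = fold (\<lambda>i. ?A i ^^ ?l i) [0..<d] x"
    unfolding monom_mat_def using x by blast
  also have "fold (\<lambda>i. ?A i ^^ ?l i) [0..<d] = foldr (\<lambda>i. ?A i ^^ ?l i) [0..<d]"
  proof (rule foldr_fold[symmetric])
    fix i j
    have 1: "?A i ((?A j ^^ l) y) = (?A j ^^ l) (?A i y)" for l y
      using funpow_commute[of "?A j" "?A i" l y] commuting_commute[OF cA, of j i] by simp
    have "(?A j ^^ ?l j) ((?A i ^^ ?l i) y) = (?A i ^^ ?l i) ((?A j ^^ ?l j) y)" for y
      using funpow_commute[of "?A i" "?A j ^^ ?l j" "?l i" y] 1 by simp
    then show "(?A j ^^ ?l j) \<circ> (?A i ^^ ?l i) = (?A i ^^ ?l i) \<circ> (?A j ^^ ?l j)" by (simp add: fun_eq_iff)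
  qed
  also have "foldr (\<lambda>i. ?A i ^^ ?l i) [0..<d] x = monom_op d ?A m x" by (simp add: monom_op_def)
  finally show ?thesis .
qed

lemma transpose_op_poly_mat:
  assumes T: "\<And>i. i < d \<Longrightarrow> T i \<in> carrier_mat n n" "\<And>i j. i < d \<Longrightarrow> j < d \<Longrightarrow> T i * T j = T j * T i"
    and x: "x \<in> supported n"
  shows "transpose_op n (poly_mat d n p T) x = ev d (op_tuple d n T) p x"
proof -
  let ?K = "Poly_Mapping.keys p" and ?l = "Poly_Mapping.lookup p"
  have "ev d (op_tuple d n T) p x = (\<Sum>m\<in>?K. smul (?l m) (transpose_op n (monom_mat d n m T) x))"
    unfolding ev_def by (intro sum.cong refl) (simp add: transpose_op_monom_mat[OF T x])
  also have "\<dots> = transpose_op n (poly_mat d n p T) x"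
  proof (rule cvec_eqI)
    fix r
    show "coord (\<Sum>m\<in>?K. smul (?l m) (transpose_op n (monom_mat d n m T) x)) r = coord (transpose_op n (poly_mat d n p T) x) r"
    proof (cases "r < n")
      case True
      have "coord (transpose_op n (poly_mat d n p T) x) r = (\<Sum>c<n. \<Sum>m\<in>?K. ?l m * (monom_mat d n m T $$ (c, r) * coord x c))"
        unfolding coord_transpose_op[OF True] using True
        by (intro sum.cong refl) (simp add: poly_mat_def sum_distrib_right mult.assoc)
      also have "\<dots> = (\<Sum>m\<in>?K. \<Sum>c<n. ?l m * (monom_mat d n m T $$ (c, r) * coord x c))" by (rule sum.swap)
      finally show ?thesis using True by (simp add: lookup_sum coord_transpose_op sum_distrib_left)
    qed (simp add: lookup_sum transpose_op_def)
  qed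
  finally show ?thesis ..
qed

lemma vec_index_mult_mat_vec:
  "M \<in> carrier_mat n n \<Longrightarrow> v \<in> carrier_vec n \<Longrightarrow> r < n \<Longrightarrow> vec_index (M *\<^sub>v v) r = (\<Sum>c<n. M $$ (r, c) * vec_index v c)"
  by (simp add: scalar_prod_def atLeast0LessThan)

lemma vnorm_nrm: "v \<in> carrier_vec n \<Longrightarrow> vnorm v = nrm n (vec_of n (vec_index v))"
  unfolding vnorm_def nrm_def by (rule L2_set_cong) auto

lemma cauchy_schwarz_sum:
  "cmod (\<Sum>i<n. a i * b i) \<le> L2_set (\<lambda>i. cmod (a i)) {..<n} * L2_set (\<lambda>i. cmod (b i)) {..<n}"
proof -
  have "cmod (\<Sum>i<n. a i * b i) \<le> (\<Sum>i<n. \<bar>cmod (a i)\<bar> * \<bar>cmod (b i)\<bar>)"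
    using norm_sum[of "\<lambda>i. a i * b i" "{..<n}"] by (simp add: norm_mult)
  also have "\<dots> \<le> L2_set (\<lambda>i. cmod (a i)) {..<n} * L2_set (\<lambda>i. cmod (b i)) {..<n}"
    by (rule L2_set_mult_ineq)
  finally show ?thesis .
qed

text \<open>
  A matrix and its transpose have the same norm.
\<close>

lemma op_norm_le_transpose:
  assumes M: "M \<in> carrier_mat n n" and K: "0 \<le> K" "\<And>x. x \<in> supported n \<Longrightarrow> nrm n (transpose_op n M x) \<le> K * nrm n x"
  shows "op_norm M \<le> K"
  unfolding op_norm_def
proof (rule cSUP_least)
  have "vnorm (0\<^sub>v n) \<le> 1" by (simp add: vnorm_def L2_set_def)
  then have "0\<^sub>v n \<in> {v \<in> carrier_vec (dim_col M). vnorm v \<le> 1}" using M by simp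
  then show "{v \<in> carrier_vec (dim_col M). vnorm v \<le> 1} \<noteq> {}" by blast
  fix v assume "v \<in> {v \<in> carrier_vec (dim_col M). vnorm v \<le> 1}"
  then have v: "v \<in> carrier_vec n" "vnorm v \<le> 1" using M by auto
  define u where "u = M *\<^sub>v v"
  have u: "u \<in> carrier_vec n" unfolding u_def using M v by simp
  define w where "w = vec_of n (\<lambda>i. cnj (vec_index u i))"
  have w: "w \<in> supported n" by (simp add: w_def supported_def)
  have nw: "nrm n w = vnorm u" unfolding vnorm_nrm[OF u] nrm_def by (rule L2_set_cong) (auto simp: w_def)
  have "complex_of_real ((vnorm u)\<^sup>2) = (\<Sum>r<n. vec_index u r * cnj (vec_index u r))"
    unfolding vnorm_nrm[OF u] nrm_power2 of_real_sum
    by (intro sum.cong refl) (simp add: complex_norm_square del: of_real_power)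
  also have "\<dots> = (\<Sum>r<n. \<Sum>c<n. vec_index v c * (M $$ (r, c) * coord w r))"
    using vec_index_mult_mat_vec[OF M v(1)] by (intro sum.cong refl) (simp add: u_def[symmetric] w_def sum_distrib_right mult_ac)
  also have "\<dots> = (\<Sum>c<n. \<Sum>r<n. vec_index v c * (M $$ (r, c) * coord w r))" by (rule sum.swap)
  also have "\<dots> = (\<Sum>c<n. vec_index v c * coord (transpose_op n M w) c)"
    by (intro sum.cong refl) (simp add: coord_transpose_op sum_distrib_left)
  finally have "cmod (complex_of_real ((vnorm u)\<^sup>2)) \<le> vnorm v * nrm n (transpose_op n M w)"
    using cauchy_schwarz_sum[of "\<lambda>c. vec_index v c" "\<lambda>c. coord (transpose_op n M w) c" n] v(1)
    by (simp add: vnorm_def nrm_def)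
  also have "\<dots> \<le> 1 * (K * vnorm u)" using v(2) K(2)[OF w] unfolding nw by (intro mult_mono) auto
  finally have "vnorm u * vnorm u \<le> K * vnorm u" by (simp only: norm_of_real abs_power2 power2_eq_square mult_1)
  moreover have "0 \<le> vnorm u" using nrm_nonneg[of n w] by (simp add: nw)
  ultimately have "vnorm u \<le> K" using K(1) by (cases "vnorm u = 0") auto
  then show "vnorm (M *\<^sub>v v) \<le> K" by (simp add: u_def)
qed

lemma vnorm_smult: "vnorm (c \<cdot>\<^sub>v v) = cmod c * vnorm v"
proof -
  have "vnorm (c \<cdot>\<^sub>v v) = L2_set (\<lambda>i. cmod c * cmod (vec_index v i)) {..<dim_vec v}"
    unfolding vnorm_def by (rule L2_set_cong) (auto simp: norm_mult)
  then show ?thesis by (simp add: vnorm_def L2_set_right_distrib)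
qed

text \<open>
  The work lies in showing that the supremum which defines the norm is taken over a bounded set.
\<close>

lemma vnorm_mult_mat_vec_le:
  assumes M: "M \<in> carrier_mat n n" and v: "v \<in> carrier_vec n"
  shows "vnorm (M *\<^sub>v v) \<le> op_norm M * vnorm v"
proof -
  let ?U = "{v \<in> carrier_vec (dim_col M). vnorm v \<le> 1}"
  have bdd: "bdd_above ((\<lambda>v. vnorm (M *\<^sub>v v)) ` ?U)"
  proof (rule bdd_aboveI2)
    fix u assume "u \<in> ?U"
    then have u: "u \<in> carrier_vec n" "vnorm u \<le> 1" using M by auto
    have "vnorm (M *\<^sub>v u) \<le> (\<Sum>r<n. cmod (vec_index (M *\<^sub>v u) r))"
      unfolding vnorm_def using M L2_set_le_sum[of "{..<n}" "\<lambda>r. cmod (vec_index (M *\<^sub>v u) r)"] by simp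
    also have "\<dots> \<le> (\<Sum>r<n. \<Sum>c<n. cmod (M $$ (r, c)))"
    proof (rule sum_mono)
      fix r assume r: "r \<in> {..<n}"
      have "cmod (vec_index (M *\<^sub>v u) r) \<le> (\<Sum>c<n. cmod (M $$ (r, c) * vec_index u c))"
        using vec_index_mult_mat_vec[OF M u(1)] r norm_sum[of "\<lambda>c. M $$ (r, c) * vec_index u c" "{..<n}"] by simp
      also have "\<dots> \<le> (\<Sum>c<n. cmod (M $$ (r, c)) * 1)"
        unfolding norm_mult
      proof (intro sum_mono mult_left_mono)
        fix c assume "c \<in> {..<n}"
        then have "cmod (vec_index u c) \<le> vnorm u"
          using fun_norm_entry[of c n "\<lambda>i. vec_index u i"] vnorm_eq_fun_norm[OF u(1)] by simp
        then show "cmod (vec_index u c) \<le> 1" using u(2) by linarith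
      qed simp
      finally show "cmod (vec_index (M *\<^sub>v u) r) \<le> (\<Sum>c<n. cmod (M $$ (r, c)))" by simp
    qed
    finally show "vnorm (M *\<^sub>v u) \<le> (\<Sum>r<n. \<Sum>c<n. cmod (M $$ (r, c)))" .
  qed
  have le: "vnorm (M *\<^sub>v u) \<le> op_norm M" if "u \<in> carrier_vec n" "vnorm u \<le> 1" for u
    unfolding op_norm_def using that M by (intro cSUP_upper[OF _ bdd]) auto
  show ?thesis
  proof (cases "vnorm v = 0")
    case True
    have "cmod (vec_index v c) = 0" if "c < n" for c
      using fun_norm_entry[OF that, of "\<lambda>i. vec_index v i"] vnorm_eq_fun_norm[OF v] True by simp
    then have "vnorm (M *\<^sub>v v) = 0"
      using vec_index_mult_mat_vec[OF M v] M by (simp add: vnorm_def L2_set_def)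
    then show ?thesis using True by simp
  next
    case False
    then have pos: "0 < vnorm v" using fun_norm_nonneg[of n "\<lambda>i. vec_index v i"] vnorm_eq_fun_norm[OF v] by linarith
    define u where "u = complex_of_real (1 / vnorm v) \<cdot>\<^sub>v v"
    have "vnorm (M *\<^sub>v u) \<le> op_norm M"
      using v pos by (intro le) (simp_all add: u_def vnorm_smult norm_divide)
    moreover have "M *\<^sub>v u = complex_of_real (1 / vnorm v) \<cdot>\<^sub>v (M *\<^sub>v v)"
      unfolding u_def using M v by (rule mult_mat_vec)
    ultimately have "vnorm (M *\<^sub>v v) / vnorm v \<le> op_norm M" using pos by (simp add: vnorm_smult norm_divide)
    then show ?thesis using pos by (simp add: pos_divide_le_eq)
  qed
qed

text \<open>
  With $v = \bar x$, the sum of the squared norms of $T_i^{\mathsf T} x$ is $x^{\mathsf T} M v$ for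
  $M = \sum_i T_i T_i^*$.
\<close>

lemma col_contraction_op_tuple:
  assumes T: "commuting_row_contraction d n T"
  shows "col_contraction d n (op_tuple d n T) (supported n)"
  unfolding col_contraction_def
proof
  fix x
  have car: "T i \<in> carrier_mat n n" if "i < d" for i using T that by (simp add: commuting_row_contraction_def)
  define M where "M = Matrix.mat n n (\<lambda>(r, c). \<Sum>i<d. (T i * mat_adjoint (T i)) $$ (r, c))"
  have M: "M \<in> carrier_mat n n" by (simp add: M_def)
  have M1: "op_norm M \<le> 1" using T by (simp add: commuting_row_contraction_def M_def)
  define v where "v = Matrix.vec n (\<lambda>i. cnj (coord x i))"
  have v: "v \<in> carrier_vec n" by (simp add: v_def)
  have norm_v: "vnorm v = nrm n x" unfolding vnorm_def nrm_def by (rule L2_set_cong) (auto simp: v_def)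
  have adj: "(T i * mat_adjoint (T i)) $$ (c, e) = (\<Sum>r<n. T i $$ (c, r) * cnj (T i $$ (e, r)))"
    if "i < d" "c < n" "e < n" for i c e
    using car[OF that(1)] that(2,3)
    by (simp add: mat_adjoint_def scalar_prod_def atLeast0LessThan mat_of_rows_index)
  have "complex_of_real (\<Sum>i<d. (nrm n (op_tuple d n T i x))\<^sup>2)
    = (\<Sum>i<d. \<Sum>r<n. (\<Sum>c<n. T i $$ (c, r) * coord x c) * cnj (\<Sum>e<n. T i $$ (e, r) * coord x e))"
    unfolding nrm_power2 of_real_sum
    by (intro sum.cong refl) (simp add: op_tuple_def coord_transpose_op complex_norm_square del: of_real_power cnj_sum)
  also have "\<dots> = (\<Sum>i<d. \<Sum>r<n. \<Sum>c<n. \<Sum>e<n. coord x c * (T i $$ (c, r) * cnj (T i $$ (e, r)) * vec_index v e))"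
    unfolding cnj_sum sum_product by (intro sum.cong refl) (simp add: v_def mult_ac)
  also have "\<dots> = (\<Sum>i<d. \<Sum>c<n. \<Sum>r<n. \<Sum>e<n. coord x c * (T i $$ (c, r) * cnj (T i $$ (e, r)) * vec_index v e))"
    by (intro sum.cong refl sum.swap)
  also have "\<dots> = (\<Sum>c<n. \<Sum>i<d. \<Sum>r<n. \<Sum>e<n. coord x c * (T i $$ (c, r) * cnj (T i $$ (e, r)) * vec_index v e))"
    by (rule sum.swap)
  also have "\<dots> = (\<Sum>c<n. \<Sum>i<d. \<Sum>e<n. \<Sum>r<n. coord x c * (T i $$ (c, r) * cnj (T i $$ (e, r)) * vec_index v e))"
    by (intro sum.cong refl sum.swap)
  also have "\<dots> = (\<Sum>c<n. \<Sum>e<n. \<Sum>i<d. \<Sum>r<n. coord x c * (T i $$ (c, r) * cnj (T i $$ (e, r)) * vec_index v e))"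
    by (intro sum.cong refl sum.swap)
  also have "\<dots> = (\<Sum>c<n. coord x c * vec_index (M *\<^sub>v v) c)"
  proof (rule sum.cong[OF refl])
    fix c assume c: "c \<in> {..<n}"
    have "vec_index (M *\<^sub>v v) c = (\<Sum>e<n. \<Sum>i<d. \<Sum>r<n. T i $$ (c, r) * cnj (T i $$ (e, r)) * vec_index v e)"
      unfolding vec_index_mult_mat_vec[OF M v lessThan_iff[THEN iffD1, OF c]]
      using c by (intro sum.cong refl) (simp add: M_def adj sum_distrib_right)
    then show "(\<Sum>e<n. \<Sum>i<d. \<Sum>r<n. coord x c * (T i $$ (c, r) * cnj (T i $$ (e, r)) * vec_index v e)) = coord x c * vec_index (M *\<^sub>v v) c"
      by (simp only: sum_distrib_left)
  qed
  finally have "cmod (complex_of_real (\<Sum>i<d. (nrm n (op_tuple d n T i x))\<^sup>2)) \<le> nrm n x * vnorm (M *\<^sub>v v)"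
    using cauchy_schwarz_sum[of "\<lambda>c. coord x c" "\<lambda>c. vec_index (M *\<^sub>v v) c" n] M
    by (simp add: vnorm_def nrm_def)
  also have "\<dots> \<le> nrm n x * (1 * nrm n x)"
  proof (rule mult_left_mono)
    have "vnorm (M *\<^sub>v v) \<le> op_norm M * nrm n x" using vnorm_mult_mat_vec_le[OF M v] by (simp add: norm_v)
    also have "\<dots> \<le> 1 * nrm n x" using M1 by (intro mult_right_mono) auto
    finally show "vnorm (M *\<^sub>v v) \<le> 1 * nrm n x" .
  qed simp
  finally have "\<bar>\<Sum>i<d. (nrm n (op_tuple d n T i x))\<^sup>2\<bar> \<le> nrm n x * nrm n x" by (simp only: norm_of_real mult_1)
  then show "(\<Sum>i<d. (nrm n (op_tuple d n T i x))\<^sup>2) \<le> (nrm n x)\<^sup>2" by (simp add: power2_eq_square)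
qed

text \<open>
  Either the given $d$ variables are used or they are replaced by $N$ new ones.
\<close>

lemma von_neumann_matrix:
  assumes C: "gleason_constant N c" "0 < c" and N: "1 \<le> N" "N = d \<or> n\<^sup>2 div 4 + 1 \<le> N" and n: "1 \<le> n"
    and T: "commuting_row_contraction d n T" and p: "p \<in> polys d"
  shows "op_norm (poly_mat d n p T) \<le> (2 * (c * sqrt (real N))) ^ (n - 1) * sup_norm d (poly_eval d p)"
proof -
  define M where "M = 2 * c * sqrt (real N)"
  have c1: "1 \<le> c" using gleason_constant_ge_1[OF C(1) less_imp_le[OF C(2)] N(1)] .
  have "1 \<le> sqrt (real N)" using N(1) by simp
  then have "1 * 1 \<le> c * sqrt (real N)" using c1 by (intro mult_mono) auto
  then have M: "2 \<le> M" by (simp add: M_def)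
  have car: "T i \<in> carrier_mat n n" if "i < d" for i using T that by (simp add: commuting_row_contraction_def)
  have com: "T i * T j = T j * T i" if "i < d" "j < d" for i j using T that by (simp add: commuting_row_contraction_def)
  let ?A = "op_tuple d n T" and ?S = "sup_norm d (poly_eval d p)" and ?Y = "supported n"
  have cA: "commuting ?A" using car com by (rule commuting_op_tuple)
  have iA: "invariant ?A ?Y" by (rule invariant_op_tuple)
  have contr: "col_contraction d n ?A ?Y" using T by (rule col_contraction_op_tuple)
  have S: "ball_bound d p ?S"
    unfolding ball_bound_def
  proof
    fix z assume "z \<in> fun_ball d"
    then show "cmod (pe d p z) \<le> ?S"
      using sup_norm_ge[OF poly_eval_H_inf, of "Matrix.vec d z" d p] by (simp add: vec_mem_unit_ball poly_eval_vec)
  qed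
  have main: "nrm n (ev d ?A p x) \<le> bound_const M (V.dim ?Y) * ?S * nrm n x" if x: "x \<in> ?Y" for x
  proof (cases "N = d")
    case True
    show ?thesis
      by (rule von_neumann_subspace[OF C(1)[unfolded True] less_imp_le[OF C(2)] _ _ M fin_subspace_supported order_refl cA iA contr p S x])
        (use N True in \<open>simp_all add: M_def\<close>)
  next
    case False
    obtain \<Phi> where \<Phi>: "finite \<Phi>" "card \<Phi> \<le> (V.dim ?Y)\<^sup>2 div 4 + 1" "determined_by d ?A ?Y \<Phi>"
      using commuting_determined[OF fin_subspace_supported cA iA] by blast
    have "(V.dim ?Y)\<^sup>2 div 4 \<le> n\<^sup>2 div 4" by (intro div_le_mono power_mono dim_supported) simp
    then have "card \<Phi> \<le> N" using \<Phi>(2) N(2) False by linarith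
    then show ?thesis
    proof (rule reduce_variables[OF cA subspace_supported iA contr \<Phi>(1) _ \<Phi>(3)])
      fix R assume R: "commuting R" "invariant R ?Y" "col_contraction N n R ?Y"
        and sub: "\<And>p S. ball_bound d p S \<Longrightarrow> \<exists>h\<in>polys N. ball_bound N h S \<and> (\<forall>y\<in>?Y. ev d ?A p y = ev N R h y)"
      obtain h where h: "h \<in> polys N" "ball_bound N h ?S" "\<forall>y\<in>?Y. ev d ?A p y = ev N R h y" using sub[OF S] by blast
      have "nrm n (ev N R h x) \<le> bound_const M (V.dim ?Y) * ?S * nrm n x"
        by (rule von_neumann_subspace[OF C(1) less_imp_le[OF C(2)] N(1) M_def M fin_subspace_supported order_refl R h(1,2) x])
      then show ?thesis using h(3) x by simp
    qed
  qed
  have K: "bound_const M (V.dim ?Y) \<le> M ^ (n - 1)"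
  proof -
    have "bound_const M (V.dim ?Y) \<le> bound_const M n" by (rule bound_const_mono[OF M dim_supported])
    also have "\<dots> \<le> M ^ (n - 1)"
    proof (cases "n = 1")
      case False
      then show ?thesis using bound_const_le_power[OF M, of n] n by linarith
    qed (simp add: bound_const.simps)
    finally show ?thesis .
  qed
  have S0: "0 \<le> ?S" using ball_bound_nonneg[OF S] .
  have "op_norm (poly_mat d n p T) \<le> M ^ (n - 1) * ?S"
  proof (rule op_norm_le_transpose)
    show "poly_mat d n p T \<in> carrier_mat n n" by (simp add: poly_mat_def)
    show "0 \<le> M ^ (n - 1) * ?S" using M S0 by simp
    fix x assume x: "x \<in> ?Y"
    have "nrm n (transpose_op n (poly_mat d n p T) x) \<le> bound_const M (V.dim ?Y) * ?S * nrm n x"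
      using main[OF x] transpose_op_poly_mat[OF car com x] by simp
    also have "\<dots> \<le> M ^ (n - 1) * ?S * nrm n x" using K S0 by (intro mult_right_mono) auto
    finally show "nrm n (transpose_op n (poly_mat d n p T) x) \<le> M ^ (n - 1) * ?S * nrm n x" .
  qed
  then show ?thesis by (simp only: M_def mult.assoc)
qed

theorem theorem4p7:
  fixes d n n' :: nat and C :: "nat \<Rightarrow> real"
  assumes "d \<ge> 1" and "n \<ge> 1"
    and "n' = nat \<lfloor>(real n)^2 / 4\<rfloor> + 1"
    and "\<And>k. k \<ge> 1 \<Longrightarrow> C k > 0"
    and "\<And>k. k \<ge> 1 \<Longrightarrow> gleason_constant k (C k)"
  shows "\<exists>K::real.
    K \<le> (2 * min (C d * sqrt (real d)) (C n' * sqrt (real n'))) ^ (n - 1) \<and>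
    (\<forall>T. commuting_row_contraction d n T \<longrightarrow>
      (\<forall>p\<in>polys d. op_norm (poly_mat d n p T) \<le> K * sup_norm d (poly_eval d p)))"
proof -
  have "\<lfloor>real (n\<^sup>2) / real 4\<rfloor> = int (n\<^sup>2 div 4)" by (rule floor_divide_of_nat_eq)
  then have n': "n' = n\<^sup>2 div 4 + 1" using assms(3) by simp
  obtain N where N: "1 \<le> N" "N = d \<or> n\<^sup>2 div 4 + 1 \<le> N"
    "C N * sqrt (real N) = min (C d * sqrt (real d)) (C n' * sqrt (real n'))"
  proof (cases "C d * sqrt (real d) \<le> C n' * sqrt (real n')")
    case True
    then show thesis using assms(1) by (intro that[of d]) auto
  next
    case False
    then show thesis by (intro that[of n']) (auto simp: n')
  qed
  show ?thesis
    unfolding N(3)[symmetric]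
  proof (intro exI[of _ "(2 * (C N * sqrt (real N))) ^ (n - 1)"] conjI order_refl allI impI ballI)
    fix T p assume "commuting_row_contraction d n T" "p \<in> polys d"
    then show "op_norm (poly_mat d n p T) \<le> (2 * (C N * sqrt (real N))) ^ (n - 1) * sup_norm d (poly_eval d p)"
      by (rule von_neumann_matrix[OF assms(5)[OF N(1)] assms(4)[OF N(1)] N(1,2) assms(2)])
  qed
qed

end
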